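(* Suppose $\lambda\in\mathbb{D}_p$ is exponentially transcendental. Then for all $x_1,\dots,x_n\in\mathbb{D}_p$ which are $\mathbb{Q}$-linearly independent we have $$\operatorname{tr.deg.}_{\mathbb{Q}(\lambda)}\mathbb{Q}(\lambda,\exp(x_1),\dots,\exp(x_n),\exp(\lambda x_1),\dots,\exp(\lambda x_n))\ge n.$$
   Context: $\mathbb{C}_p$ is the completion of an algebraic closure of $\mathbb{Q}_p$ with valuation $v$, $v(p)=1$; $\mathbb{D}_p=\{x\in\mathbb{C}_p:v(x)>1/(p-1)\}$ and $\exp(x)=\sum_{j\ge0}x^j/j!$ on $\mathbb{D}_p$. A field derivation $\partial:\mathbb{C}_p\to\mathbb{C}_p$ (an additive map satisfying the Leibniz rule) respects $\exp$ if $\partial(\exp(x))=\exp(x)\,\partial x$ for all $x\in\mathbb{D}_p$. Let $\Delta_{\exp}$ be the collection of all field derivations on $\mathbb{C}_p$ which respect $\exp$ and $C_{\exp}=\bigcap_{\partial\in\Delta_{\exp}}\ker\partial$. An element $\lambda\in\mathbb{C}_p$ is exponentially transcendental if $\lambda\notin C_{\exp}$. *)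

theory Defs
  imports
    "HOL-Analysis.Analysis"
    "HOL-Algebra.Algebraic_Closure_Type"
    "HOL-Algebra.Generated_Fields"
    "HOL-Library.Poly_Mapping"
    "HOL-Library.Extended_Nat"
begin

abbreviation the_field :: "'a::field ring" where
  "the_field \<equiv> ring_of_type_algebra"

definition is_completion_of :: "'a::metric_space set \<Rightarrow> 'a set \<Rightarrow> bool" where
  "is_completion_of E F \<longleftrightarrow> F \<subseteq> E \<and> E \<subseteq> closure F \<and> complete E"

text \<open>
  The ambient type is the completion of an algebraic closure \<open>Qpbar\<close> of \<open>Qp\<close>, where \<open>Qp\<close> is the
  completion of the rationals at \<open>p\<close>. The metric of the type is required to be the one
  induced by the valuation, so that the topological notions of the library (\<open>closure\<close>,
  \<open>complete\<close>, \<open>suminf\<close>) are the \<open>p\<close>-adic ones. Such a structure exists for every prime and is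
  unique up to an isometric isomorphism of fields.
\<close>

locale padic_complex_field =
  fixes p :: nat
    and v :: "'a::{field_char_0, metric_space} \<Rightarrow> ereal"
    and Qp Qpbar :: "'a set"
  assumes prime_p: "Factorial_Ring.prime p"
    and v_eq_infinity_iff: "v x = \<infinity> \<longleftrightarrow> x = 0"
    and v_not_minus_infinity: "v x \<noteq> -\<infinity>"
    and v_mult: "v (x * y) = v x + v y"
    and v_add: "min (v x) (v y) \<le> v (x + y)"
    and v_of_int: "k \<noteq> 0 \<Longrightarrow> v (of_int k) = ereal (real (multiplicity (int p) k))"
    and dist_eq: "x \<noteq> y \<Longrightarrow> dist x y = real p powr (- real_of_ereal (v (x - y)))"
    and Qp_completion: "is_completion_of Qp \<rat>"
    and Qpbar_closure: "algebraic_closure (the_field\<lparr>carrier := Qpbar\<rparr>) Qp"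
    and UNIV_completion: "is_completion_of UNIV Qpbar"

lemma (in padic_complex_field) v_p: "v (of_nat p) = 1"
proof -
  have "Factorial_Ring.prime (int p)"
    using prime_p by simp
  then have "multiplicity (int p) (int p) = 1" and "int p \<noteq> 0"
    by (auto intro!: multiplicity_self)
  then show ?thesis
    using v_of_int[of "int p"] by (simp add: one_ereal_def)
qed

definition exp_disc :: "nat \<Rightarrow> ('a \<Rightarrow> ereal) \<Rightarrow> 'a set" where
  "exp_disc p v = {x. v x > ereal (1 / (real p - 1))}"

definition padic_exp :: "'a::{field_char_0, metric_space} \<Rightarrow> 'a" where
  "padic_exp x = suminf (\<lambda>j. x ^ j / fact j)"

definition field_derivation :: "('a::field \<Rightarrow> 'a) \<Rightarrow> bool" where
  "field_derivation d \<longleftrightarrow>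
    (\<forall>x y. d (x + y) = d x + d y) \<and> (\<forall>x y. d (x * y) = x * d y + y * d x)"

definition exp_derivations ::
    "nat \<Rightarrow> ('a::{field_char_0, metric_space} \<Rightarrow> ereal) \<Rightarrow> ('a \<Rightarrow> 'a) set" where
  "exp_derivations p v = {d. field_derivation d \<and>
    (\<forall>x\<in>exp_disc p v. d (padic_exp x) = padic_exp x * d x)}"

definition exp_constants ::
    "nat \<Rightarrow> ('a::{field_char_0, metric_space} \<Rightarrow> ereal) \<Rightarrow> 'a set" where
  "exp_constants p v = (\<Inter>d\<in>exp_derivations p v. {x. d x = 0})"

definition exponentially_transcendental ::
    "nat \<Rightarrow> ('a::{field_char_0, metric_space} \<Rightarrow> ereal) \<Rightarrow> 'a \<Rightarrow> bool" where
  "exponentially_transcendental p v x \<longleftrightarrow> x \<notin> exp_constants p v"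

text \<open>
  A polynomial whose variables are named by elements of the field is a finitely supported
  map from monomials to coefficients, a monomial being a finitely supported map from
  variables to exponents. It is evaluated by giving each variable the element naming it.
\<close>

definition eval_at_names :: "(('a::field \<Rightarrow>\<^sub>0 nat) \<Rightarrow>\<^sub>0 'a) \<Rightarrow> 'a" where
  "eval_at_names q = (\<Sum>m\<in>Poly_Mapping.keys q.
     Poly_Mapping.lookup q m * (\<Prod>x\<in>Poly_Mapping.keys m. x ^ Poly_Mapping.lookup m x))"

definition alg_independent :: "'a::field set \<Rightarrow> 'a set \<Rightarrow> bool" where
  "alg_independent K S \<longleftrightarrow> (\<forall>q :: ('a \<Rightarrow>\<^sub>0 nat) \<Rightarrow>\<^sub>0 'a.
     (\<forall>m. Poly_Mapping.lookup q m \<in> K) \<and> (\<forall>m\<in>Poly_Mapping.keys q. Poly_Mapping.keys m \<subseteq> S) \<and>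
     eval_at_names q = 0 \<longrightarrow> q = 0)"

text \<open>
  The transcendence degree of \<open>L\<close> over a subfield \<open>K\<close>: the largest size of a subset of \<open>L\<close>
  algebraically independent over \<open>K\<close>. Finite subsets suffice, as subsets of independent sets
  are independent; all infinite degrees are identified.
\<close>

definition tr_deg :: "'a::field set \<Rightarrow> 'a set \<Rightarrow> enat" where
  "tr_deg K L = Sup {enat (card S) |S. finite S \<and> S \<subseteq> L \<and> alg_independent K S}"

text \<open>In characteristic 0, the subfield generated by \<open>S\<close> is the extension of the rationals by \<open>S\<close>.\<close>

abbreviation rat_adjoin :: "'a::field_char_0 set \<Rightarrow> 'a set" where
  "rat_adjoin S \<equiv> generate_field the_field S"

definition rat_independent :: "nat \<Rightarrow> (nat \<Rightarrow> 'a::field_char_0) \<Rightarrow> bool" where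
  "rat_independent n x \<longleftrightarrow> (\<forall>c :: nat \<Rightarrow> rat.
     (\<Sum>i=1..n. of_rat (c i) * x i) = 0 \<longrightarrow> (\<forall>i\<in>{1..n}. c i = 0))"

end

theory Submission
  imports Defs "HOL-Computational_Algebra.Formal_Laurent_Series" "Jordan_Normal_Form.Char_Poly"
    "HOL-Library.Function_Algebras"
begin

text \<open>
  Fix a derivation \<open>D\<close> respecting \<open>exp\<close> with \<open>D l \<noteq> 0\<close>, let \<open>C\<close> be its field of constants, and view
  differentials as functionals on the space of all derivations that vanish on \<open>C\<close>. Let \<open>V\<close> be the
  rational span of the \<open>x i\<close> and choose a set \<open>Y\<close> of elements \<open>x i\<close> and \<open>l x i\<close> that is a rational basis
  of \<open>V + l V\<close> modulo \<open>C\<close>. By Ax's theorem the differentials \<open>dy - d(exp y)/exp y\<close> with \<open>y\<close> in \<open>Y\<close> are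
  linearly independent, and since they all vanish at \<open>D\<close>, they stay so together with \<open>dl\<close>. If the \<open>d(x i)\<close> have
  rank \<open>r\<close> modulo \<open>dl\<close>, comparing dimensions gives at least \<open>card Y - r\<close> elements \<open>exp y\<close> whose
  differentials are independent modulo \<open>dl\<close>, and these are algebraically independent over \<open>\<rat>(l)\<close>.
  Finally \<open>card Y \<ge> n + r\<close> because \<open>l\<close> is transcendental over \<open>C\<close>.

  Ax's theorem is reduced, by the invariance of these differentials under the Lie derivative along
  \<open>D\<close>, to the statement that \<open>\<Sum>i. e i * du i / u i = dv\<close> with rationally independent constants \<open>e i\<close>
  forces all \<open>u i\<close> to be constant: one makes \<open>u = u i\<close> the only transcendental, takes traces down to
  \<open>K(u)\<close>, and compares residues at \<open>u = 0\<close>.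
\<close>

text \<open>If an integer combination of the x i and l x i is a constant of \<open>D\<close>, the
  same combination of the differentials dy - d(exp y)/exp y vanishes. This is why Ax's theorem is
  applied to a basis modulo \<open>C\<close>, and why the loss in passing to it has to be bounded.
  The comparison of dimensions works because d(l x) = l dx + x dl: the l x i add nothing to the span
  of dl and the d(x i), so whatever exceeds rank r + 1 has to come from the exp y. Traces enter
  because \<open>v\<close> and the u i are merely algebraic over K(u). The trace of a logarithmic
  derivative is the logarithmic derivative of the norm, so Laurent series at u = 0 can replace the
  places of a finite extension. The norm of u itself is u ^ n with n > 0, whereas the rational
  independence of the e i forces all orders at 0 to vanish. Of the p-adic setting the algebra uses
  only that exp has no zeros on the disc, that \<open>D\<close> respects it, and that the disc
  contains the l x i.\<close>

hide_const (open) up_ring.coeff up_ring.monom Polynomials.degree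

section \<open>Derivations\<close>

lemma field_derivation_add: "field_derivation d \<Longrightarrow> d (x + y) = d x + d y"
  and field_derivation_mult: "field_derivation d \<Longrightarrow> d (x * y) = x * d y + y * d x"
  by (simp_all add: field_derivation_def)

lemma field_derivation_0: "field_derivation d \<Longrightarrow> d 0 = 0"
  using field_derivation_add[of d 0 0] by (metis add_cancel_right_right add_0)

lemma field_derivation_1: "field_derivation d \<Longrightarrow> d 1 = 0"
  using field_derivation_mult[of d 1 1] by (metis add_cancel_right_right mult_1)

lemma field_derivation_minus: "field_derivation d \<Longrightarrow> d (- x) = - d x"
  using field_derivation_add[of d x "- x"] field_derivation_0[of d]
  by (metis add.right_inverse minus_unique)

lemma field_derivation_diff: "field_derivation d \<Longrightarrow> d (x - y) = d x - d y"
  using field_derivation_add[of d x "- y"] field_derivation_minus[of d y] by simp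

lemma field_derivation_sum: "field_derivation d \<Longrightarrow> d (sum f A) = (\<Sum>i\<in>A. d (f i))"
  by (induction A rule: infinite_finite_induct) (simp_all add: field_derivation_0 field_derivation_add)

lemma field_derivation_inverse:
  assumes "field_derivation d"
  shows "d (inverse x) = - d x / x\<^sup>2"
proof (cases "x = 0")
  case False
  then have "x * d (inverse x) + inverse x * d x = 0"
    using field_derivation_mult[OF assms, of x "inverse x"] field_derivation_1[OF assms] by simp
  with False show ?thesis
    by (simp add: field_simps power2_eq_square eq_neg_iff_add_eq_0)
qed (simp add: field_derivation_0[OF assms])

lemma field_derivation_divide:
  assumes "field_derivation d" and "y \<noteq> 0"
  shows "d (x / y) = (d x * y - x * d y) / y\<^sup>2"
proof -
  have "d (x / y) = x * (- d y / y\<^sup>2) + inverse y * d x"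
    by (simp add: divide_inverse field_derivation_mult[OF assms(1)]
        field_derivation_inverse[OF assms(1)])
  with assms(2) show ?thesis by (simp add: field_simps power2_eq_square)
qed

lemma field_derivation_power:
  "field_derivation d \<Longrightarrow> d (x ^ n) = of_nat n * x ^ (n - 1) * d x"
proof (induction n)
  case (Suc n)
  then show ?case
    by (cases n) (simp_all add: field_derivation_mult algebra_simps)
qed (simp add: field_derivation_1)

lemma log_derivative_prod:
  assumes d: "field_derivation d" and "finite A" and "\<And>i. i \<in> A \<Longrightarrow> f i \<noteq> 0"
  shows "d (prod f A) / prod f A = (\<Sum>i\<in>A. d (f i) / f i)"
  using assms(2,3)
proof (induction A rule: finite_induct)
  case (insert i A)
  then have "prod f A \<noteq> 0" and "f i \<noteq> 0" by auto
  then have "d (prod f (insert i A)) / prod f (insert i A) = d (f i) / f i + d (prod f A) / prod f A"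
    using insert.hyps by (simp add: field_derivation_mult[OF d] field_simps)
  with insert show ?case by simp
qed (simp add: field_derivation_1[OF d])

lemma log_derivative_power:
  assumes d: "field_derivation d" and "x \<noteq> 0"
  shows "d (x ^ n) / x ^ n = of_nat n * (d x / x)"
proof (cases n)
  case (Suc m)
  have "d (x ^ Suc m) = of_nat (Suc m) * x ^ m * d x"
    using field_derivation_power[OF d, of x "Suc m"] by simp
  with assms(2) Suc show ?thesis by simp
qed (simp add: field_derivation_1[OF d])

lemma log_derivative_power_int:
  assumes d: "field_derivation d" and x: "x \<noteq> 0"
  shows "d (x powi m) / x powi m = of_int m * (d x / x)"
proof (cases "m \<ge> 0")
  case True
  then show ?thesis
    using log_derivative_power[OF assms, of "nat m"] by (simp add: power_int_def)
next
  case False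
  have "d (inverse y) / inverse y = - (d y / y)" if "y \<noteq> 0" for y
    using that by (simp add: field_derivation_inverse[OF d] power2_eq_square)
  from this[of "x ^ nat (- m)"] show ?thesis
    using False x log_derivative_power[OF assms, of "nat (- m)"]
    by (simp add: power_int_def power_inverse)
qed

lemma field_derivation_of_nat: "field_derivation d \<Longrightarrow> d (of_nat n) = 0"
  by (induction n) (simp_all add: field_derivation_0 field_derivation_1 field_derivation_add)

lemma field_derivation_of_int:
  assumes "field_derivation d"
  shows "d (of_int m) = 0"
  by (cases m rule: int_cases2)
    (simp_all add: assms field_derivation_of_nat field_derivation_minus)

lemma field_derivation_of_rat:
  fixes d :: "'a::field_char_0 \<Rightarrow> 'a"
  assumes "field_derivation d"
  shows "d (of_rat q) = 0"
proof -
  obtain a b where "q = Rat.Fract a b" and "b \<noteq> 0" by (cases q) auto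
  then show ?thesis
    by (simp add: of_rat_rat field_derivation_divide[OF assms] field_derivation_of_int[OF assms])
qed

lemma field_derivation_of_rat_mult:
  fixes d :: "'a::field_char_0 \<Rightarrow> 'a"
  assumes "field_derivation d"
  shows "d (of_rat q * x) = of_rat q * d x"
  by (simp add: field_derivation_mult[OF assms] field_derivation_of_rat[OF assms])

text \<open>Chain rule. The first summand differentiates the coefficients: it vanishes over
  constants, and in general it determines the value at an algebraic element.\<close>

lemma field_derivation_poly:
  assumes "field_derivation d"
  shows "d (poly g a) = poly (map_poly d g) a + poly (pderiv g) a * d a"
proof (induction g rule: pCons_induct)
  case (pCons c g)
  then show ?case
    by (simp add: field_derivation_add[OF assms] field_derivation_mult[OF assms]
        map_poly_pCons field_derivation_0[OF assms] pderiv_pCons algebra_simps)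
qed (simp add: field_derivation_0[OF assms])

text \<open>The coefficients may be arbitrary: derivations form a vector space over the whole
  field.\<close>

lemma field_derivation_lincomb:
  "field_derivation d \<Longrightarrow> field_derivation e \<Longrightarrow> field_derivation (\<lambda>x. a * d x + b * e x)"
  by (simp add: field_derivation_def algebra_simps)

lemma field_derivation_commutator:
  assumes "field_derivation d" and "field_derivation e"
  shows "field_derivation (\<lambda>x. d (e x) - e (d x))"
  using assms by (simp add: field_derivation_def algebra_simps)


section \<open>Subfields and algebraic elements\<close>

text \<open>The clause on inverses makes no exception for 0, since
  \<open>inverse 0 = 0\<close>.\<close>

definition is_subfield :: "'a::field set \<Rightarrow> bool" where
  "is_subfield K \<longleftrightarrow> 0 \<in> K \<and> 1 \<in> K \<and> (\<forall>x\<in>K. \<forall>y\<in>K. x + y \<in> K) \<and> (\<forall>x\<in>K. - x \<in> K) \<and>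
    (\<forall>x\<in>K. \<forall>y\<in>K. x * y \<in> K) \<and> (\<forall>x\<in>K. inverse x \<in> K)"

lemma is_subfieldD:
  assumes "is_subfield K"
  shows "0 \<in> K" "1 \<in> K" "x \<in> K \<Longrightarrow> y \<in> K \<Longrightarrow> x + y \<in> K" "x \<in> K \<Longrightarrow> - x \<in> K"
    "x \<in> K \<Longrightarrow> y \<in> K \<Longrightarrow> x * y \<in> K" "x \<in> K \<Longrightarrow> inverse x \<in> K"
    "x \<in> K \<Longrightarrow> y \<in> K \<Longrightarrow> x - y \<in> K" "x \<in> K \<Longrightarrow> y \<in> K \<Longrightarrow> x / y \<in> K"
proof -
  show "0 \<in> K" "1 \<in> K" "x \<in> K \<Longrightarrow> y \<in> K \<Longrightarrow> x + y \<in> K" "x \<in> K \<Longrightarrow> - x \<in> K"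
    "x \<in> K \<Longrightarrow> y \<in> K \<Longrightarrow> x * y \<in> K" "x \<in> K \<Longrightarrow> inverse x \<in> K"
    using assms by (auto simp: is_subfield_def)
  show "x \<in> K \<Longrightarrow> y \<in> K \<Longrightarrow> x - y \<in> K"
    using assms unfolding is_subfield_def by (metis add_uminus_conv_diff)
  show "x \<in> K \<Longrightarrow> y \<in> K \<Longrightarrow> x / y \<in> K"
    using assms unfolding is_subfield_def by (metis divide_inverse)
qed

lemma is_subfield_sum: "is_subfield K \<Longrightarrow> (\<And>i. i \<in> A \<Longrightarrow> f i \<in> K) \<Longrightarrow> sum f A \<in> K"
  by (induction A rule: infinite_finite_induct) (auto intro: is_subfieldD)

lemma is_subfield_power: "is_subfield K \<Longrightarrow> x \<in> K \<Longrightarrow> x ^ n \<in> K"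
  by (induction n) (auto intro: is_subfieldD)

lemma is_subfield_of_nat: "is_subfield K \<Longrightarrow> of_nat n \<in> K"
  by (induction n) (auto intro: is_subfieldD)

lemma is_subfield_kernel:
  assumes "field_derivation d"
  shows "is_subfield {x. d x = 0}"
  unfolding is_subfield_def using assms
  by (auto simp: field_derivation_0 field_derivation_1 field_derivation_add field_derivation_minus
      field_derivation_mult field_derivation_inverse)

definition algebraic_in :: "'a::field set \<Rightarrow> 'a \<Rightarrow> bool" where
  "algebraic_in K a \<longleftrightarrow> (\<exists>g. g \<noteq> 0 \<and> (\<forall>i. coeff g i \<in> K) \<and> poly g a = 0)"

lemma algebraic_in_mono: "K \<subseteq> K' \<Longrightarrow> algebraic_in K a \<Longrightarrow> algebraic_in K' a"
  unfolding algebraic_in_def by blast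

lemma algebraic_in_mem:
  assumes "is_subfield K" and "a \<in> K"
  shows "algebraic_in K a"
  unfolding algebraic_in_def
  by (rule exI[of _ "[:- a, 1:]"])
    (use assms in \<open>auto simp: coeff_pCons is_subfieldD split: nat.splits\<close>)

lemma coeff_pderiv_in:
  assumes "is_subfield K" and "\<And>i. coeff g i \<in> K"
  shows "coeff (pderiv g) i \<in> K"
  unfolding coeff_pderiv using assms by (metis is_subfieldD(5) is_subfield_of_nat)

text \<open>A polynomial of least degree is separable at \<open>a\<close>: in characteristic 0 its
  derivative is nonzero of smaller degree, so it cannot vanish there.\<close>

lemma minimal_poly_exists:
  fixes a :: "'a::field_char_0"
  assumes "is_subfield K" and "algebraic_in K a"
  obtains g where "g \<noteq> 0" "\<And>i. coeff g i \<in> K" "poly g a = 0" "degree g > 0"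
    "\<And>h. h \<noteq> 0 \<Longrightarrow> (\<And>i. coeff h i \<in> K) \<Longrightarrow> poly h a = 0 \<Longrightarrow> degree g \<le> degree h"
    "poly (pderiv g) a \<noteq> 0"
proof -
  define P where "P g \<longleftrightarrow> g \<noteq> 0 \<and> (\<forall>i. coeff g i \<in> K) \<and> poly g a = 0" for g
  obtain g0 where "P g0" using assms(2) by (auto simp: algebraic_in_def P_def)
  then obtain g where g: "P g" and min: "\<And>h. P h \<Longrightarrow> degree g \<le> degree h"
    using ex_has_least_nat[of P g0 degree] by auto
  have deg: "degree g > 0"
  proof (rule ccontr)
    assume "\<not> degree g > 0"
    then obtain c where "g = [:c:]" by (auto elim: degree_eq_zeroE)
    with g show False by (auto simp: P_def)
  qed
  have "poly (pderiv g) a \<noteq> 0"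
  proof
    assume "poly (pderiv g) a = 0"
    moreover have "pderiv g \<noteq> 0" using deg by (simp add: pderiv_eq_0_iff)
    ultimately have "P (pderiv g)"
      using g coeff_pderiv_in[OF assms(1)] by (auto simp: P_def)
    then have "degree g \<le> degree (pderiv g)" by (rule min)
    with deg show False by (simp add: degree_pderiv)
  qed
  with g min deg show thesis by (intro that[of g]) (auto simp: P_def)
qed

text \<open>Applying \<open>d\<close> to g(a) = 0 for the minimal polynomial leaves g'(a) * d a = 0,
  and g'(a) is nonzero.\<close>

lemma algebraic_in_kernel:
  fixes a :: "'a::field_char_0"
  assumes d: "field_derivation d" and K: "is_subfield K" and "\<And>x. x \<in> K \<Longrightarrow> d x = 0"
    and "algebraic_in K a"
  shows "d a = 0"
proof -
  obtain g where g: "g \<noteq> 0" "\<And>i. coeff g i \<in> K" "poly g a = 0" "poly (pderiv g) a \<noteq> 0"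
    using minimal_poly_exists[OF K assms(4)] by metis
  have "map_poly d g = 0"
    using g(2) assms(3) by (intro poly_eqI) (simp add: coeff_map_poly field_derivation_0[OF d])
  then have "poly (pderiv g) a * d a = 0"
    using field_derivation_poly[OF d, of g a] g(3) by (simp add: field_derivation_0[OF d])
  with g(4) show ?thesis by simp
qed

section \<open>Extending derivations\<close>

text \<open>
  A derivation from a subring of a field into the field is the same thing as a subring of the
  dual numbers \<open>x + \<epsilon> y\<close>, here encoded as pairs \<open>(x, y)\<close>, that meets \<open>\<epsilon> F\<close> trivially.
\<close>

definition partial_derivation :: "('a::field \<times> 'a) set \<Rightarrow> bool" where
  "partial_derivation R \<longleftrightarrow> (0, 0) \<in> R \<and> (1, 0) \<in> R \<and> (\<forall>b. (0, b) \<in> R \<longrightarrow> b = 0) \<and>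
    (\<forall>a b c e. (a, b) \<in> R \<longrightarrow> (c, e) \<in> R \<longrightarrow> (a + c, b + e) \<in> R \<and> (a * c, a * e + c * b) \<in> R) \<and>
    (\<forall>a b. (a, b) \<in> R \<longrightarrow> (- a, - b) \<in> R)"

lemma partial_derivationD:
  assumes "partial_derivation R"
  shows "(0, 0) \<in> R" "(1, 0) \<in> R" "(0, b) \<in> R \<Longrightarrow> b = 0"
    "(a, b) \<in> R \<Longrightarrow> (c, e) \<in> R \<Longrightarrow> (a + c, b + e) \<in> R"
    "(a, b) \<in> R \<Longrightarrow> (c, e) \<in> R \<Longrightarrow> (a * c, a * e + c * b) \<in> R"
    "(a, b) \<in> R \<Longrightarrow> (- a, - b) \<in> R"
  using assms by (auto simp: partial_derivation_def)

lemma partial_derivation_unique: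
  assumes "partial_derivation R" and "(a, b) \<in> R" and "(a, c) \<in> R"
  shows "b = c"
proof -
  have "(a + - a, b + - c) \<in> R"
    using partial_derivationD(4)[OF assms(1) assms(2) partial_derivationD(6)[OF assms(1,3)]] .
  then have "b + - c = 0"
    by (intro partial_derivationD(3)[OF assms(1)]) simp
  then show ?thesis by simp
qed

lemma partial_derivation_sum:
  assumes "partial_derivation R" and "\<And>i. i \<in> A \<Longrightarrow> (f i, g i) \<in> R"
  shows "(sum f A, sum g A) \<in> R"
  using assms(2)
  by (induction A rule: infinite_finite_induct)
    (auto intro: partial_derivationD(1,4)[OF assms(1)])

text \<open>Pairs \<open>(g, h)\<close> of polynomials with coefficients in \<open>R\<close>, evaluated at \<open>\<alpha> + \<epsilon> \<beta>\<close>.\<close>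

definition dual_adjoin :: "('a::field \<times> 'a) set \<Rightarrow> 'a \<Rightarrow> 'a \<Rightarrow> ('a \<times> 'a) set" where
  "dual_adjoin R \<alpha> \<beta> =
    {(poly g \<alpha>, poly h \<alpha> + poly (pderiv g) \<alpha> * \<beta>) | g h. \<forall>i. (coeff g i, coeff h i) \<in> R}"

lemma dual_adjoin_superset:
  assumes "partial_derivation R"
  shows "R \<subseteq> dual_adjoin R \<alpha> \<beta>" and "(\<alpha>, \<beta>) \<in> dual_adjoin R \<alpha> \<beta>"
proof -
  show "R \<subseteq> dual_adjoin R \<alpha> \<beta>"
  proof (clarify)
    fix a b assume "(a, b) \<in> R"
    then show "(a, b) \<in> dual_adjoin R \<alpha> \<beta>"
      unfolding dual_adjoin_def using partial_derivationD(1)[OF assms]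
      by (intro CollectI exI[of _ "[:a:]"] exI[of _ "[:b:]"])
        (auto simp: coeff_pCons split: nat.splits)
  qed
  show "(\<alpha>, \<beta>) \<in> dual_adjoin R \<alpha> \<beta>"
    unfolding dual_adjoin_def using partial_derivationD(1,2)[OF assms]
    by (intro CollectI exI[of _ "[:0, 1:]"] exI[of _ "0"])
      (auto simp: coeff_pCons pderiv_pCons split: nat.splits)
qed

text \<open>\<open>triv\<close> says that the adjoined ring meets \<epsilon> F trivially. The rest
  is arithmetic over the dual numbers: the product of g + \<epsilon> h and g' + \<epsilon> h' has
  \<epsilon>-part g h' + g' h.\<close>

lemma partial_derivation_dual_adjoin:
  assumes R: "partial_derivation R"
    and triv: "\<And>g h. (\<And>i. (coeff g i, coeff h i) \<in> R) \<Longrightarrow> poly g \<alpha> = 0 \<Longrightarrow>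
      poly h \<alpha> + poly (pderiv g) \<alpha> * \<beta> = 0"
  shows "partial_derivation (dual_adjoin R \<alpha> \<beta>)"
  unfolding partial_derivation_def
proof (intro conjI allI impI)
  show "(0, 0) \<in> dual_adjoin R \<alpha> \<beta>" "(1, 0) \<in> dual_adjoin R \<alpha> \<beta>"
    using dual_adjoin_superset(1)[OF R] partial_derivationD(1,2)[OF R] by blast+
  show "b = 0" if "(0, b) \<in> dual_adjoin R \<alpha> \<beta>" for b
    using that triv unfolding dual_adjoin_def by fastforce
  show "(- a, - b) \<in> dual_adjoin R \<alpha> \<beta>" if "(a, b) \<in> dual_adjoin R \<alpha> \<beta>" for a b
  proof -
    obtain g h where "a = poly g \<alpha>" "b = poly h \<alpha> + poly (pderiv g) \<alpha> * \<beta>"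
      and "\<And>i. (coeff g i, coeff h i) \<in> R"
      using \<open>(a, b) \<in> dual_adjoin R \<alpha> \<beta>\<close> by (auto simp: dual_adjoin_def)
    then show ?thesis unfolding dual_adjoin_def using partial_derivationD(6)[OF R]
      by (intro CollectI exI[of _ "- g"] exI[of _ "- h"]) (auto simp: pderiv_minus)
  qed
  fix a b c e
  assume "(a, b) \<in> dual_adjoin R \<alpha> \<beta>" and "(c, e) \<in> dual_adjoin R \<alpha> \<beta>"
  then obtain g h g' h' where 1: "a = poly g \<alpha>" "b = poly h \<alpha> + poly (pderiv g) \<alpha> * \<beta>"
    "\<And>i. (coeff g i, coeff h i) \<in> R"
    and 2: "c = poly g' \<alpha>" "e = poly h' \<alpha> + poly (pderiv g') \<alpha> * \<beta>"
    "\<And>i. (coeff g' i, coeff h' i) \<in> R"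
    by (auto simp: dual_adjoin_def)
  show "(a + c, b + e) \<in> dual_adjoin R \<alpha> \<beta>"
    unfolding dual_adjoin_def using partial_derivationD(4)[OF R 1(3) 2(3)]
    by (intro CollectI exI[of _ "g + g'"] exI[of _ "h + h'"])
      (auto simp: 1 2 pderiv_add algebra_simps)
  have "(coeff (g * g') i, coeff (g * h' + g' * h) i) \<in> R" for i
  proof -
    have "coeff (g' * h) i = (\<Sum>j\<le>i. coeff g' (i - j) * coeff h j)"
      unfolding mult.commute[of g'] coeff_mult by (simp add: mult.commute)
    then have "coeff (g * h' + g' * h) i =
        (\<Sum>j\<le>i. coeff g j * coeff h' (i - j) + coeff g' (i - j) * coeff h j)"
      by (simp add: coeff_mult sum.distrib)
    then show ?thesis unfolding coeff_mult
      using partial_derivationD(5)[OF R 1(3) 2(3)] by (auto intro!: partial_derivation_sum[OF R])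
  qed
  then show "(a * c, a * e + c * b) \<in> dual_adjoin R \<alpha> \<beta>"
    unfolding dual_adjoin_def
    by (intro CollectI exI[of _ "g * g'"] exI[of _ "g * h' + g' * h"])
      (auto simp: 1 2 pderiv_mult algebra_simps)
qed

text \<open>The quotient rule extends \<open>R\<close> to all fractions, and by maximality nothing
  is gained; hence the domain of \<open>R\<close> is a field. As \<open>R'\<close> is a relation,
  well-definedness amounts to the check at first component 0.\<close>

lemma maximal_partial_derivation_inverse:
  assumes R: "partial_derivation R"
    and max: "\<And>R'. partial_derivation R' \<Longrightarrow> R \<subseteq> R' \<Longrightarrow> R' = R"
    and ab: "(a, b) \<in> R" and "a \<noteq> 0"
  shows "(inverse a, - b / a\<^sup>2) \<in> R"
proof -
  define R' where "R' = {(x / c, (y * c - x * e) / c\<^sup>2) | x y c e. (x, y) \<in> R \<and> (c, e) \<in> R \<and> c \<noteq> 0}"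
  have I: "(x / c, (y * c - x * e) / c\<^sup>2) \<in> R'" if "(x, y) \<in> R" "(c, e) \<in> R" "c \<noteq> 0" for x y c e
    using that by (auto simp: R'_def)
  have sub: "R \<subseteq> R'"
  proof clarify
    fix x y assume "(x, y) \<in> R"
    from I[OF this partial_derivationD(2)[OF R]] show "(x, y) \<in> R'" by simp
  qed
  have "partial_derivation R'"
    unfolding partial_derivation_def
  proof (intro conjI allI impI)
    show "(0, 0) \<in> R'" "(1, 0) \<in> R'" using sub partial_derivationD(1,2)[OF R] by blast+
    show "y = 0" if "(0, y) \<in> R'" for y
      using that partial_derivationD(3)[OF R] by (fastforce simp: R'_def)
    show "(- x, - y) \<in> R'" if xy: "(x, y) \<in> R'" for x y
    proof -
      obtain x1 y1 c e where *: "x = x1 / c" "y = (y1 * c - x1 * e) / c\<^sup>2" "(x1, y1) \<in> R"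
        "(c, e) \<in> R" "c \<noteq> 0"
        using xy by (auto simp: R'_def)
      have "(- y1 * c - - x1 * e) / c\<^sup>2 = - y" unfolding *
        by (metis (no_types, lifting) minus_diff_eq minus_divide_left minus_mult_left
            minus_diff_minus)
      then show ?thesis using I[OF partial_derivationD(6)[OF R *(3)] *(4,5)] * by simp
    qed
    fix x y x' y' assume "(x, y) \<in> R'" and "(x', y') \<in> R'"
    then obtain x1 y1 c e x1' y1' c' e' where
      1: "x = x1 / c" "y = (y1 * c - x1 * e) / c\<^sup>2" "(x1, y1) \<in> R" "(c, e) \<in> R" "c \<noteq> 0" and
      2: "x' = x1' / c'" "y' = (y1' * c' - x1' * e') / c'\<^sup>2" "(x1', y1') \<in> R" "(c', e') \<in> R" "c' \<noteq> 0"
      unfolding R'_def by blast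
    note mul = partial_derivationD(5)[OF R] and add = partial_derivationD(4)[OF R]
    have cc: "(c * c', c * e' + c' * e) \<in> R" "c * c' \<noteq> 0" using mul 1 2 by auto
    show "(x + x', y + y') \<in> R'"
      using I[OF add[OF mul[OF 1(3) 2(4)] mul[OF 1(4) 2(3)]] cc] 1(5) 2(5)
      by (simp add: 1(1,2) 2(1,2) field_simps power2_eq_square)
    have "((x1 * y1' + x1' * y1) * (c * c') - x1 * x1' * (c * e' + c' * e)) / (c * c')\<^sup>2 =
        x * y' + x' * y"
      using 1(5) 2(5) unfolding 1(1,2) 2(1,2) by (simp add: field_simps power2_eq_square)
    then show "(x * x', x * y' + x' * y) \<in> R'"
      using I[OF mul[OF 1(3) 2(3)] cc] unfolding 1(1) 2(1) by simp
  qed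
  then have "R' = R" using sub by (rule max)
  then show ?thesis
    using I[OF partial_derivationD(2)[OF R] ab \<open>a \<noteq> 0\<close>] \<open>a \<noteq> 0\<close> by (simp add: inverse_eq_divide)
qed

text \<open>Any \<open>\<alpha>\<close> can be adjoined to the domain, so a maximal \<open>R\<close>
  already has it there. If \<open>\<alpha>\<close> is transcendental over the domain, every value is
  admissible and 0 is taken; if it is algebraic, its minimal polynomial forces the value.\<close>

lemma maximal_partial_derivation_total:
  fixes R :: "('a::field_char_0 \<times> 'a) set"
  assumes R: "partial_derivation R"
    and max: "\<And>R'. partial_derivation R' \<Longrightarrow> R \<subseteq> R' \<Longrightarrow> R' = R"
  shows "\<exists>\<beta>. (\<alpha>, \<beta>) \<in> R"
proof -
  define k where "k = fst ` R"
  have kI: "a \<in> k" if "(a, b) \<in> R" for a b using that by (force simp: k_def)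
  have kE: "\<exists>b. (a, b) \<in> R" if "a \<in> k" for a using that by (force simp: k_def)
  have k: "is_subfield k"
    unfolding is_subfield_def
  proof (intro conjI ballI)
    show "0 \<in> k" "1 \<in> k" using partial_derivationD(1,2)[OF R] by (auto intro: kI)
    show "x + y \<in> k" "x * y \<in> k" if "x \<in> k" "y \<in> k" for x y
      using kE[OF that(1)] kE[OF that(2)] partial_derivationD(4,5)[OF R] by (blast intro: kI)+
    show "- x \<in> k" if "x \<in> k" for x
      using kE[OF that(1)] partial_derivationD(6)[OF R] by (blast intro: kI)
    show "inverse x \<in> k" if "x \<in> k" for x
      using kE[OF that(1)] maximal_partial_derivation_inverse[OF R max] that
      by (cases "x = 0") (auto intro: kI)
  qed
  obtain \<beta> where triv: "\<And>g h. (\<And>i. (coeff g i, coeff h i) \<in> R) \<Longrightarrow> poly g \<alpha> = 0 \<Longrightarrow>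
      poly h \<alpha> + poly (pderiv g) \<alpha> * \<beta> = 0"
  proof (cases "algebraic_in k \<alpha>")
    case False
    have "poly h \<alpha> + poly (pderiv g) \<alpha> * 0 = 0"
      if "\<And>i. (coeff g i, coeff h i) \<in> R" "poly g \<alpha> = 0" for g h
    proof -
      have "g = 0" using False that kI unfolding algebraic_in_def by blast
      then have "h = 0" using that(1) partial_derivationD(3)[OF R] by (intro poly_eqI) simp
      with \<open>g = 0\<close> show ?thesis by simp
    qed
    then show thesis by (rule that)
  next
    case True
    obtain P where P: "P \<noteq> 0" "\<And>i. coeff P i \<in> k" "poly P \<alpha> = 0" "degree P > 0"
      "\<And>h. h \<noteq> 0 \<Longrightarrow> (\<And>i. coeff h i \<in> k) \<Longrightarrow> poly h \<alpha> = 0 \<Longrightarrow> degree P \<le> degree h"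
      "poly (pderiv P) \<alpha> \<noteq> 0"
      using minimal_poly_exists[OF k True] by metis
    define d where "d a = (SOME b. (a, b) \<in> R)" for a
    have d: "(a, d a) \<in> R" if "a \<in> k" for a
      unfolding d_def using kE[OF that] by (rule someI_ex)
    have d0: "d 0 = 0"
      using d[of 0] is_subfieldD(1)[OF k] partial_derivationD(3)[OF R] by blast
    define Q where "Q = map_poly d P"
    have PQ: "(coeff P i, coeff Q i) \<in> R" for i
      unfolding Q_def using d P(2) by (simp add: coeff_map_poly d0)
    \<comment> \<open>The value forced by differentiating \<open>poly P \<alpha> = 0\<close>, where
      \<open>Q\<close> holds the derivatives of the coefficients.\<close>
    define \<beta> where "\<beta> = - poly Q \<alpha> / poly (pderiv P) \<alpha>"
    have \<beta>: "poly Q \<alpha> + poly (pderiv P) \<alpha> * \<beta> = 0"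
      using P(6) by (simp add: \<beta>_def)
    have "poly h \<alpha> + poly (pderiv g) \<alpha> * \<beta> = 0"
      if "\<And>i. (coeff g i, coeff h i) \<in> R" "poly g \<alpha> = 0" for g h
      using that
    proof (induction "degree g" arbitrary: g h rule: less_induct)
      case less
      show ?case
      proof (cases "g = 0")
        case True
        then have "h = 0" using less.prems(1) partial_derivationD(3)[OF R] by (intro poly_eqI) simp
        with True show ?thesis by simp
      next
        case False
        have ge: "degree P \<le> degree g"
          using P(5)[OF False] less.prems kI by blast
        define m where "m = degree g - degree P"
        define c where "c = coeff g (degree g) / coeff P (degree P)"
        have "c \<in> k" unfolding c_def
          using less.prems(1) kI P(2) by (intro is_subfieldD(8)[OF k]) blast+
        then obtain e where ce: "(c, e) \<in> R" using kE by blast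
        \<comment> \<open>One division step over the dual numbers: (c + \<epsilon> e) X^m (P +
          \<epsilon> Q) is subtracted. It vanishes at \<alpha> + \<epsilon> \<beta>, so the claim
          passes to a polynomial of smaller degree.\<close>
        define g' where "g' = g - monom c m * P"
        define h' where "h' = h - (monom c m * Q + monom e m * P)"
        have "(coeff g' i, coeff h' i) \<in> R" for i
        proof (cases "i < m")
          case True
          then show ?thesis using less.prems(1)
            by (simp add: g'_def h'_def coeff_monom_mult)
        next
          case False
          have "(c * coeff P (i - m), c * coeff Q (i - m) + coeff P (i - m) * e) \<in> R"
            by (rule partial_derivationD(5)[OF R ce PQ])
          from partial_derivationD(4)[OF R less.prems(1)[of i] partial_derivationD(6)[OF R this]]
          moreover have "coeff h' i =
              coeff h i + - (c * coeff Q (i - m) + coeff P (i - m) * e)"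
            using False by (simp add: h'_def coeff_monom_mult mult.commute[of e])
          ultimately show ?thesis using False by (simp add: g'_def coeff_monom_mult)
        qed
        moreover have "poly g' \<alpha> = 0" using less.prems(2) P(3) by (simp add: g'_def)
        moreover have "degree g' < degree g"
        proof (rule degree_lessI)
          show "g' \<noteq> 0 \<or> 0 < degree g" using ge P(4) by simp
          show "\<forall>i\<ge>degree g. coeff g' i = 0"
          proof (intro allI impI)
            fix i assume i: "degree g \<le> i"
            show "coeff g' i = 0"
            proof (cases "i = degree g")
              case True
              then show ?thesis using ge P(1)
                by (simp add: g'_def coeff_monom_mult m_def c_def)
            next
              case False
              then show ?thesis using i ge
                by (simp add: g'_def coeff_monom_mult m_def coeff_eq_0)
            qed
          qed
        qed
        ultimately have "poly h' \<alpha> + poly (pderiv g') \<alpha> * \<beta> = 0"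
          using less.hyps by blast
        moreover have "poly (monom c m) \<alpha> * (poly Q \<alpha> + poly (pderiv P) \<alpha> * \<beta>) = 0"
          using \<beta> by simp
        ultimately show ?thesis using P(3)
          by (simp add: g'_def h'_def pderiv_diff pderiv_mult algebra_simps)
      qed
    qed
    then show thesis by (rule that)
  qed
  have "dual_adjoin R \<alpha> \<beta> = R"
    using partial_derivation_dual_adjoin[OF R triv] dual_adjoin_superset(1)[OF R] by (rule max)
  then show ?thesis using dual_adjoin_superset(2)[OF R, of \<alpha> \<beta>] by auto
qed

text \<open>By Zorn's lemma, the derivation \<open>d/dw\<close> of \<open>k[w]\<close> extends to the whole field.\<close>

theorem derivation_nonzero_on_transcendental:
  fixes w :: "'a::field_char_0"
  assumes k: "is_subfield k" and w: "\<not> algebraic_in k w"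
  obtains d where "field_derivation d" "\<And>x. x \<in> k \<Longrightarrow> d x = 0" "d w = 1"
proof -
  have "partial_derivation (k \<times> {0})"
    using k by (auto simp: partial_derivation_def is_subfield_def)
  then have R0: "partial_derivation (dual_adjoin (k \<times> {0}) w 1)"
  proof (rule partial_derivation_dual_adjoin)
    fix g h :: "'a poly"
    assume *: "\<And>i. (coeff g i, coeff h i) \<in> k \<times> {0}" and "poly g w = 0"
    then have "g = 0" using w by (auto simp: algebraic_in_def)
    moreover have "h = 0" using * by (intro poly_eqI) simp
    ultimately show "poly h w + poly (pderiv g) w * 1 = 0" by simp
  qed
  define R0 where "R0 = dual_adjoin (k \<times> {0}) w 1"
  have sub: "k \<times> {0} \<subseteq> R0" "(w, 1) \<in> R0"
    unfolding R0_def using dual_adjoin_superset \<open>partial_derivation (k \<times> {0})\<close> by blast+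
  define Ex where "Ex = {R. partial_derivation R \<and> R0 \<subseteq> R}"
  have "\<exists>U\<in>Ex. \<forall>Y\<in>Ch. Y \<subseteq> U" if "subset.chain Ex Ch" for Ch
  proof (cases "Ch = {}")
    case True
    then show ?thesis using R0 by (auto simp: Ex_def R0_def)
  next
    case False
    have pd: "partial_derivation Y" "R0 \<subseteq> Y" if "Y \<in> Ch" for Y
      using that \<open>subset.chain Ex Ch\<close> by (auto simp: subset.chain_def Ex_def)
    have two: "\<exists>Y\<in>Ch. p \<in> Y \<and> q \<in> Y" if pq: "p \<in> \<Union>Ch" "q \<in> \<Union>Ch" for p q
    proof -
      obtain Y Z where "Y \<in> Ch" "p \<in> Y" "Z \<in> Ch" "q \<in> Z" using pq by auto
      moreover have "Y \<subseteq> Z \<or> Z \<subseteq> Y"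
        using \<open>subset.chain Ex Ch\<close> calculation unfolding subset_chain_def by auto
      ultimately show ?thesis by auto
    qed
    have "partial_derivation (\<Union>Ch)"
      unfolding partial_derivation_def
    proof (intro conjI allI impI)
      obtain Y where Y: "Y \<in> Ch" using False by auto
      show "(0, 0) \<in> \<Union>Ch" "(1, 0) \<in> \<Union>Ch"
        using Y partial_derivationD(1,2)[OF pd(1)[OF Y]] by auto
      show "b = 0" if "(0, b) \<in> \<Union>Ch" for b
        using that partial_derivationD(3)[OF pd(1)] by auto
      show "(- a, - b) \<in> \<Union>Ch" if "(a, b) \<in> \<Union>Ch" for a b
        using that partial_derivationD(6)[OF pd(1)] by auto
      fix a b c e assume "(a, b) \<in> \<Union>Ch" "(c, e) \<in> \<Union>Ch"
      from two[OF this] obtain Y where Y: "Y \<in> Ch" "(a, b) \<in> Y" "(c, e) \<in> Y" by auto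
      then show "(a + c, b + e) \<in> \<Union>Ch" "(a * c, a * e + c * b) \<in> \<Union>Ch"
        using partial_derivationD(4,5)[OF pd(1)[OF Y(1)] Y(2,3)] by auto
    qed
    moreover have "R0 \<subseteq> \<Union>Ch" using False pd(2) by auto
    ultimately show ?thesis by (auto simp: Ex_def)
  qed
  from subset_Zorn[OF this] obtain R where "R \<in> Ex" and "\<forall>R'\<in>Ex. R \<subseteq> R' \<longrightarrow> R' = R"
    by metis
  then have R: "partial_derivation R" "R0 \<subseteq> R"
    and max: "\<And>R'. partial_derivation R' \<Longrightarrow> R \<subseteq> R' \<Longrightarrow> R' = R"
    by (auto simp: Ex_def)
  define d where "d a = (SOME b. (a, b) \<in> R)" for a
  have d: "(a, d a) \<in> R" for a
    unfolding d_def using maximal_partial_derivation_total[OF R(1) max] by (rule someI_ex)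
  have uniq: "d a = b" if "(a, b) \<in> R" for a b
    using partial_derivation_unique[OF R(1) d that] .
  show thesis
  proof
    show "field_derivation d"
      unfolding field_derivation_def
      using partial_derivationD(4,5)[OF R(1) d d] by (auto intro!: uniq)
    show "d x = 0" if "x \<in> k" for x
      using that sub(1) R(2) by (intro uniq) blast
    show "d w = 1" using sub(2) R(2) by (intro uniq) blast
  qed
qed

section \<open>Fields of rational functions\<close>

definition rational_functions :: "'a::field set \<Rightarrow> 'a \<Rightarrow> 'a set" where
  "rational_functions K u = {poly g u / poly h u | g h.
    (\<forall>i. coeff g i \<in> K) \<and> (\<forall>i. coeff h i \<in> K) \<and> poly h u \<noteq> 0}"

lemma coeff_add_in: "is_subfield K \<Longrightarrow> \<forall>i. coeff g i \<in> K \<Longrightarrow> \<forall>i. coeff h i \<in> K \<Longrightarrow> \<forall>i. coeff (g + h) i \<in> K"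
  by (auto intro: is_subfieldD)

lemma coeff_mult_in: "is_subfield K \<Longrightarrow> \<forall>i. coeff g i \<in> K \<Longrightarrow> \<forall>i. coeff h i \<in> K \<Longrightarrow> \<forall>i. coeff (g * h) i \<in> K"
  by (auto intro!: is_subfield_sum is_subfieldD(5) simp: coeff_mult)

lemma rational_functionsI:
  "\<forall>i. coeff g i \<in> K \<Longrightarrow> \<forall>i. coeff h i \<in> K \<Longrightarrow> poly h u \<noteq> 0 \<Longrightarrow>
    poly g u / poly h u \<in> rational_functions K u"
  by (auto simp: rational_functions_def)

lemma rational_functionsE:
  assumes "x \<in> rational_functions K u"
  obtains g h where "x = poly g u / poly h u" "\<forall>i. coeff g i \<in> K" "\<forall>i. coeff h i \<in> K" "poly h u \<noteq> 0"
  using assms by (auto simp: rational_functions_def)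

lemma rational_functions_mono: "K \<subseteq> K' \<Longrightarrow> rational_functions K u \<subseteq> rational_functions K' u"
  unfolding rational_functions_def by blast

lemma rational_functions_superset:
  assumes "is_subfield K"
  shows "K \<subseteq> rational_functions K u" and "u \<in> rational_functions K u"
proof -
  have 1: "\<forall>i. coeff [:1:] i \<in> K" 
    using is_subfieldD[OF assms] by (auto simp: coeff_pCons split: nat.splits)
  show "K \<subseteq> rational_functions K u"
  proof
    fix c assume "c \<in> K"
    then have "\<forall>i. coeff [:c:] i \<in> K"
      using is_subfieldD[OF assms] by (auto simp: coeff_pCons split: nat.splits)
    from rational_functionsI[OF this 1] show "c \<in> rational_functions K u" by simp
  qed
  have "\<forall>i. coeff [:0, 1:] i \<in> K"
    using is_subfieldD[OF assms] by (auto simp: coeff_pCons split: nat.splits)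
  from rational_functionsI[OF this 1] show "u \<in> rational_functions K u" by simp
qed

lemma is_subfield_rational_functions:
  assumes K: "is_subfield K"
  shows "is_subfield (rational_functions K u)"
  unfolding is_subfield_def
proof (intro conjI ballI)
  show "0 \<in> rational_functions K u" "1 \<in> rational_functions K u"
    using rational_functions_superset(1)[OF K] is_subfieldD(1,2)[OF K] by blast+
  fix x assume "x \<in> rational_functions K u"
  then obtain g h where x: "x = poly g u / poly h u" "\<forall>i. coeff g i \<in> K" "\<forall>i. coeff h i \<in> K" "poly h u \<noteq> 0"
    by (rule rational_functionsE)
  have "\<forall>i. coeff (- g) i \<in> K" using x(2) is_subfieldD(4)[OF K] by simp
  from rational_functionsI[OF this x(3,4)] show "- x \<in> rational_functions K u" by (simp add: x(1))
  show "inverse x \<in> rational_functions K u"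
  proof (cases "poly g u = 0")
    case True
    then show ?thesis using \<open>0 \<in> rational_functions K u\<close> by (simp add: x(1))
  next
    case False
    from rational_functionsI[OF x(3,2) False] show ?thesis by (simp add: x(1))
  qed
  fix y assume "y \<in> rational_functions K u"
  then obtain g' h' where y: "y = poly g' u / poly h' u" "\<forall>i. coeff g' i \<in> K" "\<forall>i. coeff h' i \<in> K" "poly h' u \<noteq> 0"
    by (rule rational_functionsE)
  have hh: "\<forall>i. coeff (h * h') i \<in> K" by (rule coeff_mult_in[OF K x(3) y(3)])
  have nz: "poly (h * h') u \<noteq> 0" using x(4) y(4) by simp
  have "\<forall>i. coeff (g * h' + g' * h) i \<in> K"
    by (intro coeff_add_in[OF K] coeff_mult_in[OF K] x y)
  from rational_functionsI[OF this hh nz] show "x + y \<in> rational_functions K u"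
    using x(4) y(4) by (simp add: x(1) y(1) field_simps)
  have "\<forall>i. coeff (g * g') i \<in> K" by (intro coeff_mult_in[OF K] x y)
  from rational_functionsI[OF this hh nz] show "x * y \<in> rational_functions K u"
    by (simp add: x(1) y(1))
qed

text \<open>The start is D / D u. If \<open>w\<close> is transcendental over K(u), a derivation
  \<open>d\<close> that vanishes on K(u) with d w = 1 turns \<open>t\<close> into t - t(w) d, which
  kills \<open>w\<close> and keeps t u = 1. The constants only grow, so elements treated earlier
  stay algebraic.\<close>

lemma derivation_with_algebraic:
  fixes D :: "'a::field_char_0 \<Rightarrow> 'a"
  assumes D: "field_derivation D" and "D u \<noteq> 0" and "finite A"
  obtains t where "field_derivation t" "\<And>x. D x = 0 \<Longrightarrow> t x = 0" "t u = 1"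
    "\<And>w. w \<in> A \<Longrightarrow> algebraic_in (rational_functions {x. t x = 0} u) w"
proof -
  have "\<exists>t. field_derivation t \<and> (\<forall>x. D x = 0 \<longrightarrow> t x = 0) \<and> t u = 1 \<and>
    (\<forall>w\<in>A. algebraic_in (rational_functions {x. t x = 0} u) w)"
    using \<open>finite A\<close>
  proof (induction A rule: finite_induct)
    case empty
    have "field_derivation (\<lambda>x. inverse (D u) * D x + 0 * D x)"
      by (rule field_derivation_lincomb[OF D D])
    then show ?case using \<open>D u \<noteq> 0\<close> by (intro exI[of _ "\<lambda>x. inverse (D u) * D x"]) simp
  next
    case (insert w A)
    then obtain t where t: "field_derivation t" "\<And>x. D x = 0 \<Longrightarrow> t x = 0" "t u = 1"
      and A: "\<And>w. w \<in> A \<Longrightarrow> algebraic_in (rational_functions {x. t x = 0} u) w" by blast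
    have K: "is_subfield {x. t x = 0}" by (rule is_subfield_kernel[OF t(1)])
    let ?k = "rational_functions {x. t x = 0} u"
    show ?case
    proof (cases "algebraic_in ?k w")
      case True
      with t A show ?thesis by blast
    next
      case False
      obtain d where d: "field_derivation d" "\<And>x. x \<in> ?k \<Longrightarrow> d x = 0" "d w = 1"
        using derivation_nonzero_on_transcendental[OF is_subfield_rational_functions[OF K] False]
        by metis
      define t' where "t' x = 1 * t x + (- t w) * d x" for x
      have "field_derivation t'" unfolding t'_def by (rule field_derivation_lincomb[OF t(1) d(1)])
      moreover have t0: "t' x = 0" if "t x = 0" for x
        using that d(2) rational_functions_superset(1)[OF K, of u] by (auto simp: t'_def)
      moreover have "t' u = 1"
        using t(3) d(2) rational_functions_superset(2)[OF K] by (simp add: t'_def)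
      moreover have "algebraic_in (rational_functions {x. t' x = 0} u) a" if a: "a \<in> insert w A" for a
      proof (cases "a \<in> A")
        case True
        have "?k \<subseteq> rational_functions {x. t' x = 0} u"
          by (intro rational_functions_mono) (auto simp: t0)
        then show ?thesis using A[OF True] by (rule algebraic_in_mono)
      next
        case False
        with a have "a = w" by simp
        have "t' w = 0" using d(3) by (simp add: t'_def)
        then have "w \<in> rational_functions {x. t' x = 0} u"
          using rational_functions_superset(1)[OF is_subfield_kernel[OF \<open>field_derivation t'\<close>]] by blast
        with \<open>a = w\<close> show ?thesis
          by (intro algebraic_in_mem is_subfield_rational_functions is_subfield_kernel)
            (use \<open>field_derivation t'\<close> in auto)
      qed
      ultimately show ?thesis using t(2) by blast
    qed
  qed
  then show thesis using that by blast
qed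


section \<open>Finite extensions\<close>

text \<open>Meant for finite \<open>B\<close>: a sum over an infinite set defaults to 0.\<close>

definition span_over :: "'a::field set \<Rightarrow> 'a set \<Rightarrow> 'a set" where
  "span_over k B = {\<Sum>b\<in>B. c b * b | c. \<forall>b\<in>B. c b \<in> k}"

lemma span_over_minimal:
  assumes "\<And>x y. x \<in> L \<Longrightarrow> y \<in> L \<Longrightarrow> x + y \<in> L" and "0 \<in> L"
    and "\<And>c x. c \<in> k \<Longrightarrow> x \<in> L \<Longrightarrow> c * x \<in> L" and "B \<subseteq> L"
  shows "span_over k B \<subseteq> L"
proof
  fix x assume "x \<in> span_over k B"
  then obtain c where c: "x = (\<Sum>b\<in>B. c b * b)" "\<forall>b\<in>B. c b \<in> k" by (auto simp: span_over_def)
  have "(\<Sum>b\<in>B'. c b * b) \<in> L" if "B' \<subseteq> B" for B'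
    using that by (induction B' rule: infinite_finite_induct) (use assms c(2) in auto)
  then show "x \<in> L" by (simp add: c(1))
qed

lemma span_over_closed:
  assumes "is_subfield k"
  shows "0 \<in> span_over k B"
    and "x \<in> span_over k B \<Longrightarrow> y \<in> span_over k B \<Longrightarrow> x + y \<in> span_over k B"
    and "c \<in> k \<Longrightarrow> x \<in> span_over k B \<Longrightarrow> c * x \<in> span_over k B"
    and "finite B \<Longrightarrow> b \<in> B \<Longrightarrow> b \<in> span_over k B"
proof -
  show "0 \<in> span_over k B"
    unfolding span_over_def by (intro CollectI exI[of _ "\<lambda>_. 0"]) (simp add: is_subfieldD[OF assms])
  show "x + y \<in> span_over k B" if "x \<in> span_over k B" "y \<in> span_over k B"
  proof -
    obtain f g where "x = (\<Sum>b\<in>B. f b * b)" "\<forall>b\<in>B. f b \<in> k" "y = (\<Sum>b\<in>B. g b * b)" "\<forall>b\<in>B. g b \<in> k"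
      using \<open>x \<in> span_over k B\<close> \<open>y \<in> span_over k B\<close> by (auto simp: span_over_def)
    then show ?thesis unfolding span_over_def
      by (intro CollectI exI[of _ "\<lambda>b. f b + g b"])
        (auto simp: sum.distrib algebra_simps is_subfieldD(3)[OF assms])
  qed
  show "c * x \<in> span_over k B" if "c \<in> k" "x \<in> span_over k B"
  proof -
    obtain f where "x = (\<Sum>b\<in>B. f b * b)" "\<forall>b\<in>B. f b \<in> k"
      using \<open>x \<in> span_over k B\<close> by (auto simp: span_over_def)
    then show ?thesis unfolding span_over_def using \<open>c \<in> k\<close>
      by (intro CollectI exI[of _ "\<lambda>b. c * f b"])
        (auto simp: sum_distrib_left mult.assoc is_subfieldD(5)[OF assms])
  qed
  show "b \<in> span_over k B" if "finite B" "b \<in> B"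
    unfolding span_over_def using that
    by (intro CollectI exI[of _ "\<lambda>a. if a = b then 1 else 0"])
      (auto simp: is_subfieldD[OF assms] if_distrib[of "\<lambda>c. c * _"] cong: if_cong)
qed

text \<open>Inverses are not demanded; they are derived from the finite dimension in
  \<open>inverse_L\<close>.\<close>

definition finite_algebra :: "'a::field set \<Rightarrow> 'a set \<Rightarrow> bool" where
  "finite_algebra k L \<longleftrightarrow> k \<subseteq> L \<and> (\<forall>x\<in>L. \<forall>y\<in>L. x + y \<in> L) \<and> (\<forall>x\<in>L. \<forall>y\<in>L. x * y \<in> L) \<and>
    (\<exists>B. finite B \<and> L = span_over k B)"

lemma finite_algebra_self:
  assumes "is_subfield k"
  shows "finite_algebra k k"
proof -
  have "k = span_over k {1}" by (auto simp: span_over_def)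
  then show ?thesis
    unfolding finite_algebra_def using is_subfieldD[OF assms] by (auto intro!: exI[of _ "{1}"])
qed

text \<open>Division with remainder over \<open>L\<close>, which is only known to be a ring here:
  the leading coefficient of \<open>P\<close> is inverted inside \<open>k\<close>.\<close>

lemma coeff_reduce:
  assumes k: "is_subfield k" and L: "finite_algebra k L"
    and P: "P \<noteq> 0" "\<And>i. coeff P i \<in> k" "poly P a = 0" "degree P > 0"
    and g: "\<And>i. coeff g i \<in> L"
  shows "\<exists>g'. (\<forall>i. coeff g' i \<in> L) \<and> poly g' a = poly g a \<and> degree g' < degree P"
  using g
proof (induction "degree g" arbitrary: g rule: less_induct)
  case less
  have kL: "x \<in> L" if "x \<in> k" for x using L that by (auto simp: finite_algebra_def)
  have Ladd: "x + y \<in> L" "x * y \<in> L" if "x \<in> L" "y \<in> L" for x y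
    using L that by (auto simp: finite_algebra_def)
  have Ldiff: "x - y \<in> L" if "x \<in> L" "y \<in> L" for x y
    using Ladd(1)[OF that(1) Ladd(2)[OF kL[of "- 1"] that(2)]] is_subfieldD(2,4)[OF k] by simp
  show ?case
  proof (cases "degree g < degree P")
    case True
    with less.prems show ?thesis by blast
  next
    case False
    define m where "m = degree g - degree P"
    define c where "c = coeff g (degree g) * inverse (coeff P (degree P))"
    have c: "c \<in> L"
      unfolding c_def by (rule Ladd(2)[OF less.prems kL[OF is_subfieldD(6)[OF k P(2)]]])
    define g' where "g' = g - monom c m * P"
    have "\<forall>i. coeff g' i \<in> L"
    proof
      fix i
      show "coeff g' i \<in> L"
        using less.prems Ldiff Ladd(2)[OF c kL[OF P(2)]]
        by (cases "i < m") (auto simp: g'_def coeff_monom_mult)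
    qed
    moreover have "poly g' a = poly g a" using P(3) by (simp add: g'_def)
    moreover have "degree g' < degree g"
    proof (rule degree_lessI)
      show "g' \<noteq> 0 \<or> 0 < degree g" using False P(4) by simp
      show "\<forall>i\<ge>degree g. coeff g' i = 0"
      proof (intro allI impI)
        fix i assume i: "degree g \<le> i"
        show "coeff g' i = 0"
        proof (cases "i = degree g")
          case True
          then show ?thesis using False P(1)
            by (simp add: g'_def coeff_monom_mult m_def c_def)
        next
          case False
          then show ?thesis using i \<open>\<not> degree g < degree P\<close>
            by (simp add: g'_def coeff_monom_mult m_def coeff_eq_0)
        qed
      qed
    qed
    ultimately show ?thesis using less.hyps[of g'] by auto
  qed
qed

text \<open>\<open>L'\<close> is L[a]. Degrees are cut down by the minimal polynomial of
  \<open>a\<close> over \<open>k\<close>, whose leading coefficient is a unit of \<open>L\<close>;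
  so the products of the generators of \<open>L\<close> with the powers of \<open>a\<close> below
  its degree span \<open>L'\<close>.\<close>

lemma finite_algebra_adjoin:
  fixes a :: "'a::field_char_0"
  assumes k: "is_subfield k" and L: "finite_algebra k L" and a: "algebraic_in k a"
  obtains L' where "finite_algebra k L'" "L \<subseteq> L'" "a \<in> L'"
proof -
  have kL: "x \<in> L" if "x \<in> k" for x using L that by (auto simp: finite_algebra_def)
  have Ladd: "x + y \<in> L" "x * y \<in> L" if "x \<in> L" "y \<in> L" for x y
    using L that by (auto simp: finite_algebra_def)
  have L01: "0 \<in> L" "1 \<in> L" using kL is_subfieldD[OF k] by auto
  have Lsum: "sum f A \<in> L" if "\<And>i. i \<in> A \<Longrightarrow> f i \<in> L" for f :: "nat \<Rightarrow> 'a" and A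
    using that by (induction A rule: infinite_finite_induct) (auto intro: L01 Ladd)
  obtain B where B: "finite B" "L = span_over k B" using L by (auto simp: finite_algebra_def)
  obtain P where P: "P \<noteq> 0" "\<And>i. coeff P i \<in> k" "poly P a = 0" "degree P > 0"
    using minimal_poly_exists[OF k a] by metis
  define L' where "L' = {poly g a | g. \<forall>i. coeff g i \<in> L}"
  have I: "poly g a \<in> L'" if "\<And>i. coeff g i \<in> L" for g using that by (auto simp: L'_def)
  have E: "\<exists>g. x = poly g a \<and> (\<forall>i. coeff g i \<in> L)" if "x \<in> L'" for x using that by (auto simp: L'_def)
  have sub: "L \<subseteq> L'"
  proof
    fix c assume "c \<in> L"
    then have "poly [:c:] a \<in> L'" by (intro I) (auto simp: coeff_pCons L01 split: nat.splits)
    then show "c \<in> L'" by simp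
  qed
  have "poly [:0, 1:] a \<in> L'" by (intro I) (auto simp: coeff_pCons L01 split: nat.splits)
  then have aL: "a \<in> L'" by simp
  have add: "x + y \<in> L'" and mul: "x * y \<in> L'" if xy: "x \<in> L'" "y \<in> L'" for x y
  proof -
    obtain g h where gh: "x = poly g a" "\<forall>i. coeff g i \<in> L" "y = poly h a" "\<forall>i. coeff h i \<in> L"
      using E[OF xy(1)] E[OF xy(2)] by blast
    have "poly (g + h) a \<in> L'" by (intro I) (simp add: Ladd gh)
    then show "x + y \<in> L'" by (simp add: gh)
    have "poly (g * h) a \<in> L'" by (intro I) (auto simp: coeff_mult gh intro!: Lsum Ladd(2))
    then show "x * y \<in> L'" by (simp add: gh)
  qed
  define B' where "B' = (\<lambda>(b, i). b * a ^ i) ` (B \<times> {..<degree P})"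
  have fin: "finite B'" by (simp add: B'_def B(1))
  have apow: "a ^ i \<in> L'" for i
    by (induction i) (use sub L01 mul aL in auto)
  have "span_over k B' \<subseteq> L'"
  proof (rule span_over_minimal)
    show "0 \<in> L'" using sub L01 by blast
    show "c * x \<in> L'" if "c \<in> k" "x \<in> L'" for c x using mul that kL sub by blast
    have "B \<subseteq> L'" using span_over_closed(4)[OF k B(1)] B(2) sub by blast
    then show "B' \<subseteq> L'" by (auto simp: B'_def intro!: mul apow)
  qed (rule add)
  moreover have "L' \<subseteq> span_over k B'"
  proof
    fix x assume "x \<in> L'"
    then obtain g0 where "x = poly g0 a" "\<forall>i. coeff g0 i \<in> L" using E by blast
    then obtain g where g: "\<forall>i. coeff g i \<in> L" "x = poly g a" "degree g < degree P"
      using coeff_reduce[OF k L P] by metis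
    have mem: "coeff g i * a ^ i \<in> span_over k B'" if "i \<le> degree g" for i
    proof -
      obtain c where c: "coeff g i = (\<Sum>b\<in>B. c b * b)" "\<forall>b\<in>B. c b \<in> k"
        using g(1) B(2) by (auto simp: span_over_def)
      have "c b * (b * a ^ i) \<in> span_over k B'" if "b \<in> B" for b
        using c(2) that \<open>i \<le> degree g\<close> g(3)
        by (intro span_over_closed(3)[OF k] span_over_closed(4)[OF k fin]) (auto simp: B'_def)
      then have "(\<Sum>b\<in>B''. c b * (b * a ^ i)) \<in> span_over k B'" if "B'' \<subseteq> B" for B''
        using that
        by (induction B'' rule: infinite_finite_induct) (auto intro: span_over_closed[OF k])
      from this[of B] show ?thesis by (simp add: c(1) sum_distrib_right mult.assoc)
    qed
    have "(\<Sum>i\<in>A. coeff g i * a ^ i) \<in> span_over k B'" if "A \<subseteq> {..degree g}" for A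
      using that
      by (induction A rule: infinite_finite_induct) (auto intro: span_over_closed[OF k] mem)
    from this[of "{..degree g}"] show "x \<in> span_over k B'" by (simp add: g(2) poly_altdef)
  qed
  ultimately have "finite_algebra k L'"
    unfolding finite_algebra_def using add mul fin sub kL by blast
  then show thesis using sub aL by (rule that)
qed

lemma finite_algebra_exists:
  fixes A :: "'a::field_char_0 set"
  assumes "is_subfield k" and "finite A" and "\<And>a. a \<in> A \<Longrightarrow> algebraic_in k a"
  obtains L where "finite_algebra k L" "A \<subseteq> L"
proof -
  have "\<exists>L. finite_algebra k L \<and> A \<subseteq> L"
    using assms(2,3)
  proof (induction A rule: finite_induct)
    case empty
    then show ?case using finite_algebra_self[OF assms(1)] by blast
  next
    case (insert a A)
    then obtain L where "finite_algebra k L" "A \<subseteq> L" by auto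
    moreover obtain L' where "finite_algebra k L'" "L \<subseteq> L'" "a \<in> L'"
      using finite_algebra_adjoin[OF assms(1) \<open>finite_algebra k L\<close>, of a] insert.prems by blast
    ultimately show ?case by blast
  qed
  then show thesis using that by blast
qed

text \<open>A spanning set of least cardinality is independent, as an element with nonzero
  coefficient in a relation could be dropped. Indexing by an initial segment of the naturals
  prepares for matrices.\<close>

lemma finite_algebra_basis:
  assumes k: "is_subfield k" and L: "finite_algebra k L"
  obtains d :: nat and b where
    "\<And>i. i < d \<Longrightarrow> b i \<in> L"
    "\<And>x. x \<in> L \<Longrightarrow> \<exists>c. (\<forall>i<d. c i \<in> k) \<and> x = (\<Sum>i<d. c i * b i)"
    "\<And>c. (\<And>i. i < d \<Longrightarrow> c i \<in> k) \<Longrightarrow> (\<Sum>i<d. c i * b i) = 0 \<Longrightarrow> \<forall>i<d. c i = 0"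
proof -
  define Q where "Q B \<longleftrightarrow> finite B \<and> L = span_over k B" for B
  obtain B0 where "Q B0" using L by (auto simp: finite_algebra_def Q_def)
  then obtain B where "Q B" and min: "\<And>B'. Q B' \<Longrightarrow> card B \<le> card B'"
    using ex_has_least_nat[of Q B0 card] by auto
  then have B: "finite B" "L = span_over k B" by (auto simp: Q_def)
  have indep: "c b0 = 0" if c: "\<And>b. b \<in> B \<Longrightarrow> c b \<in> k" "(\<Sum>b\<in>B. c b * b) = 0" "b0 \<in> B" for c b0
  proof (rule ccontr)
    assume nz: "c b0 \<noteq> 0"
    let ?B = "B - {b0}"
    have fin: "finite ?B" using B(1) by simp
    have "c b0 * b0 + (\<Sum>b\<in>?B. c b * b) = 0" using c(2,3) B(1) by (simp add: sum.remove)
    then have "b0 = (\<Sum>b\<in>?B. c b * b) * (- inverse (c b0))"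
      using nz by (simp add: field_simps eq_neg_iff_add_eq_0 add.commute)
    then have b0: "b0 = (\<Sum>b\<in>?B. (- c b / c b0) * b)"
      by (simp add: sum_distrib_right sum_divide_distrib sum_negf field_simps)
    have "b0 \<in> span_over k ?B"
      unfolding span_over_def using c(1,3)
      by (subst b0, intro CollectI exI[of _ "\<lambda>b. - c b / c b0"])
        (auto intro!: is_subfieldD(8)[OF k] is_subfieldD(4)[OF k])
    then have "span_over k B \<subseteq> span_over k ?B"
      using span_over_closed(4)[OF k fin]
      by (intro span_over_minimal span_over_closed(1-3)[OF k]) auto
    moreover have "span_over k ?B \<subseteq> span_over k B"
      using span_over_closed(4)[OF k B(1)]
      by (intro span_over_minimal span_over_closed(1-3)[OF k]) auto
    ultimately have "Q ?B" using B fin by (auto simp: Q_def)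
    then show False using min[of ?B] B(1) c(3) card_Diff1_less[of B b0] by fastforce
  qed
  obtain b where b: "bij_betw b {0..<card B} B"
    using ex_bij_betw_nat_finite[OF B(1)] by blast
  then have b': "bij_betw b {..<card B} B" by (simp add: atLeast0LessThan)
  show thesis
  proof (rule that[of "card B" b])
    show "b i \<in> L" if "i < card B" for i
      using span_over_closed(4)[OF k B(1)] B(2) b' that by (auto simp: bij_betw_def)
    show "\<exists>c. (\<forall>i<card B. c i \<in> k) \<and> x = (\<Sum>i<card B. c i * b i)" if x: "x \<in> L" for x
    proof -
      obtain c where c: "x = (\<Sum>b\<in>B. c b * b)" "\<forall>b\<in>B. c b \<in> k"
        using x B(2) by (auto simp: span_over_def)
      have "x = (\<Sum>i<card B. c (b i) * b i)"
        unfolding c(1) using sum.reindex_bij_betw[OF b', of "\<lambda>b. c b * b"] by simp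
      then show ?thesis using c(2) b' by (intro exI[of _ "\<lambda>i. c (b i)"]) (auto simp: bij_betw_def)
    qed
    show "\<forall>i<card B. c i = 0" if c: "\<And>i. i < card B \<Longrightarrow> c i \<in> k" "(\<Sum>i<card B. c i * b i) = 0" for c
    proof -
      define idx where "idx = the_inv_into {..<card B} b"
      have idx: "idx (b i) = i" if "i < card B" for i
        unfolding idx_def using b' that by (auto simp: bij_betw_def the_inv_into_f_f)
      have "(\<Sum>x\<in>B. c (idx x) * x) = (\<Sum>i<card B. c (idx (b i)) * b i)"
        using sum.reindex_bij_betw[OF b', of "\<lambda>x. c (idx x) * x"] by simp
      also have "\<dots> = 0" unfolding c(2)[symmetric] by (rule sum.cong) (auto simp: idx)
      finally have 0: "(\<Sum>x\<in>B. c (idx x) * x) = 0" .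
      have k': "c (idx x) \<in> k" if x: "x \<in> B" for x
      proof -
        obtain i where "i < card B" "x = b i" using b' x by (auto simp: bij_betw_def)
        then show ?thesis using c(1) idx by simp
      qed
      show ?thesis
      proof (intro allI impI)
        fix i assume i: "i < card B"
        then have "b i \<in> B" using b' by (auto simp: bij_betw_def)
        from indep[OF k' 0 this] show "c i = 0" by (simp add: idx[OF i])
      qed
    qed
  qed
qed

section \<open>Determinants over subrings and under derivations\<close>

lemma det_mem:
  fixes S :: "'b::comm_ring_1 set"
  assumes A: "A \<in> carrier_mat n n" and e: "\<And>i j. i < n \<Longrightarrow> j < n \<Longrightarrow> A $$ (i, j) \<in> S"
    and S: "0 \<in> S" "1 \<in> S" "\<And>x y. x \<in> S \<Longrightarrow> y \<in> S \<Longrightarrow> x + y \<in> S" "\<And>x. x \<in> S \<Longrightarrow> - x \<in> S"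
      "\<And>x y. x \<in> S \<Longrightarrow> y \<in> S \<Longrightarrow> x * y \<in> S"
  shows "det A \<in> S"
proof -
  have sum: "sum f T \<in> S" if "\<And>i. i \<in> T \<Longrightarrow> f i \<in> S" for f :: "(nat \<Rightarrow> nat) \<Rightarrow> 'b" and T
    using that by (induction T rule: infinite_finite_induct) (auto intro: S)
  have prod: "prod f T \<in> S" if "\<And>i. i \<in> T \<Longrightarrow> f i \<in> S" for f :: "nat \<Rightarrow> 'b" and T
    using that by (induction T rule: infinite_finite_induct) (auto intro: S)
  show ?thesis
    unfolding det_def'[OF A]
  proof (intro sum S(5) prod)
    fix p i assume "p \<in> {p. p permutes {0..<n}}" and "i \<in> {0..<n}"
    then show "A $$ (i, p i) \<in> S" by (intro e) (auto simp: permutes_in_image)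
  next
    fix p :: "nat \<Rightarrow> nat"
    show "signof p \<in> S" by (auto simp: sign_def intro: S)
  qed
qed

text \<open>Jacobi's formula: by the Leibniz rule the derivative is the sum of the determinants with
  one row differentiated, and each is expanded along that row.\<close>

lemma derivation_det:
  fixes A :: "'a::field mat"
  assumes d: "field_derivation t" and A: "A \<in> carrier_mat n n"
  shows "t (det A) = (\<Sum>i<n. \<Sum>j<n. t (A $$ (i, j)) * cofactor A i j)"
proof -
  have prod: "t (prod f T) = (\<Sum>i\<in>T. t (f i) * prod f (T - {i}))" if "finite T" for f :: "nat \<Rightarrow> 'a" and T
    using that
  proof (induction T rule: finite_induct)
    case (insert a T)
    have "(\<Sum>i\<in>insert a T. t (f i) * prod f (insert a T - {i})) =
        t (f a) * prod f T + (\<Sum>i\<in>T. t (f i) * prod f (insert a T - {i}))"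
      using insert.hyps by simp
    also have "(\<Sum>i\<in>T. t (f i) * prod f (insert a T - {i})) = (\<Sum>i\<in>T. f a * (t (f i) * prod f (T - {i})))"
    proof (rule sum.cong[OF refl])
      fix i assume "i \<in> T"
      then have "insert a T - {i} = insert a (T - {i})" using insert.hyps by auto
      then show "t (f i) * prod f (insert a T - {i}) = f a * (t (f i) * prod f (T - {i}))"
        using insert.hyps by simp
    qed
    finally show ?case
      using insert by (simp add: field_derivation_mult[OF d] sum_distrib_left algebra_simps)
  qed (simp add: field_derivation_1[OF d])
  define R where "R i = mat n n (\<lambda>(k, j). if k = i then t (A $$ (k, j)) else A $$ (k, j))" for i
  have R: "R i \<in> carrier_mat n n" for i by (simp add: R_def)
  have sg: "t (signof p * x) = signof p * t x" for p :: "nat \<Rightarrow> nat" and x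
    by (auto simp: sign_def field_derivation_minus[OF d])
  have "t (det A) = (\<Sum>p\<in>{p. p permutes {0..<n}}. signof p * t (\<Prod>i=0..<n. A $$ (i, p i)))"
    unfolding det_def'[OF A] by (simp add: field_derivation_sum[OF d] sg)
  also have "\<dots> = (\<Sum>p\<in>{p. p permutes {0..<n}}. \<Sum>i<n. signof p * (\<Prod>k=0..<n. R i $$ (k, p k)))"
  proof (rule sum.cong[OF refl])
    fix p assume p: "p \<in> {p. p permutes {0..<n}}"
    then have pn: "p k < n" if "k < n" for k 
      using permutes_in_image[of p "{0..<n}" k] p that by simp
    have "t (\<Prod>i=0..<n. A $$ (i, p i)) =
        (\<Sum>i=0..<n. t (A $$ (i, p i)) * (\<Prod>k\<in>{0..<n} - {i}. A $$ (k, p k)))"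
      by (rule prod) simp
    also have "\<dots> = (\<Sum>i=0..<n. \<Prod>k=0..<n. R i $$ (k, p k))"
    proof (rule sum.cong[OF refl])
      fix i assume i: "i \<in> {0..<n}"
      have "(\<Prod>k=0..<n. R i $$ (k, p k)) = R i $$ (i, p i) * (\<Prod>k\<in>{0..<n} - {i}. R i $$ (k, p k))"
        using i by (simp add: prod.remove)
      also have "(\<Prod>k\<in>{0..<n} - {i}. R i $$ (k, p k)) = (\<Prod>k\<in>{0..<n} - {i}. A $$ (k, p k))"
        by (rule prod.cong[OF refl]) (simp add: R_def pn)
      also have "R i $$ (i, p i) = t (A $$ (i, p i))" using i by (simp add: R_def pn)
      finally show "t (A $$ (i, p i)) * (\<Prod>k\<in>{0..<n} - {i}. A $$ (k, p k)) =
          (\<Prod>k=0..<n. R i $$ (k, p k))" ..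
    qed
    finally show "signof p * t (\<Prod>i=0..<n. A $$ (i, p i)) =
        (\<Sum>i<n. signof p * (\<Prod>k=0..<n. R i $$ (k, p k)))"
      by (simp add: sum_distrib_left atLeast0LessThan)
  qed
  also have "\<dots> = (\<Sum>i<n. det (R i))"
    unfolding det_def'[OF R] by (rule sum.swap)
  also have "\<dots> = (\<Sum>i<n. \<Sum>j<n. t (A $$ (i, j)) * cofactor A i j)"
  proof (rule sum.cong[OF refl])
    fix i assume "i \<in> {..<n}"
    then have i: "i < n" by simp
    have "mat_delete (R i) i j = mat_delete A i j" for j
      using A i by (intro eq_matI) (auto simp: mat_delete_def R_def)
    then have "cofactor (R i) i j = cofactor A i j" for j by (simp add: cofactor_def)
    then show "det (R i) = (\<Sum>j<n. t (A $$ (i, j)) * cofactor A i j)"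
      unfolding laplace_expansion_row[OF R i]
      by (intro sum.cong refl) (use i in \<open>simp add: R_def\<close>)
  qed
  finally show ?thesis .
qed

section \<open>Multiplication matrices, traces and norms of a finite extension\<close>

locale finite_extension_basis =
  fixes k L :: "'a::field_char_0 set" and d :: nat and b :: "nat \<Rightarrow> 'a"
  assumes k: "is_subfield k" and L: "finite_algebra k L"
    and b_in: "i < d \<Longrightarrow> b i \<in> L"
    and spans: "x \<in> L \<Longrightarrow> \<exists>c. (\<forall>i<d. c i \<in> k) \<and> x = (\<Sum>i<d. c i * b i)"
    and indep: "(\<And>i. i < d \<Longrightarrow> c i \<in> k) \<Longrightarrow> (\<Sum>i<d. c i * b i) = 0 \<Longrightarrow> \<forall>i<d. c i = 0"
begin

lemma L_closed: "x \<in> k \<Longrightarrow> x \<in> L" "x \<in> L \<Longrightarrow> y \<in> L \<Longrightarrow> x + y \<in> L" "x \<in> L \<Longrightarrow> y \<in> L \<Longrightarrow> x * y \<in> L"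
  "0 \<in> L" "1 \<in> L"
  using L is_subfieldD(1,2)[OF k] by (auto simp: finite_algebra_def)

definition coord :: "'a \<Rightarrow> nat \<Rightarrow> 'a" where
  "coord x = (SOME c. (\<forall>i<d. c i \<in> k) \<and> x = (\<Sum>i<d. c i * b i))"

lemma coord_in: "x \<in> L \<Longrightarrow> i < d \<Longrightarrow> coord x i \<in> k"
  and coord_sum: "x \<in> L \<Longrightarrow> (\<Sum>i<d. coord x i * b i) = x"
  using someI_ex[OF spans, of x] unfolding coord_def by auto

lemma coord_unique:
  assumes "x = (\<Sum>i<d. c i * b i)" and "\<And>i. i < d \<Longrightarrow> c i \<in> k" and "i < d"
  shows "coord x i = c i"
proof -
  have x: "x \<in> L"
  proof -
    have "(\<Sum>i\<in>A. c i * b i) \<in> L" if "A \<subseteq> {..<d}" for A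
      using that by (induction A rule: infinite_finite_induct) (auto intro: L_closed assms(2) b_in)
    then show ?thesis by (simp add: assms(1))
  qed
  have "\<forall>i<d. coord x i - c i = 0"
  proof (rule indep)
    show "coord x i - c i \<in> k" if "i < d" for i
      using coord_in[OF x that] assms(2)[OF that] by (rule is_subfieldD(7)[OF k])
    show "(\<Sum>i<d. (coord x i - c i) * b i) = 0"
      using coord_sum[OF x] assms(1) by (simp add: left_diff_distrib sum_subtractf)
  qed
  with assms(3) show ?thesis by simp
qed

text \<open>Row \<open>i\<close> holds the coordinates of x * b i. With this convention products of
  elements become matrix products in the reverse order, as in \<open>M_mult\<close>.\<close>

definition M :: "'a \<Rightarrow> nat \<Rightarrow> nat \<Rightarrow> 'a" where
  "M x i j = coord (x * b i) j"

lemma M_in: "x \<in> L \<Longrightarrow> i < d \<Longrightarrow> j < d \<Longrightarrow> M x i j \<in> k"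
  unfolding M_def by (intro coord_in L_closed(3) b_in)

lemma M_sum: "x \<in> L \<Longrightarrow> i < d \<Longrightarrow> (\<Sum>j<d. M x i j * b j) = x * b i"
  unfolding M_def by (intro coord_sum L_closed(3) b_in)

lemma M_unique:
  assumes "x * b i = (\<Sum>j<d. c j * b j)" and "\<And>j. j < d \<Longrightarrow> c j \<in> k" and "j < d"
  shows "M x i j = c j"
  unfolding M_def using assms by (rule coord_unique)

lemma M_mult:
  assumes x: "x \<in> L" and y: "y \<in> L" and i: "i < d" "j < d"
  shows "M (x * y) i j = (\<Sum>l<d. M y i l * M x l j)"
proof (rule M_unique[OF _ _ i(2)])
  have "x * y * b i = x * (\<Sum>l<d. M y i l * b l)"
    by (simp add: M_sum[OF y i(1)] mult.assoc)
  also have "\<dots> = (\<Sum>l<d. M y i l * (\<Sum>j<d. M x l j * b j))"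
    by (simp add: sum_distrib_left M_sum[OF x] mult.left_commute)
  also have "\<dots> = (\<Sum>l<d. \<Sum>j<d. M y i l * M x l j * b j)"
    by (simp add: sum_distrib_left mult.assoc)
  also have "\<dots> = (\<Sum>j<d. (\<Sum>l<d. M y i l * M x l j) * b j)"
    unfolding sum_distrib_right by (rule sum.swap)
  finally show "x * y * b i = (\<Sum>j<d. (\<Sum>l<d. M y i l * M x l j) * b j)" .
  show "(\<Sum>l<d. M y i l * M x l j) \<in> k" if "j < d" for j
    using that by (intro is_subfield_sum[OF k] is_subfieldD(5)[OF k] M_in x y i) auto
qed

lemma M_scalar:
  assumes "c \<in> k" and "i < d" and "j < d"
  shows "M c i j = (if i = j then c else 0)"
  by (rule M_unique)
    (use assms in \<open>auto simp: if_distrib[of "\<lambda>c. c * _"] is_subfieldD[OF k] cong: if_cong\<close>)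

lemma M_add:
  assumes x: "x \<in> L" and y: "y \<in> L" and i: "i < d" "j < d"
  shows "M (x + y) i j = M x i j + M y i j"
proof (rule M_unique[OF _ _ i(2)])
  show "(x + y) * b i = (\<Sum>j<d. (M x i j + M y i j) * b j)"
    by (simp add: distrib_right sum.distrib M_sum[OF x i(1)] M_sum[OF y i(1)])
  show "M x i j + M y i j \<in> k" if "j < d" for j
    using that by (intro is_subfieldD(3)[OF k] M_in x y i) auto
qed

definition trace :: "'a \<Rightarrow> 'a" where "trace x = (\<Sum>i<d. M x i i)"
definition nrm :: "'a \<Rightarrow> 'a" where "nrm x = det (mat d d (\<lambda>(i, j). M x i j))"

lemma trace_in: "x \<in> L \<Longrightarrow> trace x \<in> k"
  unfolding trace_def by (intro is_subfield_sum[OF k] M_in) auto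

lemma nrm_in: "x \<in> L \<Longrightarrow> nrm x \<in> k"
  unfolding nrm_def by (rule det_mem[of _ d]) (auto intro: M_in is_subfieldD[OF k])

lemma nrm_scalar:
  assumes "c \<in> k"
  shows "nrm c = c ^ d"
proof -
  have "mat d d (\<lambda>(i, j). M c i j) = c \<cdot>\<^sub>m 1\<^sub>m d"
    by (intro eq_matI) (auto simp: M_scalar[OF assms])
  then show ?thesis by (simp add: nrm_def)
qed

lemma nrm_mult:
  assumes "x \<in> L" and "y \<in> L"
  shows "nrm (x * y) = nrm x * nrm y"
proof -
  have "mat d d (\<lambda>(i, j). M (x * y) i j) = mat d d (\<lambda>(i, j). M y i j) * mat d d (\<lambda>(i, j). M x i j)"
    by (intro eq_matI) (auto simp: M_mult[OF assms] scalar_prod_def atLeast0LessThan)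
  then show ?thesis by (simp add: nrm_def det_mult[of _ d] mult.commute)
qed

lemma trace_add: "x \<in> L \<Longrightarrow> y \<in> L \<Longrightarrow> trace (x + y) = trace x + trace y"
  by (simp add: trace_def M_add sum.distrib)

lemma trace_scale:
  assumes "c \<in> k" and "x \<in> L"
  shows "trace (c * x) = c * trace x"
proof -
  have "M (x * c) i i = c * M x i i" if "i < d" for i
  proof -
    have "M (x * c) i i = (\<Sum>l<d. M c i l * M x l i)"
      by (rule M_mult) (use assms L_closed that in auto)
    also have "\<dots> = (\<Sum>l<d. if l = i then c * M x l i else 0)"
      by (rule sum.cong) (use that in \<open>auto simp: M_scalar[OF assms(1)]\<close>)
    finally show ?thesis using that by simp
  qed
  then show ?thesis by (simp add: trace_def sum_distrib_left mult.commute[of c])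
qed

lemma trace_sum:
  assumes "finite I" and "\<And>i. i \<in> I \<Longrightarrow> c i \<in> k" and "\<And>i. i \<in> I \<Longrightarrow> f i \<in> L"
  shows "(\<Sum>i\<in>I. c i * f i) \<in> L" and "trace (\<Sum>i\<in>I. c i * f i) = (\<Sum>i\<in>I. c i * trace (f i))"
proof -
  have "(\<Sum>i\<in>I. c i * f i) \<in> L \<and> trace (\<Sum>i\<in>I. c i * f i) = (\<Sum>i\<in>I. c i * trace (f i))"
    using assms
  proof (induction I rule: finite_induct)
    case empty
    have "trace (0 * 1) = 0 * trace 1" by (rule trace_scale) (use L_closed is_subfieldD[OF k] in auto)
    then show ?case using L_closed by simp
  next
    case (insert i I)
    then have "c i * f i \<in> L" by (intro L_closed(3)[OF L_closed(1)]) auto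
    with insert show ?case by (simp add: trace_add trace_scale L_closed(2))
  qed
  then show "(\<Sum>i\<in>I. c i * f i) \<in> L" "trace (\<Sum>i\<in>I. c i * f i) = (\<Sum>i\<in>I. c i * trace (f i))" by auto
qed

lemma d_pos: "d > 0"
proof (rule ccontr)
  assume "\<not> d > 0"
  then have "(1::'a) = 0" using coord_sum[OF L_closed(5)] by simp
  then show False by simp
qed

text \<open>The vector of the basis elements is an eigenvector of the multiplication by \<open>x\<close>.\<close>

lemma algebraic_L:
  assumes x: "x \<in> L"
  shows "algebraic_in k x"
proof -
  define A where "A = mat d d (\<lambda>(i, j). M x i j)"
  have A: "A \<in> carrier_mat d d" by (simp add: A_def)
  have "\<exists>i<d. b i \<noteq> 0"
  proof (rule ccontr)
    assume "\<not> ?thesis"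
    then have "(\<Sum>i<d. coord 1 i * b i) = 0" by simp
    then show False using coord_sum[OF L_closed(5)] by simp
  qed
  then have "vec d b \<noteq> 0\<^sub>v d" by (metis index_vec index_zero_vec(1))
  moreover have "A *\<^sub>v vec d b = x \<cdot>\<^sub>v vec d b"
    by (intro eq_vecI) (auto simp: A_def scalar_prod_def atLeast0LessThan M_sum[OF x])
  ultimately have "eigenvector A (vec d b) x" using A by (simp add: eigenvector_def)
  then have "poly (char_poly A) x = 0"
    using eigenvalue_root_char_poly[OF A] by (auto simp: eigenvalue_def)
  moreover have "char_poly A \<noteq> 0" using degree_monic_char_poly[OF A] by auto
  \<comment> \<open>The polynomials over \<open>k\<close> form a subring that contains the entries
    of the characteristic matrix, hence also its determinant.\<close>
  moreover have "char_poly A \<in> {g. \<forall>i. coeff g i \<in> k}"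
    unfolding char_poly_def
  proof (rule det_mem[OF char_poly_matrix_closed[OF A]])
    fix i j assume "i < d" "j < d"
    then show "char_poly_matrix A $$ (i, j) \<in> {g. \<forall>i. coeff g i \<in> k}"
      by (auto simp: char_poly_matrix_def A_def coeff_pCons M_in[OF x] is_subfieldD[OF k]
          intro!: is_subfieldD(3,4,7)[OF k] split: nat.splits)
  qed (auto intro: is_subfieldD[OF k] coeff_mult_in[OF k, rule_format])
  ultimately show ?thesis by (auto simp: algebraic_in_def)
qed

lemma poly_in_L:
  assumes "\<And>i. coeff g i \<in> k" and "x \<in> L"
  shows "poly g x \<in> L"
  using assms(1)
proof (induction g rule: pCons_induct)
  case (pCons c g)
  have "c \<in> k" "\<And>i. coeff g i \<in> k"
    using pCons.prems[of 0] pCons.prems[of "Suc _"] by auto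
  with pCons.IH assms(2) show ?case by (simp add: L_closed)
qed (simp add: L_closed)

text \<open>By minimality the constant term \<open>c\<close> of the minimal polynomial is nonzero,
  and x * q(x) = - c exhibits the inverse. So the ring \<open>L\<close> is a field.\<close>

lemma inverse_L:
  assumes x: "x \<in> L"
  shows "inverse x \<in> L"
proof (cases "x = 0")
  case False
  obtain P where P: "P \<noteq> 0" "\<And>i. coeff P i \<in> k" "poly P x = 0" "degree P > 0"
    "\<And>h. h \<noteq> 0 \<Longrightarrow> (\<And>i. coeff h i \<in> k) \<Longrightarrow> poly h x = 0 \<Longrightarrow> degree P \<le> degree h"
    using minimal_poly_exists[OF k algebraic_L[OF x]] by metis
  obtain c q where cq: "P = pCons c q" by (cases P)
  have c: "c \<in> k" and q: "coeff q i \<in> k" for i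
    using P(2)[of 0] P(2)[of "Suc i"] by (auto simp: cq)
  have "q \<noteq> 0" using P(4) cq by auto
  have "c \<noteq> 0"
  proof
    assume "c = 0"
    then have "poly q x = 0" using P(3) False by (simp add: cq)
    with P(5)[OF \<open>q \<noteq> 0\<close> q] show False using \<open>q \<noteq> 0\<close> by (simp add: cq)
  qed
  have "x * poly q x = - c" using P(3) by (simp add: cq eq_neg_iff_add_eq_0 add.commute)
  then have "inverse x = - inverse c * poly q x"
    using False \<open>c \<noteq> 0\<close> by (simp add: field_simps)
  then show ?thesis
    using L_closed(3)[OF L_closed(1)[OF is_subfieldD(4)[OF k is_subfieldD(6)[OF k c]]] poly_in_L[OF q x]]
    by simp
qed (simp add: L_closed)

section \<open>Compatibility of trace and norm with a derivation that preserves
  \<open>k\<close>\<close>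

context
  fixes t :: "'a \<Rightarrow> 'a"
  assumes t: "field_derivation t" and tk: "\<And>x. x \<in> k \<Longrightarrow> t x \<in> k"
begin

text \<open>Differentiating P(x) = 0 for the minimal polynomial expresses t x as a rational function
  of \<open>x\<close> over \<open>k\<close>.\<close>

lemma derivation_L:
  assumes x: "x \<in> L"
  shows "t x \<in> L"
proof -
  obtain P where P: "\<And>i. coeff P i \<in> k" "poly P x = 0" "poly (pderiv P) x \<noteq> 0"
    using minimal_poly_exists[OF k algebraic_L[OF x]] by metis
  have "poly (map_poly t P) x + poly (pderiv P) x * t x = 0"
    using field_derivation_poly[OF t, of P x] P(2) by (simp add: field_derivation_0[OF t])
  then have *: "t x = - 1 * poly (map_poly t P) x * inverse (poly (pderiv P) x)"
    using P(3) by (simp add: field_simps eq_neg_iff_add_eq_0 add.commute)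
  have "coeff (map_poly t P) i \<in> k" for i
    using tk P(1) by (simp add: coeff_map_poly field_derivation_0[OF t])
  then show ?thesis
    unfolding * using P(1)
    by (intro L_closed(3) poly_in_L inverse_L x coeff_pderiv_in[OF k] L_closed(1) is_subfieldD(2,4)[OF k])
qed

text \<open>Connection matrix of \<open>t\<close> in the basis: the \<open>b i\<close> need not be
  constants, so differentiating a multiplication matrix entrywise requires a correction.\<close>

definition conn :: "nat \<Rightarrow> nat \<Rightarrow> 'a" where
  "conn i j = coord (t (b i)) j"

lemma conn: "i < d \<Longrightarrow> j < d \<Longrightarrow> conn i j \<in> k" "i < d \<Longrightarrow> (\<Sum>j<d. conn i j * b j) = t (b i)"
  unfolding conn_def by (simp_all add: coord_in coord_sum derivation_L b_in)

text \<open>Expand t(x * b i) both by the Leibniz rule and in coordinates. The correction is the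
  commutator of the multiplication matrix of \<open>x\<close> with the connection.\<close>

lemma M_derivation:
  assumes x: "x \<in> L" and i: "i < d" "j < d"
  shows "M (t x) i j =
    t (M x i j) + (\<Sum>l<d. M x i l * conn l j) - (\<Sum>l<d. conn i l * M x l j)"
proof (rule M_unique[OF _ _ i(2)])
  have "t x * b i + x * t (b i) = t (x * b i)"
    by (simp add: field_derivation_mult[OF t])
  also have "\<dots> = t (\<Sum>j<d. M x i j * b j)"
    by (simp add: M_sum[OF x i(1)])
  also have "\<dots> = (\<Sum>j<d. t (M x i j) * b j) + (\<Sum>l<d. M x i l * t (b l))"
    by (simp add: field_derivation_sum[OF t] field_derivation_mult[OF t] sum.distrib add.commute
        mult.commute)
  also have "(\<Sum>l<d. M x i l * t (b l)) = (\<Sum>l<d. \<Sum>j<d. M x i l * conn l j * b j)"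
    by (rule sum.cong[OF refl]) (simp add: conn(2)[symmetric] sum_distrib_left mult.assoc)
  also have "\<dots> = (\<Sum>j<d. (\<Sum>l<d. M x i l * conn l j) * b j)"
    unfolding sum_distrib_right by (rule sum.swap)
  finally have 1: "t x * b i + x * t (b i) =
    (\<Sum>j<d. t (M x i j) * b j) + (\<Sum>j<d. (\<Sum>l<d. M x i l * conn l j) * b j)" .
  have "x * t (b i) = (\<Sum>l<d. conn i l * (x * b l))"
    by (simp add: conn(2)[OF i(1), symmetric] sum_distrib_left mult.left_commute)
  also have "\<dots> = (\<Sum>l<d. \<Sum>j<d. conn i l * M x l j * b j)"
    by (rule sum.cong[OF refl]) (simp add: M_sum[OF x, symmetric] sum_distrib_left mult.assoc)
  also have "\<dots> = (\<Sum>j<d. (\<Sum>l<d. conn i l * M x l j) * b j)"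
    unfolding sum_distrib_right by (rule sum.swap)
  finally have 2: "x * t (b i) = (\<Sum>j<d. (\<Sum>l<d. conn i l * M x l j) * b j)" .
  show "t x * b i = (\<Sum>j<d. (t (M x i j) + (\<Sum>l<d. M x i l * conn l j) -
      (\<Sum>l<d. conn i l * M x l j)) * b j)"
    using 1 unfolding 2 by (simp add: distrib_right left_diff_distrib sum.distrib sum_subtractf eq_diff_eq)
  show "t (M x i j) + (\<Sum>l<d. M x i l * conn l j) - (\<Sum>l<d. conn i l * M x l j) \<in> k" if "j < d" for j
    using that by (intro is_subfieldD(3,7)[OF k] is_subfield_sum[OF k] is_subfieldD(5)[OF k] tk M_in x conn i) auto
qed

text \<open>A commutator has trace 0, so the connection drops out.\<close>

lemma trace_derivation:
  assumes x: "x \<in> L"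
  shows "trace (t x) = t (trace x)"
proof -
  have "(\<Sum>i<d. \<Sum>l<d. M x i l * conn l i) = (\<Sum>i<d. \<Sum>l<d. conn i l * M x l i)"
    by (subst sum.swap) (simp add: mult.commute)
  then show ?thesis
    by (simp add: trace_def M_derivation[OF x] sum.distrib sum_subtractf field_derivation_sum[OF t])
qed

text \<open>Jacobi's formula, with the cofactors read off from the inverse matrix M(1/x), gives
  t(nrm x) = nrm x * tr(M(1/x) t(M x)). In tr(M(1/x) M(t x)) the connection enters through two
  terms; both equal its trace because M(1/x) and M x are inverse to each other, and they
  cancel.\<close>

lemma trace_log_derivation:
  assumes x: "x \<in> L" "x \<noteq> 0"
  shows "nrm x \<noteq> 0" and "trace (t x / x) = t (nrm x) / nrm x"
proof -
  define c where "c = inverse x"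
  have c: "c \<in> L" "x * c = 1" "c * x = 1" using inverse_L x by (auto simp: c_def)
  define A where "A = mat d d (\<lambda>(i, j). M x i j)"
  define C where "C = mat d d (\<lambda>(i, j). M c i j)"
  have AC: "A \<in> carrier_mat d d" "C \<in> carrier_mat d d" by (auto simp: A_def C_def)
  have one: "M 1 i j = (if i = j then 1 else 0)" if "i < d" "j < d" for i j
    using that by (intro M_scalar is_subfieldD[OF k])
  have MM: "(\<Sum>l<d. M c i l * M x l j) = (if i = j then 1 else 0)"
    "(\<Sum>l<d. M x i l * M c l j) = (if i = j then 1 else 0)" if "i < d" "j < d" for i j
    using M_mult[OF x(1) c(1) that] M_mult[OF c(1) x(1) that] one[OF that] c by auto
  have CA: "C * A = 1\<^sub>m d"
    by (intro eq_matI) (auto simp: A_def C_def scalar_prod_def atLeast0LessThan MM)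
  show nz: "nrm x \<noteq> 0"
    using nrm_mult[OF x(1) c(1)] nrm_scalar[OF is_subfieldD(2)[OF k]] c(2) by auto
  have "adj_mat A = C * (A * adj_mat A)"
    using CA AC adj_mat(1)[OF AC(1)] by (simp add: assoc_mult_mat[symmetric, of _ d d _ d _ d])
  also have "\<dots> = det A \<cdot>\<^sub>m C"
    using AC adj_mat(2)[OF AC(1)] mult_smult_distrib[OF AC(2) one_carrier_mat, of "det A"] by simp
  finally have adj: "adj_mat A = nrm x \<cdot>\<^sub>m C" by (simp add: nrm_def A_def)
  have cof: "cofactor A i j = nrm x * M c j i" if "i < d" "j < d" for i j
  proof -
    have "adj_mat A $$ (j, i) = cofactor A i j" using AC that by (simp add: adj_mat_def)
    then show ?thesis using that AC unfolding adj by (simp add: C_def)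
  qed
  have "t (nrm x) = (\<Sum>i<d. \<Sum>j<d. t (A $$ (i, j)) * cofactor A i j)"
    unfolding nrm_def A_def[symmetric] by (rule derivation_det[OF t AC(1)])
  also have "\<dots> = (\<Sum>i<d. \<Sum>j<d. nrm x * (t (M x i j) * M c j i))"
    by (intro sum.cong refl) (simp add: cof, simp add: A_def)
  finally have 1: "t (nrm x) = nrm x * (\<Sum>i<d. \<Sum>j<d. M c j i * t (M x i j))"
    by (simp add: sum_distrib_left mult.commute)
  have "trace (t x / x) = (\<Sum>j<d. M (t x * c) j j)"
    by (simp add: trace_def c_def divide_inverse)
  also have "\<dots> = (\<Sum>j<d. \<Sum>i<d. M c j i * M (t x) i j)"
    by (intro sum.cong refl M_mult derivation_L x c) auto
  also have "\<dots> = (\<Sum>j<d. \<Sum>i<d. M c j i * t (M x i j)) +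
      ((\<Sum>j<d. \<Sum>i<d. \<Sum>l<d. M c j i * M x i l * conn l j) -
       (\<Sum>j<d. \<Sum>i<d. \<Sum>l<d. M c j i * conn i l * M x l j))"
    by (simp add: M_derivation[OF x(1)] sum.distrib sum_subtractf distrib_left right_diff_distrib
        sum_distrib_left mult.assoc)
  also have "(\<Sum>j<d. \<Sum>i<d. \<Sum>l<d. M c j i * M x i l * conn l j) = (\<Sum>l<d. conn l l)"
  proof -
    have "(\<Sum>i<d. \<Sum>l<d. M c j i * M x i l * conn l j) = conn j j" if "j < d" for j
    proof -
      have "(\<Sum>i<d. \<Sum>l<d. M c j i * M x i l * conn l j) = (\<Sum>l<d. (\<Sum>i<d. M c j i * M x i l) * conn l j)"
        unfolding sum_distrib_right by (rule sum.swap)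
      also have "\<dots> = (\<Sum>l<d. if j = l then conn l j else 0)"
        by (rule sum.cong) (use that in \<open>auto simp: MM\<close>)
      finally show ?thesis using that by simp
    qed
    then show ?thesis by simp
  qed
  also have "(\<Sum>j<d. \<Sum>i<d. \<Sum>l<d. M c j i * conn i l * M x l j) = (\<Sum>l<d. conn l l)"
  proof -
    have "(\<Sum>j<d. \<Sum>i<d. \<Sum>l<d. M c j i * conn i l * M x l j) =
        (\<Sum>i<d. \<Sum>j<d. \<Sum>l<d. M c j i * conn i l * M x l j)"
      by (rule sum.swap)
    also have "\<dots> = (\<Sum>i<d. \<Sum>l<d. \<Sum>j<d. M c j i * conn i l * M x l j)"
      by (intro sum.cong refl sum.swap)
    also have "\<dots> = (\<Sum>i<d. \<Sum>l<d. conn i l * (\<Sum>j<d. M x l j * M c j i))"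
      by (simp add: sum_distrib_left mult.commute mult.left_commute)
    also have "\<dots> = (\<Sum>i<d. \<Sum>l<d. if l = i then conn i l else 0)"
      by (intro sum.cong refl) (auto simp: MM)
    finally show ?thesis by simp
  qed
  also have "(\<Sum>j<d. \<Sum>i<d. M c j i * t (M x i j)) = (\<Sum>i<d. \<Sum>j<d. M c j i * t (M x i j))"
    by (rule sum.swap)
  finally have "trace (t x / x) = (\<Sum>i<d. \<Sum>j<d. M c j i * t (M x i j))" by simp
  then show "trace (t x / x) = t (nrm x) / nrm x" using nz by (simp add: 1)
qed

end

end

lemma finite_extension_basis_exists:
  fixes k :: "'a::field_char_0 set"
  assumes "is_subfield k" and "finite_algebra k L"
  obtains d b where "finite_extension_basis k L d b"
proof (rule finite_algebra_basis[OF assms])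
  fix d :: nat and b
  assume "\<And>i. i < d \<Longrightarrow> b i \<in> L"
    and "\<And>x. x \<in> L \<Longrightarrow> \<exists>c. (\<forall>i<d. c i \<in> k) \<and> x = (\<Sum>i<d. c i * b i)"
    and "\<And>c. (\<And>i. i < d \<Longrightarrow> c i \<in> k) \<Longrightarrow> (\<Sum>i<d. c i * b i) = 0 \<Longrightarrow> \<forall>i<d. c i = 0"
  with assms have "finite_extension_basis k L d b"
    by (rule finite_extension_basis.intro)
  then show thesis by (rule that)
qed

section \<open>Residues\<close>

text \<open>If f has order n \<noteq> 0, the leading coefficient of f' is n times that of f, one
  degree lower, so f'/f has a simple pole with residue n. For n = 0 the leading term disappears on
  differentiation, but f'/f then has no pole.\<close>

lemma fls_residue_log_deriv:
  fixes f :: "'a::field_char_0 fls"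
  assumes f: "f \<noteq> 0"
  shows "fls_residue (fls_deriv f / f) = of_int (fls_subdegree f)"
proof -
  define h where "h = fls_deriv f / f"
  have fh: "fls_deriv f = f * h" using f by (simp add: h_def)
  show ?thesis
  proof (cases "fls_subdegree f = 0")
    case True
    then have "fls_subdegree (fls_deriv f) \<ge> 0" by (rule fls_deriv_subdegree0)
    show ?thesis
    proof (cases "h = 0")
      case h0: True
      then show ?thesis using True by (simp add: h_def[symmetric])
    next
      case False
      then have "fls_subdegree (fls_deriv f) = fls_subdegree h"
        using f True by (simp add: fh)
      then have "fls_subdegree h \<ge> 0" using \<open>fls_subdegree (fls_deriv f) \<ge> 0\<close> by simp
      then show ?thesis using True by (simp add: h_def[symmetric])
    qed
  next
    case False
    then have sd: "fls_subdegree (fls_deriv f) = fls_subdegree f - 1"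
      by (intro fls_subdegree_deriv) simp
    have "fls_nth (fls_deriv f) (fls_subdegree f - 1) \<noteq> 0"
      using False f by simp
    then have "h \<noteq> 0" using fh by auto
    then have h: "fls_subdegree h = - 1" using f sd by (simp add: fh)
    have "of_int (fls_subdegree f) * fls_nth f (fls_subdegree f) =
        fls_nth (f * h) (fls_subdegree f + fls_subdegree h)"
      unfolding fh[symmetric] h by simp
    also have "\<dots> = fls_nth f (fls_subdegree f) * fls_nth h (fls_subdegree h)"
      by (rule fls_times_base)
    finally show ?thesis using f h by (simp add: h_def[symmetric])
  qed
qed

definition fls_of_poly :: "'a::field poly \<Rightarrow> 'a fls" where
  "fls_of_poly g = fps_to_fls (fps_of_poly g)"

lemma fls_of_poly_simps:
  "fls_of_poly (g + h) = fls_of_poly g + fls_of_poly h"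
  "fls_of_poly (g - h) = fls_of_poly g - fls_of_poly h"
  "fls_of_poly (g * h) = fls_of_poly g * fls_of_poly h"
  "fls_of_poly (pderiv g) = fls_deriv (fls_of_poly g)"
  "fls_of_poly g = 0 \<longleftrightarrow> g = 0"
  "fls_of_poly [:c:] = fls_const c"
  "fls_of_poly [:0, 1:] = fls_X"
  by (simp_all add: fls_of_poly_def fps_of_poly_add fps_of_poly_diff fps_of_poly_mult
      fps_of_poly_pderiv fls_deriv_fps_to_fls fls_times_fps_to_fls fps_of_poly_eq_iff[of _ 0, simplified]
      fps_of_poly_const)

text \<open>
  The map is expansion at \<open>u = 0\<close>; \<open>u\<close> is transcendental over \<open>K\<close> because \<open>t u = 1\<close>.
\<close>

lemma laurent_expansion:
  assumes K: "is_subfield K" and t: "field_derivation t" "\<And>c. c \<in> K \<Longrightarrow> t c = 0" "t u = 1"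
  obtains \<phi> :: "'a::field_char_0 \<Rightarrow> 'a fls" where
    "\<And>x y. x \<in> rational_functions K u \<Longrightarrow> y \<in> rational_functions K u \<Longrightarrow> \<phi> (x + y) = \<phi> x + \<phi> y"
    "\<And>x y. x \<in> rational_functions K u \<Longrightarrow> y \<in> rational_functions K u \<Longrightarrow> \<phi> (x * y) = \<phi> x * \<phi> y"
    "\<And>x. x \<in> rational_functions K u \<Longrightarrow> \<phi> x = 0 \<longleftrightarrow> x = 0"
    "\<And>c. c \<in> K \<Longrightarrow> \<phi> c = fls_const c" "\<phi> u = fls_X"
    "\<And>x. x \<in> rational_functions K u \<Longrightarrow> t x \<in> rational_functions K u"
    "\<And>x. x \<in> rational_functions K u \<Longrightarrow> \<phi> (t x) = fls_deriv (\<phi> x)"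
proof -
  have u: "\<not> algebraic_in K u"
    using algebraic_in_kernel[OF t(1) K t(2)] t(3) by auto
  let ?k = "rational_functions K u"
  \<comment> \<open>The quotient of the expansions of numerator and denominator, for some
    representation as a fraction; \<open>inj\<close>, which rests on the transcendence of
    \<open>u\<close>, makes the result independent of the representation.\<close>
  define \<phi> where "\<phi> x = (SOME f. \<exists>g h. (\<forall>i. coeff g i \<in> K) \<and> (\<forall>i. coeff h i \<in> K) \<and> poly h u \<noteq> 0 \<and>
    x = poly g u / poly h u \<and> f = fls_of_poly g / fls_of_poly h)" for x
  have inj: "g = h" if "\<forall>i. coeff g i \<in> K" "\<forall>i. coeff h i \<in> K" "poly g u = poly h u" for g h
  proof -
    have "\<forall>i. coeff (g - h) i \<in> K" using that is_subfieldD(7)[OF K] by simp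
    moreover have "poly (g - h) u = 0" using that by simp
    ultimately have "g - h = 0" using u unfolding algebraic_in_def by blast
    then show ?thesis by simp
  qed
  have \<phi>: "\<phi> (poly g u / poly h u) = fls_of_poly g / fls_of_poly h"
    if gh: "\<forall>i. coeff g i \<in> K" "\<forall>i. coeff h i \<in> K" "poly h u \<noteq> 0" for g h
  proof -
    have "\<exists>f. \<exists>g' h'. (\<forall>i. coeff g' i \<in> K) \<and> (\<forall>i. coeff h' i \<in> K) \<and> poly h' u \<noteq> 0 \<and>
      poly g u / poly h u = poly g' u / poly h' u \<and> f = fls_of_poly g' / fls_of_poly h'"
      using gh by blast
    from someI_ex[OF this, folded \<phi>_def] obtain g' h' where
      gh': "\<forall>i. coeff g' i \<in> K" "\<forall>i. coeff h' i \<in> K" "poly h' u \<noteq> 0"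
      and eq: "poly g u / poly h u = poly g' u / poly h' u"
      and f: "\<phi> (poly g u / poly h u) = fls_of_poly g' / fls_of_poly h'" by blast
    have "g * h' = g' * h"
      by (rule inj) (use eq gh gh' in \<open>auto simp: field_simps coeff_mult_in[OF K, rule_format]\<close>)
    then have "fls_of_poly g * fls_of_poly h' = fls_of_poly g' * fls_of_poly h"
      by (metis fls_of_poly_simps(3))
    moreover have "fls_of_poly h \<noteq> 0" "fls_of_poly h' \<noteq> 0"
      using gh(3) gh'(3) by (auto simp: fls_of_poly_simps)
    ultimately show ?thesis unfolding f by (simp add: field_simps)
  qed
  have const: "\<forall>i. coeff [:c:] i \<in> K" if "c \<in> K" for c
    using that is_subfieldD[OF K] by (auto simp: coeff_pCons split: nat.splits)
  have one: "\<forall>i. coeff [:1:] i \<in> K" using is_subfieldD[OF K] by (intro const) auto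
  have nz: "fls_of_poly h \<noteq> 0" if "poly h u \<noteq> 0" for h
    using that by (auto simp: fls_of_poly_simps)
  show thesis
  proof (rule that[of \<phi>])
    fix x y assume "x \<in> ?k" "y \<in> ?k"
    then obtain g h g' h' where x: "x = poly g u / poly h u" "\<forall>i. coeff g i \<in> K" "\<forall>i. coeff h i \<in> K" "poly h u \<noteq> 0"
      and y: "y = poly g' u / poly h' u" "\<forall>i. coeff g' i \<in> K" "\<forall>i. coeff h' i \<in> K" "poly h' u \<noteq> 0"
      by (elim rational_functionsE)
    have hh: "\<forall>i. coeff (h * h') i \<in> K" by (rule coeff_mult_in[OF K x(3) y(3)])
    have nz2: "poly (h * h') u \<noteq> 0" using x(4) y(4) by simp
    have "\<forall>i. coeff (g * h' + g' * h) i \<in> K"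
      by (intro coeff_add_in[OF K] coeff_mult_in[OF K] x y)
    from \<phi>[OF this hh nz2] have "\<phi> (poly (g * h' + g' * h) u / poly (h * h') u) = \<phi> x + \<phi> y"
      using nz[OF x(4)] nz[OF y(4)]
      by (simp add: x(1) y(1) \<phi>[OF x(2-4)] \<phi>[OF y(2-4)] fls_of_poly_simps add_frac_eq)
    also have "poly (g * h' + g' * h) u / poly (h * h') u = x + y"
      using x(4) y(4) by (simp add: x(1) y(1) add_frac_eq)
    finally show "\<phi> (x + y) = \<phi> x + \<phi> y" .
    have "\<forall>i. coeff (g * g') i \<in> K" by (intro coeff_mult_in[OF K] x y)
    from \<phi>[OF this hh nz2] show "\<phi> (x * y) = \<phi> x * \<phi> y"
      by (simp add: x(1) y(1) \<phi>[OF x(2-4)] \<phi>[OF y(2-4)] fls_of_poly_simps)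
  next
    fix x assume "x \<in> ?k"
    then obtain g h where x: "x = poly g u / poly h u" "\<forall>i. coeff g i \<in> K" "\<forall>i. coeff h i \<in> K" "poly h u \<noteq> 0"
      by (elim rational_functionsE)
    have "poly g u = 0 \<longleftrightarrow> g = 0"
      using u x(2) by (auto simp: algebraic_in_def)
    then show "\<phi> x = 0 \<longleftrightarrow> x = 0"
      using nz[OF x(4)] x(4) by (simp add: x(1) \<phi>[OF x(2-4)] fls_of_poly_simps)
  next
    fix c assume c: "c \<in> K"
    show "\<phi> c = fls_const c"
      using \<phi>[OF const[OF c] one] by (simp add: fls_of_poly_simps)
  next
    have "\<forall>i. coeff [:0, 1:] i \<in> K"
      using is_subfieldD[OF K] by (auto simp: coeff_pCons split: nat.splits)
    from \<phi>[OF this one] show "\<phi> u = fls_X" by (simp add: fls_of_poly_simps)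
  next
    fix x assume "x \<in> ?k"
    then obtain g h where x: "x = poly g u / poly h u" "\<forall>i. coeff g i \<in> K" "\<forall>i. coeff h i \<in> K" "poly h u \<noteq> 0"
      by (elim rational_functionsE)
    have tp: "t (poly g u) = poly (pderiv g) u" if "\<forall>i. coeff g i \<in> K" for g
    proof -
      have "map_poly t g = 0"
        using that t(2) by (intro poly_eqI) (simp add: coeff_map_poly field_derivation_0[OF t(1)])
      then show ?thesis by (simp add: field_derivation_poly[OF t(1)] t(3))
    qed
    let ?g = "pderiv g * h - g * pderiv h"
    have tx: "t x = poly ?g u / poly (h * h) u"
      using x(4) by (simp add: x(1) field_derivation_divide[OF t(1)] tp[OF x(2)] tp[OF x(3)] power2_eq_square)
    have "\<forall>i. coeff (pderiv g) i \<in> K" "\<forall>i. coeff (pderiv h) i \<in> K"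
      using coeff_pderiv_in[OF K] x by blast+
    then have 1: "\<forall>i. coeff ?g i \<in> K"
      using coeff_mult_in[OF K _ x(3), of "pderiv g"] coeff_mult_in[OF K x(2), of "pderiv h"]
        is_subfieldD(7)[OF K] by simp
    have 2: "\<forall>i. coeff (h * h) i \<in> K" by (rule coeff_mult_in[OF K x(3) x(3)])
    have 3: "poly (h * h) u \<noteq> 0" using x(4) by simp
    have "\<phi> (t x) = (fls_deriv (fls_of_poly g) * fls_of_poly h - fls_of_poly g * fls_deriv (fls_of_poly h)) /
        (fls_of_poly h * fls_of_poly h)"
      unfolding tx \<phi>[OF 1 2 3] by (simp only: fls_of_poly_simps)
    also have "\<dots> = fls_deriv (fls_of_poly g / fls_of_poly h)"
    proof -
      define f where "f = fls_of_poly g / fls_of_poly h"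
      have "fls_of_poly g = f * fls_of_poly h" using nz[OF x(4)] by (simp add: f_def)
      then show ?thesis
        unfolding f_def[symmetric] using nz[OF x(4)] by (simp add: field_simps)
    qed
    finally show "\<phi> (t x) = fls_deriv (\<phi> x)" by (simp add: x(1) \<phi>[OF x(2-4)])
    show "t x \<in> ?k" using rational_functionsI[OF 1 2 3] tx by simp
  qed
qed

text \<open>
  Taking traces reduces to \<open>K(u)\<close>; there the residue at \<open>u = 0\<close> of \<open>d/du\<close> of the right-hand side
  vanishes, while the one of the left-hand side is an integer combination of the \<open>e i\<close>, with the
  degree of the extension as coefficient of \<open>e i0\<close>.
\<close>

lemma log_derivatives_exact:
  fixes D :: "'a::field_char_0 \<Rightarrow> 'a" and e u :: "'i \<Rightarrow> 'a"
  assumes D: "field_derivation D" and I: "finite I"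
    and e: "\<And>i. i \<in> I \<Longrightarrow> D (e i) = 0"
    and eindep: "\<And>m :: 'i \<Rightarrow> int. (\<Sum>i\<in>I. e i * of_int (m i)) = 0 \<Longrightarrow> \<forall>i\<in>I. m i = 0"
    and u: "\<And>i. i \<in> I \<Longrightarrow> u i \<noteq> 0"
    and exact: "\<And>d. field_derivation d \<Longrightarrow> (\<And>x. D x = 0 \<Longrightarrow> d x = 0) \<Longrightarrow>
      (\<Sum>i\<in>I. e i * (d (u i) / u i)) = d v"
    and i0: "i0 \<in> I"
  shows "D (u i0) = 0"
proof (rule ccontr)
  assume nz: "D (u i0) \<noteq> 0"
  obtain t where t: "field_derivation t" "\<And>x. D x = 0 \<Longrightarrow> t x = 0" "t (u i0) = 1"
    and alg: "\<And>w. w \<in> insert v (u ` I) \<Longrightarrow> algebraic_in (rational_functions {x. t x = 0} (u i0)) w"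
    using derivation_with_algebraic[OF D nz, of "insert v (u ` I)"] I by auto
  define K where "K = {x. t x = 0}"
  define k where "k = rational_functions K (u i0)"
  have K: "is_subfield K" unfolding K_def by (rule is_subfield_kernel[OF t(1)])
  have k: "is_subfield k" unfolding k_def by (rule is_subfield_rational_functions[OF K])
  have tK: "t c = 0" if "c \<in> K" for c using that by (simp add: K_def)
  obtain \<phi> :: "'a \<Rightarrow> 'a fls" where
    add: "\<And>x y. x \<in> k \<Longrightarrow> y \<in> k \<Longrightarrow> \<phi> (x + y) = \<phi> x + \<phi> y" and
    mul: "\<And>x y. x \<in> k \<Longrightarrow> y \<in> k \<Longrightarrow> \<phi> (x * y) = \<phi> x * \<phi> y" and
    z: "\<And>x. x \<in> k \<Longrightarrow> \<phi> x = 0 \<longleftrightarrow> x = 0" and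
    con: "\<And>c. c \<in> K \<Longrightarrow> \<phi> c = fls_const c" and \<phi>u: "\<phi> (u i0) = fls_X" and
    tk: "\<And>x. x \<in> k \<Longrightarrow> t x \<in> k" and \<phi>t: "\<And>x. x \<in> k \<Longrightarrow> \<phi> (t x) = fls_deriv (\<phi> x)"
    using laurent_expansion[OF K t(1) tK t(3)] unfolding k_def by blast
  obtain L where FL: "finite_algebra k L" "insert v (u ` I) \<subseteq> L"
    using finite_algebra_exists[OF k, of "insert v (u ` I)"] alg I unfolding k_def K_def by blast
  obtain n b where "finite_extension_basis k L n b"
    using finite_extension_basis_exists[OF k FL(1)] .
  then interpret finite_extension_basis k L n b .
  have uL: "u i \<in> L" if "i \<in> I" for i using FL(2) that by auto
  have eK: "e i \<in> K" if "i \<in> I" for i using e[OF that] t(2) by (simp add: K_def)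
  have Kk: "K \<subseteq> k" unfolding k_def by (rule rational_functions_superset(1)[OF K])
  have tu: "t (u i) / u i \<in> L" if "i \<in> I" for i
    using L_closed(3)[OF derivation_L[OF t(1) tk uL[OF that]] inverse_L[OF uL[OF that]]]
    by (simp add: divide_inverse)
  have "trace (\<Sum>i\<in>I. e i * (t (u i) / u i)) = trace (t v)"
    using exact[OF t(1,2)] by simp
  also have "trace (\<Sum>i\<in>I. e i * (t (u i) / u i)) = (\<Sum>i\<in>I. e i * trace (t (u i) / u i))"
    using Kk eK by (intro trace_sum(2)[OF I _ tu]) auto
  also have "\<dots> = (\<Sum>i\<in>I. e i * (t (nrm (u i)) / nrm (u i)))"
    by (rule sum.cong[OF refl]) (simp add: trace_log_derivation(2)[OF t(1) tk uL u])
  also have "trace (t v) = t (trace v)"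
    using FL(2) by (intro trace_derivation[OF t(1) tk]) auto
  finally have eq: "(\<Sum>i\<in>I. e i * (t (nrm (u i)) / nrm (u i))) = t (trace v)" .
  define N where "N i = nrm (u i)" for i
  have N: "N i \<in> k" "N i \<noteq> 0" if "i \<in> I" for i
    using nrm_in[OF uL[OF that]] trace_log_derivation(1)[OF t(1) tk uL[OF that] u[OF that]]
    by (auto simp: N_def)
  have w: "trace v \<in> k" using FL(2) by (intro trace_in) auto
  have div: "t (N i) / N i \<in> k" if "i \<in> I" for i
    using that by (intro is_subfieldD(8)[OF k] tk N)
  have \<phi>div: "\<phi> (t (N i) / N i) = fls_deriv (\<phi> (N i)) / \<phi> (N i)" if "i \<in> I" for i
  proof -
    have "\<phi> (t (N i) / N i) * \<phi> (N i) = fls_deriv (\<phi> (N i))"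
      using mul[OF div[OF that] N(1)[OF that]] N(2)[OF that] \<phi>t[OF N(1)[OF that]] by simp
    then show ?thesis using z[OF N(1)[OF that]] N(2)[OF that] by (simp add: field_simps)
  qed
  \<comment> \<open>Additivity of \<open>\<phi>\<close> is known only on \<open>k\<close>, so the
    induction over subsets carries membership in \<open>k\<close> along.\<close>
  have "\<phi> (\<Sum>i\<in>J. e i * (t (N i) / N i)) =
    (\<Sum>i\<in>J. fls_const (e i) * (fls_deriv (\<phi> (N i)) / \<phi> (N i)))" if "J \<subseteq> I" for J
  proof -
    have "finite J" using that I finite_subset by blast
    then have "(\<Sum>i\<in>J. e i * (t (N i) / N i)) \<in> k \<and> \<phi> (\<Sum>i\<in>J. e i * (t (N i) / N i)) =
        (\<Sum>i\<in>J. fls_const (e i) * (fls_deriv (\<phi> (N i)) / \<phi> (N i)))"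
      using that
    proof (induction J rule: finite_induct)
      case empty
      then show ?case using z[of 0] is_subfieldD(1)[OF k] by simp
    next
      case (insert i J)
      then have i: "i \<in> I" by simp
      then have ek: "e i \<in> k" using eK Kk by auto
      have "e i * (t (N i) / N i) \<in> k" by (intro is_subfieldD(5)[OF k] ek div i)
      then show ?case
        using insert by (simp add: add mul[OF ek div[OF i]] con[OF eK[OF i]] \<phi>div[OF i] is_subfieldD(3)[OF k]
            del: times_divide_eq_right)
    qed
    then show ?thesis ..
  qed
  from this[of I] have "(\<Sum>i\<in>I. fls_const (e i) * (fls_deriv (\<phi> (N i)) / \<phi> (N i))) = fls_deriv (\<phi> (trace v))"
    using eq \<phi>t[OF w] by (simp add: N_def)
  then have residue0: "fls_residue (\<Sum>i\<in>I. fls_const (e i) * (fls_deriv (\<phi> (N i)) / \<phi> (N i))) = 0"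
    by (simp only: fls_residue_deriv)
  have res_sum: "fls_residue (\<Sum>i\<in>I. f i) = (\<Sum>i\<in>I. fls_residue (f i))" for f :: "'i \<Rightarrow> 'a fls"
    by (induction I rule: infinite_finite_induct) auto
  have res_const: "fls_residue (fls_const c * f) = c * fls_residue f" for c and f :: "'a fls"
    by simp
  have res: "fls_residue (fls_deriv (\<phi> (N i)) / \<phi> (N i)) = of_int (fls_subdegree (\<phi> (N i)))"
    if "i \<in> I" for i
    using z[OF N(1)[OF that]] N(2)[OF that] by (intro fls_residue_log_deriv) simp
  have "fls_residue (\<Sum>i\<in>I. fls_const (e i) * (fls_deriv (\<phi> (N i)) / \<phi> (N i))) =
      (\<Sum>i\<in>I. e i * of_int (fls_subdegree (\<phi> (N i))))"
    unfolding res_sum res_const by (intro sum.cong refl) (simp only: res)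
  with residue0 have "(\<Sum>i\<in>I. e i * of_int (fls_subdegree (\<phi> (N i)))) = 0" by (simp only:)
  then have "fls_subdegree (\<phi> (N i0)) = 0" using eindep[of "\<lambda>i. fls_subdegree (\<phi> (N i))"] i0 by simp
  moreover have uk: "u i0 \<in> k" unfolding k_def by (rule rational_functions_superset(2)[OF K])
  have "\<phi> (u i0 ^ j) = fls_X ^ j" for j
  proof (induction j)
    case 0
    then show ?case using con[OF is_subfieldD(2)[OF K]] by simp
  next
    case (Suc j)
    then show ?case by (simp add: mul[OF uk is_subfield_power[OF k uk]] \<phi>u)
  qed
  then have "\<phi> (N i0) = fls_X ^ n" by (simp add: N_def nrm_scalar[OF uk])
  ultimately show False using d_pos by simp
qed

section \<open>Families of vectors\<close>

context vector_space
begin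

text \<open>Links indexed families to independent sets; a repetition f i = f j is excluded by the
  relation with coefficients 1 and -1.\<close>

lemma independent_familyI:
  assumes I: "finite I" and 0: "\<And>c. (\<Sum>i\<in>I. scale (c i) (f i)) = 0 \<Longrightarrow> \<forall>i\<in>I. c i = 0"
  shows "inj_on f I" and "independent (f ` I)"
proof -
  show inj: "inj_on f I"
  proof (rule inj_onI, rule ccontr)
    fix i j assume ij: "i \<in> I" "j \<in> I" "f i = f j" "i \<noteq> j"
    let ?c = "\<lambda>k. if k = i then 1 else if k = j then - 1 else (0::'a)"
    have "(\<Sum>k\<in>I. scale (?c k) (f k)) = (\<Sum>k\<in>{i, j}. scale (?c k) (f k))"
      using I ij by (intro sum.mono_neutral_right) auto
    also have "\<dots> = 0" using ij by simp
    finally show False using 0[of ?c] ij(1) by auto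
  qed
  show "independent (f ` I)"
    unfolding dependent_finite[OF finite_imageI[OF I]]
  proof safe
    fix u i assume u: "(\<Sum>v\<in>f ` I. scale (u v) v) = 0" "i \<in> I" "u (f i) \<noteq> 0"
    have "(\<Sum>i\<in>I. scale (u (f i)) (f i)) = 0" using u(1) by (simp add: sum.reindex[OF inj])
    from 0[OF this] u(2,3) show False by blast
  qed
qed

lemma independent_familyD:
  assumes "inj_on f I" and "finite I" and "independent (f ` I)"
    and "(\<Sum>i\<in>I. scale (c i) (f i)) = 0" and "i \<in> I"
  shows "c i = 0"
proof -
  define idx where "idx = the_inv_into I f"
  have idx: "idx (f i) = i" if "i \<in> I" for i
    unfolding idx_def using assms(1) that by (rule the_inv_into_f_f)
  have "(\<Sum>v\<in>f ` I. scale (c (idx v)) v) = (\<Sum>i\<in>I. scale (c i) (f i))"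
    unfolding sum.reindex[OF assms(1)] by (intro sum.cong) (auto simp: idx)
  then have "c (idx (f i)) = 0"
    using independentD[OF assms(3), of "f ` I" "\<lambda>v. c (idx v)" "f i"] assms by simp
  then show ?thesis by (simp add: idx assms(5))
qed

end

definition rat_scale :: "rat \<Rightarrow> 'a::field_char_0 \<Rightarrow> 'a" where
  "rat_scale q x = of_rat q * x"

interpretation rat: vector_space rat_scale
  by unfold_locales (simp_all add: rat_scale_def algebra_simps of_rat_add of_rat_mult)

text \<open>Used with derivations as arguments: differentials become vectors over the whole
  field.\<close>

definition fun_scale :: "'a::field \<Rightarrow> ('b \<Rightarrow> 'a) \<Rightarrow> 'b \<Rightarrow> 'a" where
  "fun_scale c f = (\<lambda>x. c * f x)"

interpretation fn: vector_space fun_scale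
  by unfold_locales (simp_all add: fun_scale_def fun_eq_iff algebra_simps)

lemma common_denominator:
  fixes q :: "'i \<Rightarrow> rat"
  assumes "finite I"
  shows "\<exists>N::int. N > 0 \<and> (\<forall>i\<in>I. \<exists>m::int. of_int N * q i = of_int m)"
  using assms
proof (induction I rule: finite_induct)
  case empty
  then show ?case by (intro exI[of _ 1]) simp
next
  case (insert i I)
  then obtain N :: int where N: "N > 0" "\<forall>i\<in>I. \<exists>m::int. of_int N * q i = of_int m" by blast
  obtain a b where ab: "q i = Rat.Fract a b" "b > 0" by (cases "q i") auto
  then have qi: "of_int b * q i = of_int a" by (simp add: Fract_of_int_quotient)
  show ?case
  proof (rule exI[of _ "N * b"], intro conjI ballI)
    show "N * b > 0" using N(1) ab(2) by simp
    fix j assume "j \<in> insert i I"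
    then consider "j = i" | "j \<in> I" by blast
    then show "\<exists>m::int. of_int (N * b) * q j = of_int m"
    proof cases
      case 1
      then show ?thesis using qi by (intro exI[of _ "N * a"]) (simp add: mult.assoc)
    next
      case 2
      then obtain m :: int where "of_int N * q j = of_int m" using N(2) by blast
      then show ?thesis by (intro exI[of _ "b * m"]) (simp add: mult.assoc mult.left_commute)
    qed
  qed
qed


section \<open>Ax's theorem for one derivation\<close>

context
  fixes D :: "'a::field_char_0 \<Rightarrow> 'a"
  assumes D: "field_derivation D"
begin

definition der :: "('a \<Rightarrow> 'a) set" where
  "der = {d. field_derivation d \<and> (\<forall>x. D x = 0 \<longrightarrow> d x = 0)}"

lemma der_derivation: "d \<in> der \<Longrightarrow> field_derivation d"
  and der_zero: "d \<in> der \<Longrightarrow> D x = 0 \<Longrightarrow> d x = 0"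
  and D_der: "D \<in> der"
  using D by (auto simp: der_def)

lemma der_lincomb: "d \<in> der \<Longrightarrow> e \<in> der \<Longrightarrow> (\<lambda>x. a * d x + b * e x) \<in> der"
  by (auto simp: der_def field_derivation_lincomb)

text \<open>The bracket expresses the Lie derivative of a functional on \<open>der\<close>: (L_D
  \<omega>)(d) = D(\<omega>(d)) - \<omega>([D, d]).\<close>

lemma commutator_der: "d \<in> der \<Longrightarrow> (\<lambda>x. D (d x) - d (D x)) \<in> der"
  using field_derivation_commutator[OF D] field_derivation_0[OF D]
  by (auto simp: der_def field_derivation_0)

context
  fixes I :: "'i set" and y z :: "'i \<Rightarrow> 'a"
  assumes I: "finite I" and z: "\<And>i. i \<in> I \<Longrightarrow> z i \<noteq> 0"
    and Dz: "\<And>i. i \<in> I \<Longrightarrow> D (z i) = z i * D (y i)"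
    and yindep: "\<And>m :: 'i \<Rightarrow> int. D (\<Sum>i\<in>I. of_int (m i) * y i) = 0 \<Longrightarrow> \<forall>i\<in>I. m i = 0"
begin

text \<open>Constant coefficients can be integrated: \<Sum> f i dy i = d(\<Sum> f i y i), so the
  relation makes \<Sum> f i dz i / z i exact. Over a rational basis \<open>E\<close> of the span of
  the f i, with denominators cleared by \<open>N\<close>, this becomes a combination of du e / u e
  with u e a product of powers of the z i. By \<open>log_derivatives_exact\<close> the u e are
  constants, and since D(u e) / u e = D(\<Sum> m i e * y i), all exponents vanish.\<close>

lemma ax_constant_coefficients:
  assumes f: "\<And>i. i \<in> I \<Longrightarrow> D (f i) = 0"
    and rel: "\<And>d. d \<in> der \<Longrightarrow> (\<Sum>i\<in>I. f i * (d (y i) - d (z i) / z i)) = 0"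
  shows "\<forall>i\<in>I. f i = 0"
proof -
  obtain E where E: "E \<subseteq> f ` I" "rat.independent E" "f ` I \<subseteq> rat.span E"
    by (rule rat.maximal_independent_subset)
  have finE: "finite E" using E(1) I by (rule finite_subset[OF _ finite_imageI])
  have "\<exists>q. f i = (\<Sum>e\<in>E. rat_scale (q e) e)" if "i \<in> I" for i
    using E(3) that unfolding rat.span_finite[OF finE] by auto
  then obtain q where q: "\<And>i. i \<in> I \<Longrightarrow> f i = (\<Sum>e\<in>E. rat_scale (q i e) e)" by metis
  obtain N :: int where N: "N > 0" "\<forall>p\<in>I \<times> E. \<exists>m::int. of_int N * q (fst p) (snd p) = of_int m"
    using common_denominator[of "I \<times> E" "\<lambda>p. q (fst p) (snd p)"] I finE by auto
  then have "\<forall>i\<in>I. \<forall>e\<in>E. \<exists>m::int. of_int N * q i e = of_int m" by auto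
  then obtain m :: "'i \<Rightarrow> 'a \<Rightarrow> int" where m: "\<And>i e. i \<in> I \<Longrightarrow> e \<in> E \<Longrightarrow> of_int N * q i e = of_int (m i e)"
    by metis
  have Nf: "of_int N * f i = (\<Sum>e\<in>E. of_int (m i e) * e)" if "i \<in> I" for i
  proof -
    have "of_int N * rat_scale (q i e) e = of_int (m i e) * e" if "e \<in> E" for e
      using arg_cong[OF m[OF \<open>i \<in> I\<close> that], of "of_rat :: rat \<Rightarrow> 'a"]
      by (simp add: rat_scale_def of_rat_mult mult.assoc[symmetric])
    then show ?thesis by (simp add: q[OF that] sum_distrib_left)
  qed
  define u where "u e = (\<Prod>i\<in>I. z i powi m i e)" for e
  have u: "u e \<noteq> 0" for e using z I by (simp add: u_def)
  have du: "d (u e) / u e = (\<Sum>i\<in>I. of_int (m i e) * (d (z i) / z i))" if "d \<in> der" for d e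
  proof -
    have "d (u e) / u e = (\<Sum>i\<in>I. d (z i powi m i e) / z i powi m i e)"
      unfolding u_def using z by (intro log_derivative_prod der_derivation that I) simp
    also have "\<dots> = (\<Sum>i\<in>I. of_int (m i e) * (d (z i) / z i))"
      using z by (intro sum.cong log_derivative_power_int der_derivation that) auto
    finally show ?thesis .
  qed
  define w where "w = (\<Sum>i\<in>I. of_int N * f i * y i)"
  have "D (u e) = 0" if "e \<in> E" for e
  proof (rule log_derivatives_exact[OF D finE, where e = "\<lambda>e. e" and u = u and v = w])
    show "D e = 0" if "e \<in> E" for e using E(1) f that by auto
    show "u e \<noteq> 0" for e by (rule u)
    show "\<forall>e\<in>E. k e = 0" if "(\<Sum>e\<in>E. e * of_int (k e)) = 0" for k :: "'a \<Rightarrow> int"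
    proof
      fix e assume e: "e \<in> E"
      have "(\<Sum>e\<in>E. rat_scale (of_int (k e)) e) = 0"
        using that by (simp add: rat_scale_def mult.commute)
      from rat.independentD[OF E(2) finE subset_refl this e] show "k e = 0" by simp
    qed
    show "e \<in> E" by fact
    fix d assume "field_derivation d" "\<And>x. D x = 0 \<Longrightarrow> d x = 0"
    then have d: "d \<in> der" by (simp add: der_def)
    have "(\<Sum>e\<in>E. e * (d (u e) / u e)) = (\<Sum>e\<in>E. \<Sum>i\<in>I. of_int (m i e) * e * (d (z i) / z i))"
      by (simp only: du[OF d] sum_distrib_left mult.left_commute mult.assoc)
    also have "\<dots> = (\<Sum>i\<in>I. of_int N * f i * (d (z i) / z i))"
      by (subst sum.swap) (simp only: Nf sum_distrib_right cong: sum.cong)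
    also have "\<dots> = (\<Sum>i\<in>I. of_int N * f i * d (y i)) -
        of_int N * (\<Sum>i\<in>I. f i * (d (y i) - d (z i) / z i))"
      by (simp add: sum_distrib_left right_diff_distrib sum_subtractf mult.assoc)
    also have "\<dots> = (\<Sum>i\<in>I. of_int N * f i * d (y i))" by (simp only: rel[OF d]) simp
    also have "\<dots> = d w"
      unfolding w_def using der_zero[OF d f]
      by (simp add: field_derivation_sum[OF der_derivation[OF d]]
          field_derivation_mult[OF der_derivation[OF d]] field_derivation_of_int[OF der_derivation[OF d]])
    finally show "(\<Sum>e\<in>E. e * (d (u e) / u e)) = d w" .
  qed
  have m0: "\<forall>i\<in>I. m i e = 0" if "e \<in> E" for e
  proof (rule yindep)
    have "D (\<Sum>i\<in>I. of_int (m i e) * y i) = (\<Sum>i\<in>I. of_int (m i e) * (D (z i) / z i))"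
      using z by (simp add: field_derivation_sum[OF D] field_derivation_mult[OF D]
          field_derivation_of_int[OF D] Dz)
    also have "\<dots> = D (u e) / u e" by (simp only: du[OF D_der])
    also have "\<dots> = 0" using \<open>\<And>e. e \<in> E \<Longrightarrow> D (u e) = 0\<close>[OF that] by simp
    finally show "D (\<Sum>i\<in>I. of_int (m i e) * y i) = 0" .
  qed
  show ?thesis
  proof
    fix i assume i: "i \<in> I"
    have "of_int N * f i = 0" unfolding Nf[OF i] using m0 i by simp
    then show "f i = 0" using N(1) by simp
  qed
qed

text \<open>
  The Lie derivatives along \<open>D\<close> of the differentials \<open>d y - d z / z\<close> vanish, so the coefficients of a shortest linear relation are killed by \<open>D\<close>.
\<close>

theorem ax_differentials_independent:
  assumes "\<And>d. d \<in> der \<Longrightarrow> (\<Sum>i\<in>I. f i * (d (y i) - d (z i) / z i)) = 0"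
  shows "\<forall>i\<in>I. f i = 0"
  using assms
proof (induction "card {i \<in> I. f i \<noteq> 0}" arbitrary: f rule: less_induct)
  case less
  show ?case
  proof (rule ccontr)
    assume "\<not> ?thesis"
    then obtain i0 where i0: "i0 \<in> I" "f i0 \<noteq> 0" by blast
    \<comment> \<open>The coefficient at \<open>i0\<close> becomes 1 and is killed by
      \<open>D\<close>, so the differentiated relation has strictly smaller support and is trivial
      by induction.\<close>
    define g where "g i = f i / f i0" for i
    have g: "(\<Sum>i\<in>I. g i * (d (y i) - d (z i) / z i)) = 0" if "d \<in> der" for d
      using less.prems[OF that] by (simp add: g_def sum_divide_distrib[symmetric])
    have "\<forall>i\<in>I. D (g i) = 0"
    proof (rule less.hyps)
      have "D (g i0) = 0" using i0(2) by (simp add: g_def field_derivation_1[OF D])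
      moreover have "D (g i) = 0" if "f i = 0" for i
        using that by (simp add: g_def field_derivation_0[OF D])
      ultimately have "{i \<in> I. D (g i) \<noteq> 0} \<subset> {i \<in> I. f i \<noteq> 0}" using i0 by blast
      then show "card {i \<in> I. D (g i) \<noteq> 0} < card {i \<in> I. f i \<noteq> 0}"
        using I by (intro psubset_card_mono) auto
      fix d assume d: "d \<in> der"
      note d' = der_derivation[OF d]
      define d2 where "d2 x = D (d x) - d (D x)" for x
      have d2: "d2 \<in> der" unfolding d2_def by (rule commutator_der[OF d])
      have lie: "D (d (y i) - d (z i) / z i) = d2 (y i) - d2 (z i) / z i" if "i \<in> I" for i
      proof -
        have "D (d (y i) - d (z i) / z i) =
            D (d (y i)) - (D (d (z i)) * z i - d (z i) * (z i * D (y i))) / (z i)\<^sup>2"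
          unfolding field_derivation_diff[OF D] field_derivation_divide[OF D z[OF that]] Dz[OF that] ..
        moreover have "d2 (z i) = D (d (z i)) - (z i * d (D (y i)) + D (y i) * d (z i))"
          unfolding d2_def Dz[OF that] field_derivation_mult[OF d'] ..
        moreover have "D (d (y i)) - (D (d (z i)) * z i - d (z i) * (z i * D (y i))) / (z i)\<^sup>2 =
            d2 (y i) - (D (d (z i)) - (z i * d (D (y i)) + D (y i) * d (z i))) / z i"
          using z[OF that] by (simp add: d2_def field_simps power2_eq_square)
        ultimately show ?thesis by simp
      qed
      have "0 = D (\<Sum>i\<in>I. g i * (d (y i) - d (z i) / z i))"
        by (simp only: g[OF d] field_derivation_0[OF D])
      also have "\<dots> = (\<Sum>i\<in>I. g i * D (d (y i) - d (z i) / z i)) +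
          (\<Sum>i\<in>I. D (g i) * (d (y i) - d (z i) / z i))"
        by (simp only: field_derivation_sum[OF D] field_derivation_mult[OF D] sum.distrib mult.commute)
      also have "(\<Sum>i\<in>I. g i * D (d (y i) - d (z i) / z i)) =
          (\<Sum>i\<in>I. g i * (d2 (y i) - d2 (z i) / z i))"
        by (intro sum.cong refl) (simp only: lie)
      also have "\<dots> = 0" by (rule g[OF d2])
      finally show "(\<Sum>i\<in>I. D (g i) * (d (y i) - d (z i) / z i)) = 0" by simp
    qed
    then have "\<forall>i\<in>I. g i = 0" by (intro ax_constant_coefficients g) auto
    with i0 show False by (simp add: g_def)
  qed
qed

end

end

section \<open>Counting dimensions\<close>

text \<open>An \<open>l\<close> algebraic over the constants of \<open>D\<close> would itself be a
  constant.\<close>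

lemma powers_independent:
  fixes D :: "'a::field_char_0 \<Rightarrow> 'a"
  assumes D: "field_derivation D" and l: "D l \<noteq> 0" and a: "\<And>i. i \<le> N \<Longrightarrow> D (a i) = 0"
    and 0: "(\<Sum>i\<le>N. a i * l ^ i) = 0"
  shows "\<forall>i\<le>N. a i = 0"
proof -
  define g where "g = (\<Sum>i\<le>N. monom (a i) i)"
  have coeff: "coeff g j = (if j \<le> N then a j else 0)" for j
    by (simp add: g_def coeff_sum if_distrib[of "\<lambda>c. c = _"] cong: if_cong)
  have "poly g l = 0" using 0 by (simp add: g_def poly_sum poly_monom)
  moreover have "\<not> algebraic_in {x. D x = 0} l"
    using algebraic_in_kernel[OF D is_subfield_kernel[OF D], of l] l by auto
  moreover have "\<forall>i. coeff g i \<in> {x. D x = 0}"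
    using a by (simp add: coeff field_derivation_0[OF D])
  ultimately have "g = 0" unfolding algebraic_in_def by blast
  then show ?thesis using coeff by (metis coeff_0)
qed

lemma rat_span_closed_scale:
  assumes "w \<in> rat.span B" and "\<And>b. b \<in> B \<Longrightarrow> c * b \<in> rat.span B'"
  shows "c * w \<in> rat.span B'"
  using assms(1)
proof (induction rule: rat.span_induct_alt)
  case base
  then show ?case using rat.span_zero by simp
next
  case (step q b w)
  have "c * (rat_scale q b + w) = rat_scale q (c * b) + c * w"
    by (simp add: rat_scale_def algebra_simps)
  then show ?case using step assms(2) by (simp add: rat.span_add rat.span_scale)
qed

text \<open>
  The \<open>l ^ i * b\<close> with \<open>b\<close> in \<open>J\<close> or in a basis of the constants of \<open>V + l V\<close> are independent, and
  for \<open>i \<le> N\<close> they lie in \<open>V + \<dots> + l ^ (N + 1) V\<close>, whose dimension grows with \<open>N\<close> at most by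
  \<open>dim (V + l V) - dim V\<close> in each step. Here \<open>N = dim V\<close> is large enough.
\<close>

lemma rank_bound:
  fixes D :: "'a::field_char_0 \<Rightarrow> 'a"
  assumes D: "field_derivation D" and l: "D l \<noteq> 0"
    and V: "finite V" "rat.independent V"
    and J: "J \<subseteq> V" "\<And>c. (\<And>d. d \<in> der D \<Longrightarrow> d l = 0 \<Longrightarrow> (\<Sum>j\<in>J. c j * d j) = 0) \<Longrightarrow> \<forall>j\<in>J. c j = 0"
    and Y: "finite Y" "Y \<subseteq> V \<union> (*) l ` V"
      "\<And>w. w \<in> V \<union> (*) l ` V \<Longrightarrow> \<exists>y\<in>rat.span Y. D (w - y) = 0"
  shows "card V + card J \<le> card Y"
proof -
  define W where "W = rat.span (V \<union> (*) l ` V)"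
  have subW: "rat.span T \<subseteq> W" if "T \<subseteq> W" for T
    using that unfolding W_def by (intro rat.span_minimal rat.subspace_span)
  have VW: "V \<subseteq> W" "(*) l ` V \<subseteq> W" unfolding W_def by (auto intro: rat.span_base)
  obtain B where B: "B \<subseteq> W \<inter> {x. D x = 0}" "rat.independent B" "W \<inter> {x. D x = 0} \<subseteq> rat.span B"
    by (rule rat.maximal_independent_subset)
  have finB: "finite B"
    using rat.independent_span_bound[of "V \<union> (*) l ` V" B] V(1) B(1,2) by (auto simp: W_def)
  obtain E where E: "V \<subseteq> E" "E \<subseteq> W" "rat.independent E" "W \<subseteq> rat.span E"
    by (rule rat.maximal_independent_subset_extend[OF VW(1) V(2)])
  have YW: "Y \<subseteq> W" using Y(2) VW by blast
  have "w \<in> rat.span (B \<union> Y)" if w: "w \<in> V \<union> (*) l ` V" for w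
  proof -
    obtain y where y: "y \<in> rat.span Y" "D (w - y) = 0" using Y(3)[OF w] by blast
    have "y \<in> W" using y(1) subW[OF YW] by blast
    then have "w - y \<in> W"
      unfolding W_def by (rule rat.span_diff[OF rat.span_base[OF w]])
    then have "w - y \<in> rat.span B" using B(3) y(2) by blast
    then have "w - y + y \<in> rat.span (B \<union> Y)"
      using y(1) rat.span_mono[of B "B \<union> Y"] rat.span_mono[of Y "B \<union> Y"]
      by (intro rat.span_add) auto
    then show ?thesis by simp
  qed
  then have "W \<subseteq> rat.span (B \<union> Y)"
    unfolding W_def by (intro rat.span_minimal rat.subspace_span) blast
  then have "E \<subseteq> rat.span (B \<union> Y)" using E(2) by blast
  then have finE: "finite E" and cE: "card E \<le> card B + card Y"
    using rat.independent_span_bound[OF _ E(3), of "B \<union> Y"] finB Y(1) card_Un_le[of B Y] by auto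
  \<comment> \<open>\<open>E\<close> is a basis of \<open>W\<close>, so \<open>card U\<close> is the
    growth of the dimension from V to V + l V.\<close>
  define U where "U = E - V"
  have finU: "finite U" and EU: "E = V \<union> U" and cU: "card V + card U \<le> card B + card Y"
    using finE E(1) cE V(1) by (auto simp: U_def card_Diff_subset card_mono)
  \<comment> \<open>For \<open>v\<close> in \<open>V\<close> the product l * v is expanded again in
    \<open>E\<close>, so each further power of \<open>l\<close> costs only \<open>card U\<close> new
    generators.\<close>
  define G where "G i = V \<union> (\<lambda>(j, u). l ^ j * u) ` ({..i} \<times> U)" for i :: nat
  have Gmono: "G i \<subseteq> G j" if "i \<le> j" for i j using that unfolding G_def by fastforce
  have lG: "l ^ i * w \<in> rat.span (G i)" if "w \<in> W" for i w
    using that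
  proof (induction i arbitrary: w)
    case 0
    have "E \<subseteq> G 0" by (auto simp: EU G_def intro!: image_eqI[of _ _ "(0, _)"])
    then show ?case using rat.span_mono[of E "G 0"] 0 E(4) by auto
  next
    case (Suc i)
    show ?case
    proof (rule rat_span_closed_scale)
      show "w \<in> rat.span E" using Suc.prems E(4) by blast
      fix b assume "b \<in> E"
      then consider "b \<in> V" | "b \<in> U" by (auto simp: EU)
      then show "l ^ Suc i * b \<in> rat.span (G (Suc i))"
      proof cases
        case 1
        then have "l * b \<in> W" using VW(2) by blast
        then have "l ^ i * (l * b) \<in> rat.span (G i)" by (rule Suc.IH)
        then show ?thesis using rat.span_mono[OF Gmono[of i "Suc i"]] by (auto simp: mult.assoc mult.left_commute)
      next
        case 2
        then show ?thesis unfolding G_def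
          by (intro rat.span_base UnI2 image_eqI[of _ _ "(Suc i, b)"]) auto
      qed
    qed
  qed
  define N where "N = card V"
  have JB: "J \<inter> B = {}"
  proof (rule ccontr)
    assume "J \<inter> B \<noteq> {}"
    then obtain j where j: "j \<in> J" "D j = 0" using B(1) by blast
    have finJ: "finite J" using J(1) V(1) by (rule finite_subset)
    have "\<forall>i\<in>J. (if i = j then 1 else 0 :: 'a) = 0"
    proof (rule J(2))
      fix d assume "d \<in> der D"
      then have "d j = 0" using j(2) by (rule der_zero[OF D])
      then show "(\<Sum>i\<in>J. (if i = j then 1 else 0) * d i) = 0" by (intro sum.neutral) auto
    qed
    with j(1) show False by auto
  qed
  have finJ: "finite J" using J(1) V(1) by (rule finite_subset)
  define I where "I = {..N} \<times> (B \<union> J)"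
  define f where "f p = l ^ fst p * snd p" for p :: "nat \<times> 'a"
  have finI: "finite I" using finB finJ by (simp add: I_def)
  have fam: "\<forall>p\<in>I. c p = 0" if rel: "(\<Sum>p\<in>I. rat_scale (c p) (f p)) = 0" for c
  proof -
    define P where "P b = (\<Sum>i\<le>N. of_rat (c (i, b)) * l ^ i)" for b
    have "(\<Sum>p\<in>I. rat_scale (c p) (f p)) = (\<Sum>i\<le>N. \<Sum>b\<in>B \<union> J. of_rat (c (i, b)) * l ^ i * b)"
      by (simp add: I_def sum.cartesian_product rat_scale_def f_def mult.assoc case_prod_unfold)
    also have "\<dots> = (\<Sum>b\<in>B \<union> J. P b * b)"
      unfolding P_def sum_distrib_right by (rule sum.swap)
    also have "\<dots> = (\<Sum>b\<in>B. P b * b) + (\<Sum>b\<in>J. P b * b)"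
      using finB finJ JB by (intro sum.union_disjoint) auto
    finally have PBJ: "(\<Sum>b\<in>B. P b * b) + (\<Sum>b\<in>J. P b * b) = 0" using rel by simp
    have rat0: "i \<le> N \<Longrightarrow> D (of_rat (c (i, b))) = 0" for i b by (rule field_derivation_of_rat[OF D])
    \<comment> \<open>A derivation with d l = 0 kills every \<open>P b\<close> and every element of
      \<open>B\<close>; what it leaves of the relation involves only the \<open>d j\<close> with
      \<open>j\<close> in \<open>J\<close>.\<close>
    have PJ: "\<forall>b\<in>J. P b = 0"
    proof (rule J(2))
      fix d assume d: "d \<in> der D" "d l = 0"
      note d' = der_derivation[OF D d(1)]
      have dP: "d (P b) = 0" for b
        unfolding P_def by (simp add: field_derivation_sum[OF d'] field_derivation_mult[OF d']
            field_derivation_of_rat[OF d'] field_derivation_power[OF d'] d(2))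
      have "d b = 0" if "b \<in> B" for b using B(1) that by (intro der_zero[OF D d(1)]) auto
      then have "d (\<Sum>b\<in>B. P b * b) = 0"
        by (simp add: field_derivation_sum[OF d'] field_derivation_mult[OF d'] dP)
      moreover have "d ((\<Sum>b\<in>B. P b * b) + (\<Sum>b\<in>J. P b * b)) = 0"
        unfolding PBJ by (rule field_derivation_0[OF d'])
      ultimately have "d (\<Sum>b\<in>J. P b * b) = 0" by (simp add: field_derivation_add[OF d'])
      then show "(\<Sum>j\<in>J. P j * d j) = 0"
        by (simp add: field_derivation_sum[OF d'] field_derivation_mult[OF d'] dP)
    qed
    have cJ: "c (i, b) = 0" if "b \<in> J" "i \<le> N" for i b
    proof -
      have "\<forall>i\<le>N. of_rat (c (i, b)) = (0::'a)"
        using PJ that(1) by (intro powers_independent[OF D l rat0]) (auto simp: P_def)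
      then show ?thesis using that(2) by simp
    qed
    \<comment> \<open>With the part over \<open>J\<close> gone, the relation is a polynomial in
      \<open>l\<close> whose coefficients are constants of \<open>D\<close>.\<close>
    have "(\<Sum>b\<in>B. P b * b) = 0" using PBJ PJ by simp
    also have "(\<Sum>b\<in>B. P b * b) = (\<Sum>i\<le>N. (\<Sum>b\<in>B. of_rat (c (i, b)) * b) * l ^ i)"
      unfolding P_def sum_distrib_right by (subst sum.swap) (simp add: mult.assoc mult.commute[of "l ^ _"])
    finally have "\<forall>i\<le>N. (\<Sum>b\<in>B. of_rat (c (i, b)) * b) = 0"
    proof (intro powers_independent[OF D l])
      fix i
      have "D b = 0" if "b \<in> B" for b using B(1) that by auto
      then show "D (\<Sum>b\<in>B. of_rat (c (i, b)) * b) = 0"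
        by (simp add: field_derivation_sum[OF D] field_derivation_of_rat_mult[OF D])
    qed
    then have cB: "c (i, b) = 0" if "b \<in> B" "i \<le> N" for i b
      using rat.independentD[OF B(2) finB subset_refl, of "\<lambda>b. c (i, b)" b] that
      by (simp add: rat_scale_def)
    show ?thesis using cJ cB by (auto simp: I_def)
  qed
  have ind: "inj_on f I" "rat.independent (f ` I)"
    by (rule rat.independent_familyI[OF finI fam]; assumption)+
  have finG: "finite (G N)" using V(1) finU by (simp add: G_def)
  have "f ` I \<subseteq> rat.span (G N)"
  proof
    fix w assume "w \<in> f ` I"
    then obtain i b where ib: "w = l ^ i * b" "i \<le> N" "b \<in> W"
      using B(1) J(1) VW(1) by (auto simp: f_def I_def)
    then show "w \<in> rat.span (G N)"
      using lG[OF ib(3), of i] rat.span_mono[OF Gmono[OF ib(2)]] by blast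
  qed
  then have "card (f ` I) \<le> card (G N)"
    using rat.independent_span_bound[OF finG ind(2)] by blast
  also have "card (G N) \<le> card V + card ({..N} \<times> U)"
    unfolding G_def using finU
    by (intro order_trans[OF card_Un_le] add_left_mono card_image_le) auto
  finally have "Suc N * (card B + card J) \<le> N + Suc N * card U"
    using card_image[OF ind(1)] finB finJ JB
    by (simp add: I_def card_cartesian_product card_Un_disjoint Int_commute N_def)
  \<comment> \<open>One unit of excess would already give Suc N \<le> N.\<close>
  then have "card B + card J \<le> card U"
  proof (rule contrapos_pp)
    assume "\<not> card B + card J \<le> card U"
    then have "Suc N * (card U + 1) \<le> Suc N * (card B + card J)" by (intro mult_le_mono2) simp
    then show "\<not> Suc N * (card B + card J) \<le> N + Suc N * card U" by simp
  qed
  \<comment> \<open>The contribution of \<open>B\<close> cancels between the two bounds.\<close>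
  with cU show ?thesis by simp
qed


section \<open>Algebraic independence from differentials\<close>

text \<open>Differentiate the relation: as the dz are independent modulo dl, it stays a relation
  when each monomial is weighted by its exponent in \<open>z\<close> (an Euler operator).
  Subtracting a multiple of the original removes a chosen monomial and multiplies the other
  coefficients by integers, which explains the first condition on \<open>K\<close>. By induction a
  single term remains, and it cannot vanish because 0 is not in \<open>S\<close>.\<close>

lemma monomials_independent:
  fixes D :: "'a::field_char_0 \<Rightarrow> 'a" and K S :: "'a set"
  assumes D: "field_derivation D" and S: "finite S" "0 \<notin> S"
    and K: "\<And>k n. k \<in> K \<Longrightarrow> of_int n * k \<in> K" "\<And>k. k \<in> K \<Longrightarrow> \<exists>a. \<forall>d\<in>der D. d k = a * d l"
    and indep: "\<And>a c. (\<And>d. d \<in> der D \<Longrightarrow> a * d l + (\<Sum>z\<in>S. c z * d z) = 0) \<Longrightarrow> \<forall>z\<in>S. c z = 0"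
    and M: "finite M" "\<And>m. m \<in> M \<Longrightarrow> Poly_Mapping.keys m \<subseteq> S"
    and c: "\<And>m. m \<in> M \<Longrightarrow> c m \<in> K"
    and 0: "(\<Sum>m\<in>M. c m * (\<Prod>z\<in>S. z ^ Poly_Mapping.lookup m z)) = 0"
  shows "\<forall>m\<in>M. c m = (0::'a)"
  using M c 0
proof (induction "card M" arbitrary: M c rule: less_induct)
  case less
  define mon where "mon m = (\<Prod>z\<in>S. z ^ Poly_Mapping.lookup m z)" for m :: "'a \<Rightarrow>\<^sub>0 nat"
  have mon0: "mon m \<noteq> 0" for m using S by (simp add: mon_def)
  have rel: "(\<Sum>m\<in>M. c m * mon m) = 0" using less.prems(4) by (simp add: mon_def)
  have dmon: "d (mon m) = (\<Sum>z\<in>S. of_nat (Poly_Mapping.lookup m z) * mon m / z * d z)"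
    if "d \<in> der D" for d m
  proof -
    note d' = der_derivation[OF D that]
    have "d (mon m) / mon m = (\<Sum>z\<in>S. d (z ^ Poly_Mapping.lookup m z) / z ^ Poly_Mapping.lookup m z)"
      unfolding mon_def using S by (intro log_derivative_prod[OF d']) auto
    also have "\<dots> = (\<Sum>z\<in>S. of_nat (Poly_Mapping.lookup m z) * (d z / z))"
      using S by (intro sum.cong refl log_derivative_power[OF d']) auto
    finally have "d (mon m) = (\<Sum>z\<in>S. of_nat (Poly_Mapping.lookup m z) * (d z / z)) * mon m"
      using mon0[of m] by (simp add: field_simps)
    also have "\<dots> = (\<Sum>z\<in>S. of_nat (Poly_Mapping.lookup m z) * mon m / z * d z)"
      unfolding sum_distrib_right by (intro sum.cong refl) simp
    finally show ?thesis .
  qed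
  obtain a where a: "\<And>m d. m \<in> M \<Longrightarrow> d \<in> der D \<Longrightarrow> d (c m) = a m * d l"
    using K(2)[OF less.prems(3)] by metis
  have euler: "(\<Sum>m\<in>M. c m * of_nat (Poly_Mapping.lookup m z) * mon m) = 0" if z: "z \<in> S" for z
  proof -
    have "\<forall>z\<in>S. (\<Sum>m\<in>M. c m * of_nat (Poly_Mapping.lookup m z) * mon m / z) = 0"
    proof (rule indep)
      fix d assume d: "d \<in> der D"
      note d' = der_derivation[OF D d]
      have "0 = d (\<Sum>m\<in>M. c m * mon m)" unfolding rel by (simp add: field_derivation_0[OF d'])
      also have "\<dots> = (\<Sum>m\<in>M. mon m * d (c m)) + (\<Sum>m\<in>M. c m * d (mon m))"
        by (simp add: field_derivation_sum[OF d'] field_derivation_mult[OF d'] sum.distrib)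
      also have "(\<Sum>m\<in>M. mon m * d (c m)) = (\<Sum>m\<in>M. mon m * a m) * d l"
        by (simp add: a[OF _ d] sum_distrib_right mult.assoc)
      also have "(\<Sum>m\<in>M. c m * d (mon m)) =
          (\<Sum>m\<in>M. \<Sum>z\<in>S. c m * of_nat (Poly_Mapping.lookup m z) * mon m / z * d z)"
        by (simp add: dmon[OF d] sum_distrib_left mult.assoc)
      also have "\<dots> = (\<Sum>z\<in>S. (\<Sum>m\<in>M. c m * of_nat (Poly_Mapping.lookup m z) * mon m / z) * d z)"
        unfolding sum_distrib_right by (rule sum.swap)
      finally show "(\<Sum>m\<in>M. mon m * a m) * d l +
          (\<Sum>z\<in>S. (\<Sum>m\<in>M. c m * of_nat (Poly_Mapping.lookup m z) * mon m / z) * d z) = 0" by simp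
    qed
    then show ?thesis using z S(2) by (auto simp: sum_divide_distrib[symmetric])
  qed
  show ?case
  proof (rule ccontr)
    assume "\<not> ?thesis"
    then obtain m0 where m0: "m0 \<in> M" "c m0 \<noteq> 0" by blast
    have others: "c m = 0" if m: "m \<in> M" "m \<noteq> m0" for m
    proof -
      obtain z where z: "Poly_Mapping.lookup m z \<noteq> Poly_Mapping.lookup m0 z"
        using m(2) by (meson poly_mapping_eqI)
      then have "z \<in> Poly_Mapping.keys m \<or> z \<in> Poly_Mapping.keys m0"
        by (metis in_keys_iff)
      then have zS: "z \<in> S" using less.prems(2) m(1) m0(1) by blast
      define r where "r m = int (Poly_Mapping.lookup m z) - int (Poly_Mapping.lookup m0 z)"
        for m :: "'a \<Rightarrow>\<^sub>0 nat"
      have "(\<Sum>m\<in>M. of_int (r m) * c m * mon m) = 0"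
      proof -
        have "(\<Sum>m\<in>M. of_int (r m) * c m * mon m) =
            (\<Sum>m\<in>M. c m * of_nat (Poly_Mapping.lookup m z) * mon m) -
            of_nat (Poly_Mapping.lookup m0 z) * (\<Sum>m\<in>M. c m * mon m)"
          by (simp add: r_def left_diff_distrib right_diff_distrib sum_subtractf sum_distrib_left mult_ac)
        then show ?thesis using euler[OF zS] rel by simp
      qed
      moreover have "(\<Sum>m\<in>M. of_int (r m) * c m * mon m) = (\<Sum>m\<in>M - {m0}. of_int (r m) * c m * mon m)"
        using less.prems(1) m0(1) by (simp add: sum.remove r_def)
      ultimately have "(\<Sum>m\<in>M - {m0}. of_int (r m) * c m * (\<Prod>z\<in>S. z ^ Poly_Mapping.lookup m z)) = 0"
        by (simp add: mon_def)
      moreover have "card (M - {m0}) < card M"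
        using less.prems(1) m0(1) by (rule card_Diff1_less)
      ultimately have "\<forall>m\<in>M - {m0}. of_int (r m) * c m = 0"
        using less.prems(1-3) K(1) by (intro less.hyps) auto
      then have "of_int (r m) * c m = 0" using m by blast
      then show ?thesis using z by (simp add: r_def)
    qed
    have "(\<Sum>m\<in>M. c m * mon m) = c m0 * mon m0"
      using less.prems(1) m0(1) others by (simp add: sum.remove)
    with rel m0(2) mon0[of m0] show False by simp
  qed
qed

text \<open>By induction on the generation of \<rat>(l), the differential of each of its elements is
  a multiple of dl, so \<open>monomials_independent\<close> applies with coefficients from
  \<rat>(l).\<close>

lemma alg_independent_of_differentials:
  fixes D :: "'a::field_char_0 \<Rightarrow> 'a"
  assumes D: "field_derivation D" and S: "finite S" "0 \<notin> S"
    and indep: "\<And>a c. (\<And>d. d \<in> der D \<Longrightarrow> a * d l + (\<Sum>z\<in>S. c z * d z) = 0) \<Longrightarrow> \<forall>z\<in>S. c z = 0"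
  shows "alg_independent (rat_adjoin {l}) S"
proof -
  let ?K = "rat_adjoin {l}"
  have car: "carrier (the_field :: 'a ring) = UNIV" "\<one>\<^bsub>the_field\<^esub> = (1::'a)" "\<zero>\<^bsub>the_field\<^esub> = (0::'a)"
    "x \<otimes>\<^bsub>the_field\<^esub> y = (x * y :: 'a)" "x \<oplus>\<^bsub>the_field\<^esub> y = (x + y :: 'a)" for x y
    by (simp_all add: ring_of_type_algebra_def)
  interpret F: Ring.field "the_field :: 'a ring" by (rule field_from_type_algebra)
  have neg: "\<ominus>\<^bsub>the_field\<^esub> x = (- x :: 'a)" for x
    using F.minus_equality[of "- x" x] by (simp add: car)
  have inve: "inv\<^bsub>the_field\<^esub> x = (inverse x :: 'a)" if "x \<noteq> 0" for x
    using F.comm_inv_char[of x "inverse x"] that by (simp add: car)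
  have diff: "\<exists>a. \<forall>d\<in>der D. d k = a * d l" if "k \<in> ?K" for k
    using that
  proof (induction rule: generate_field.induct)
    case one
    show ?case by (intro exI[of _ 0]) (simp add: car field_derivation_1 der_derivation[OF D])
  next
    case (incl h)
    then show ?case by (intro exI[of _ 1]) simp
  next
    case (a_inv h)
    then obtain a where "\<forall>d\<in>der D. d h = a * d l" by blast
    then show ?case
      by (intro exI[of _ "- a"]) (simp add: neg field_derivation_minus der_derivation[OF D])
  next
    case (m_inv h)
    then obtain a where "\<forall>d\<in>der D. d h = a * d l" by blast
    then show ?case using m_inv
      by (intro exI[of _ "- a / h\<^sup>2"])
        (simp add: inve car field_derivation_inverse der_derivation[OF D])
  next
    case (eng_add h1 h2)
    then obtain a b where "\<forall>d\<in>der D. d h1 = a * d l" "\<forall>d\<in>der D. d h2 = b * d l" by blast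
    then show ?case
      by (intro exI[of _ "a + b"]) (simp add: car field_derivation_add der_derivation[OF D] distrib_right)
  next
    case (eng_mult h1 h2)
    then obtain a b where ab: "\<forall>d\<in>der D. d h1 = a * d l" "\<forall>d\<in>der D. d h2 = b * d l" by blast
    have "d (h1 * h2) = (h1 * b + h2 * a) * d l" if "d \<in> der D" for d
      unfolding field_derivation_mult[OF der_derivation[OF D that]] bspec[OF ab(1) that] bspec[OF ab(2) that]
      by (simp add: algebra_simps)
    then show ?case unfolding car by blast
  qed
  have zero: "0 \<in> ?K" using F.zero_in_generate by (simp add: car)
  have add: "x + y \<in> ?K" if "x \<in> ?K" "y \<in> ?K" for x y
    using generate_field.eng_add[OF that] by (simp add: car)
  have minus: "- x \<in> ?K" if "x \<in> ?K" for x
    using generate_field.a_inv[OF that] by (simp add: neg)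
  have nat: "of_nat n * k \<in> ?K" if "k \<in> ?K" for n k
    by (induction n) (auto simp: zero distrib_right intro: add that)
  have int: "of_int n * k \<in> ?K" if "k \<in> ?K" for n k
    by (cases n rule: int_cases2) (auto simp: nat[OF that] intro!: minus)
  show ?thesis
    unfolding alg_independent_def
  proof (intro allI impI, elim conjE)
    fix q :: "('a \<Rightarrow>\<^sub>0 nat) \<Rightarrow>\<^sub>0 'a"
    assume q: "\<forall>m. Poly_Mapping.lookup q m \<in> ?K" "\<forall>m\<in>Poly_Mapping.keys q. Poly_Mapping.keys m \<subseteq> S"
      and ev: "eval_at_names q = 0"
    have "(\<Prod>z\<in>S. z ^ Poly_Mapping.lookup m z) = (\<Prod>z\<in>Poly_Mapping.keys m. z ^ Poly_Mapping.lookup m z)"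
      if "m \<in> Poly_Mapping.keys q" for m
      using q(2) that S(1) by (intro prod.mono_neutral_right) (auto simp: in_keys_iff)
    then have "(\<Sum>m\<in>Poly_Mapping.keys q. Poly_Mapping.lookup q m * (\<Prod>z\<in>S. z ^ Poly_Mapping.lookup m z)) = 0"
      using ev by (simp add: eval_at_names_def)
    then have "\<forall>m\<in>Poly_Mapping.keys q. Poly_Mapping.lookup q m = 0"
      using q by (intro monomials_independent[OF D S int diff indep]) auto
    then show "q = 0" by (metis in_keys_iff poly_mapping_eqI lookup_zero)
  qed
qed

text \<open>The algebraic core: \<open>ex\<close> is any map that is nonzero and satisfies the
  differential equation on V \<union> l V. The differentials of \<open>S\<close> complete those of
  \<open>l\<close> and \<open>V\<close> to a spanning set for the differentials of the
  \<open>ex y\<close> with \<open>y\<close> in \<open>Y\<close>.\<close>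

theorem independent_exponentials:
  fixes D :: "'a::field_char_0 \<Rightarrow> 'a" and ex :: "'a \<Rightarrow> 'a"
  assumes D: "field_derivation D" and l: "D l \<noteq> 0"
    and V: "finite V" "rat.independent V"
    and ex: "\<And>w. w \<in> V \<union> (*) l ` V \<Longrightarrow> ex w \<noteq> 0" "\<And>w. w \<in> V \<union> (*) l ` V \<Longrightarrow> D (ex w) = ex w * D w"
  obtains S where "S \<subseteq> ex ` (V \<union> (*) l ` V)" "finite S" "card V \<le> card S"
    "alg_independent (rat_adjoin {l}) S"
proof -
  define A where "A = V \<union> (*) l ` V"
  have finA: "finite A" using V(1) by (simp add: A_def)
  \<comment> \<open>\<open>D\<close> is linear over the rationals with kernel \<open>C\<close>, so a
    basis of the span of its values on \<open>A\<close> lifts to a basis \<open>Y\<close> of the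
    span of \<open>A\<close> modulo constants.\<close>
  obtain B where B: "B \<subseteq> D ` A" "rat.independent B" "D ` A \<subseteq> rat.span B"
    by (rule rat.maximal_independent_subset)
  obtain Y where Y: "Y \<subseteq> A" "inj_on D Y" "B = D ` Y" using B(1) by (auto simp: subset_image_inj)
  have finY: "finite Y" using Y(1) finA by (rule finite_subset)
  have Yspan: "\<exists>y\<in>rat.span Y. D (w - y) = 0" if w: "w \<in> A" for w
  proof -
    have "D w \<in> rat.span (D ` Y)" using B(3) w Y(3) by blast
    then have "D w \<in> D ` rat.span Y"
    proof (induction rule: rat.span_induct_alt)
      case base
      then show ?case
        using field_derivation_0[OF D] rat.span_zero by (intro image_eqI[of _ _ 0]) auto
    next
      case (step c b b')
      then obtain y y' where y: "y \<in> Y" "b = D y" "y' \<in> rat.span Y" "b' = D y'" by blast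
      then have "rat_scale c b + b' = D (rat_scale c y + y')"
        by (simp add: rat_scale_def field_derivation_add[OF D] field_derivation_of_rat_mult[OF D])
      moreover have "rat_scale c y + y' \<in> rat.span Y"
        using y(1,3) by (simp add: rat.span_add rat.span_scale rat.span_base)
      ultimately show ?case by blast
    qed
    then obtain y where "y \<in> rat.span Y" "D w = D y" by blast
    then show ?thesis by (intro bexI[of _ y]) (simp_all add: field_derivation_diff[OF D])
  qed
  have Yindep: "\<forall>y\<in>Y. m y = 0" if m: "D (\<Sum>y\<in>Y. of_int (m y) * y) = 0" for m :: "'a \<Rightarrow> int"
  proof
    fix y assume y: "y \<in> Y"
    have "(\<Sum>y\<in>Y. rat_scale (of_int (m y)) (D y)) = 0"
      using m by (simp add: rat_scale_def field_derivation_sum[OF D] field_derivation_mult[OF D]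
          field_derivation_of_int[OF D])
    from rat.independent_familyD[OF Y(2) finY B(2)[unfolded Y(3)] this y] show "m y = 0" by simp
  qed
  \<comment> \<open>The differential of \<open>s\<close> as a functional. The value 0 outside
    \<open>der D\<close> makes a linear relation between such functions equivalent to one on
    \<open>der D\<close>.\<close>
  define \<phi> where "\<phi> s d = (if d \<in> der D then d s else 0)" for s and d :: "'a \<Rightarrow> 'a"
  have \<phi>_der: "\<phi> s d = d s" if "d \<in> der D" for s d using that by (simp add: \<phi>_def)
  have \<phi>_out: "\<phi> s d = 0" if "d \<notin> der D" for s d using that by (simp add: \<phi>_def)
  have \<phi>l: "\<phi> l \<noteq> 0" using \<phi>_der[OF D_der[OF D], of l] l by (metis zero_fun_apply)
  have sum_fun: "sum f T d = (\<Sum>i\<in>T. f i d)" for f :: "'b \<Rightarrow> ('a \<Rightarrow> 'a) \<Rightarrow> 'a" and T d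
    by (induction T rule: infinite_finite_induct) (auto simp: plus_fun_def zero_fun_def)

  define \<omega> where "\<omega> y = \<phi> y - fun_scale (inverse (ex y)) (\<phi> (ex y))" for y
  have \<omega>_der: "\<omega> y d = d y - d (ex y) / ex y" if "d \<in> der D" for y d
    using that by (simp add: \<omega>_def fun_scale_def \<phi>_der divide_inverse fun_diff_def)
  have exY: "ex y \<noteq> 0" "D (ex y) = ex y * D y" if "y \<in> Y" for y
    using ex[of y] Y(1) that unfolding A_def by blast+
  have fam: "\<forall>y\<in>Y. c y = 0" if c: "(\<Sum>y\<in>Y. fun_scale (c y) (\<omega> y)) = 0" for c
  proof (rule ax_differentials_independent[OF D finY])
    fix d assume d: "d \<in> der D"
    have "(\<Sum>y\<in>Y. fun_scale (c y) (\<omega> y)) d = 0" unfolding c by simp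
    then show "(\<Sum>y\<in>Y. c y * (d y - d (ex y) / ex y)) = 0"
      by (simp add: sum_fun fun_scale_def \<omega>_der[OF d])
  qed (use exY Yindep in auto)
  have \<omega>ind: "inj_on \<omega> Y" "fn.independent (\<omega> ` Y)"
    by (rule fn.independent_familyI[OF finY fam]; assumption)+
  have \<omega>D: "\<omega> y D = 0" if "y \<in> Y" for y
    using exY[OF that] by (simp add: \<omega>_der[OF D_der[OF D]])
  have "f D = 0" if "f \<in> fn.span (\<omega> ` Y)" for f
    using that by (induction rule: fn.span_induct_alt) (auto simp: \<omega>D fun_scale_def)
  then have \<phi>l_notin: "\<phi> l \<notin> fn.span (\<omega> ` Y)"
    using \<phi>_der[OF D_der[OF D], of l] l by metis
  then have ind1: "fn.independent (insert (\<phi> l) (\<omega> ` Y))"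
    using \<omega>ind(2) by (simp add: fn.independent_insertI)
  have card1: "card (insert (\<phi> l) (\<omega> ` Y)) = Suc (card Y)"
    using \<phi>l_notin fn.span_base[of "\<phi> l" "\<omega> ` Y"] finY
    by (subst card_insert_disjoint) (blast | simp add: card_image[OF \<omega>ind(1)])+

  \<comment> \<open>The basis grows in three stages: dl, differentials of elements of
    \<open>V\<close>, differentials of values of \<open>ex\<close>. \<open>J\<close> and
    \<open>S\<close> pick one element for each vector added in the second and third stage.\<close>
  have "fn.independent {\<phi> l}" using \<phi>l by simp
  then obtain B1 where B1: "{\<phi> l} \<subseteq> B1" "B1 \<subseteq> insert (\<phi> l) (\<phi> ` V)" "fn.independent B1"
    "insert (\<phi> l) (\<phi> ` V) \<subseteq> fn.span B1"
    by (rule fn.maximal_independent_subset_extend[of "{\<phi> l}" "insert (\<phi> l) (\<phi> ` V)", rotated]) auto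
  obtain B2 where B2: "B1 \<subseteq> B2" "B2 \<subseteq> B1 \<union> \<phi> ` ex ` Y" "fn.independent B2"
    "B1 \<union> \<phi> ` ex ` Y \<subseteq> fn.span B2"
    by (rule fn.maximal_independent_subset_extend[OF _ B1(3), of "B1 \<union> \<phi> ` ex ` Y"]) auto
  have "B1 - {\<phi> l} \<subseteq> \<phi> ` V" using B1(2) by blast
  then obtain J where J: "J \<subseteq> V" "inj_on \<phi> J" "B1 - {\<phi> l} = \<phi> ` J" by (auto simp: subset_image_inj)
  have "B2 - B1 \<subseteq> \<phi> ` ex ` Y" using B2(2) by blast
  then obtain S where S: "S \<subseteq> ex ` Y" "inj_on \<phi> S" "B2 - B1 = \<phi> ` S" by (auto simp: subset_image_inj)
  have finJ: "finite J" using J(1) V(1) by (rule finite_subset)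
  have finS: "finite S" using S(1) finY by (rule finite_subset[OF _ finite_imageI])
  have B1_eq: "B1 = insert (\<phi> l) (\<phi> ` J)" "\<phi> l \<notin> \<phi> ` J" using B1(1) J(3) by blast+
  have B2_eq: "B2 = B1 \<union> \<phi> ` S" "B1 \<inter> \<phi> ` S = {}" using B2(1) S(3) by blast+
  have finB2: "finite B2" using finJ finS by (simp add: B1_eq B2_eq)
  have cardB2: "card B2 = Suc (card J + card S)"
    using finJ finS B1_eq(2) B2_eq(2)
    by (simp add: B2_eq(1) card_Un_disjoint B1_eq(1) card_image[OF J(2)] card_image[OF S(2)])

  have span12: "fn.span B1 \<subseteq> fn.span B2" by (rule fn.span_mono[OF B2(1)])
  have \<phi>A: "\<phi> w \<in> fn.span B2" if w: "w \<in> A" for w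
  proof -
    consider "w \<in> V" | v where "v \<in> V" "w = l * v" using w by (auto simp: A_def)
    then show ?thesis
    proof cases
      case 1
      then show ?thesis using B1(4) span12 by blast
    next
      case 2
      \<comment> \<open>The Leibniz rule d(l v) = l dv + v dl keeps the differentials of l V in the
        span.\<close>
      have "\<phi> w = fun_scale l (\<phi> v) + fun_scale v (\<phi> l)"
      proof
        fix d
        show "\<phi> w d = (fun_scale l (\<phi> v) + fun_scale v (\<phi> l)) d"
          by (cases "d \<in> der D")
            (simp_all add: \<phi>_der \<phi>_out 2(2) fun_scale_def field_derivation_mult der_derivation[OF D])
      qed
      also have "\<dots> \<in> fn.span B2"
        using B1(4) span12 2(1) by (intro fn.span_add fn.span_scale) auto
      finally show ?thesis .
    qed
  qed
  have "\<omega> y \<in> fn.span B2" if "y \<in> Y" for y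
    unfolding \<omega>_def using \<phi>A[of y] that Y(1) B2(4) by (intro fn.span_diff fn.span_scale) auto
  then have "insert (\<phi> l) (\<omega> ` Y) \<subseteq> fn.span B2" using B1(4) span12 by blast
  \<comment> \<open>Both sides count dl once, so it cancels.\<close>
  from fn.independent_span_bound[OF finB2 ind1 this] have le: "card Y \<le> card J + card S"
    by (simp add: card1 cardB2)

  have rel: "(\<Sum>s\<in>T. fun_scale (c s) (\<phi> s)) d = (\<Sum>s\<in>T. c s * \<phi> s d)" for T c d
    by (simp add: sum_fun fun_scale_def)
  have "card V + card J \<le> card Y"
  proof (rule rank_bound[OF D l V J(1) _ finY])
    show "Y \<subseteq> V \<union> (*) l ` V" using Y(1) by (simp add: A_def)
    show "\<exists>y\<in>rat.span Y. D (w - y) = 0" if "w \<in> V \<union> (*) l ` V" for w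
      using Yspan that by (simp add: A_def)
    fix c assume c: "\<And>d. d \<in> der D \<Longrightarrow> d l = 0 \<Longrightarrow> (\<Sum>j\<in>J. c j * d j) = 0"
    \<comment> \<open>\<open>c\<close> is tested only on derivations with d l = 0. Replacing
      \<open>d\<close> by d - (d l / D l) D, which kills \<open>l\<close>, extends the relation to
      all of \<open>der D\<close> at the price of a multiple of dl; \<open>a\<close> is that
      multiple.\<close>
    define a where "a = (\<Sum>j\<in>J. c j * D j) / D l"
    have eq: "(\<Sum>j\<in>J. c j * \<phi> j d) = a * \<phi> l d" for d
    proof (cases "d \<in> der D")
      case True
      have "(\<Sum>j\<in>J. c j * (1 * d j + (- d l / D l) * D j)) = 0"
        by (rule c[OF der_lincomb[OF D True D_der[OF D]]]) (use l in simp)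
      then have "(\<Sum>j\<in>J. c j * d j) - d l / D l * (\<Sum>j\<in>J. c j * D j) = 0"
        by (simp add: sum_distrib_left sum_subtractf right_diff_distrib mult.left_commute)
      then show ?thesis by (simp add: \<phi>_der[OF True] a_def mult.commute)
    qed (simp add: \<phi>_out)
    have 0: "(\<Sum>j\<in>insert l J. fun_scale (if j = l then - a else c j) (\<phi> j)) = 0"
    proof
      fix d
      have "l \<notin> J" using B1_eq(2) by blast
      then have "(\<Sum>j\<in>insert l J. fun_scale (if j = l then - a else c j) (\<phi> j)) d =
          - a * \<phi> l d + (\<Sum>j\<in>J. c j * \<phi> j d)"
        using finJ unfolding rel by (subst sum.insert) (auto intro!: sum.cong)
      then show "(\<Sum>j\<in>insert l J. fun_scale (if j = l then - a else c j) (\<phi> j)) d = 0 d"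
        by (simp add: eq)
    qed
    have inj: "inj_on \<phi> (insert l J)" using J(2) B1_eq(2) by auto
    have ind: "fn.independent (\<phi> ` insert l J)" using B1(3) B1_eq(1) by simp
    show "\<forall>j\<in>J. c j = 0"
    proof
      fix j assume j: "j \<in> J"
      have "j \<noteq> l" using j B1_eq(2) by blast
      then show "c j = 0"
        using fn.independent_familyD[OF inj _ ind 0, of j] finJ j by simp
    qed
  qed
  with le have "card V \<le> card S" by simp
  moreover have "alg_independent (rat_adjoin {l}) S"
  proof (rule alg_independent_of_differentials[OF D finS])
    show "0 \<notin> S" using S(1) exY(1) by auto
    fix a c assume ac: "\<And>d. d \<in> der D \<Longrightarrow> a * d l + (\<Sum>z\<in>S. c z * d z) = 0"
    have lS: "\<phi> l \<notin> \<phi> ` S" using B2_eq(2) B1(1) by blast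
    have 0: "(\<Sum>z\<in>insert l S. fun_scale (if z = l then a else c z) (\<phi> z)) = 0"
    proof
      fix d
      have "l \<notin> S" using lS by blast
      then have "(\<Sum>z\<in>insert l S. fun_scale (if z = l then a else c z) (\<phi> z)) d =
          a * \<phi> l d + (\<Sum>z\<in>S. c z * \<phi> z d)"
        using finS unfolding rel by (subst sum.insert) (auto intro!: sum.cong)
      also have "\<dots> = 0" using ac[of d] by (cases "d \<in> der D") (simp_all add: \<phi>_der \<phi>_out)
      finally show "(\<Sum>z\<in>insert l S. fun_scale (if z = l then a else c z) (\<phi> z)) d = 0 d" by simp
    qed
    have inj: "inj_on \<phi> (insert l S)" using S(2) lS by auto
    have ind: "fn.independent (\<phi> ` insert l S)"
      using B2(3) by (rule fn.independent_mono) (use B2_eq(1) B1(1) in auto)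
    show "\<forall>z\<in>S. c z = 0"
    proof
      fix z assume z: "z \<in> S"
      have "z \<noteq> l" using z lS by blast
      then show "c z = 0"
        using fn.independent_familyD[OF inj _ ind 0, of z] finS z by simp
    qed
  qed
  moreover have "S \<subseteq> ex ` (V \<union> (*) l ` V)"
    using S(1) image_mono[OF Y(1), of ex] unfolding A_def by (rule order_trans)
  ultimately show thesis using finS that by blast
qed


section \<open>The p-adic exponential\<close>

text \<open>One step of Legendre's formula: the multiples of \<open>p\<close> up to \<open>n\<close>
  contribute one factor \<open>p\<close> each and leave the factorial of
  \<open>n div p\<close>.\<close>

lemma multiplicity_fact:
  fixes p :: nat
  assumes "Factorial_Ring.prime p"
  shows "multiplicity p (fact n) = n div p + multiplicity p (fact (n div p))"
proof (induction n)
  case (Suc n)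
  have p: "prime_elem p" using assms by simp
  have mult_fact_Suc: "multiplicity p (fact (Suc m)) = multiplicity p (Suc m) + multiplicity p (fact m)" for m
    unfolding fact_Suc by (simp add: prime_elem_multiplicity_mult_distrib[OF p] del: mult_Suc)
  show ?case
  proof (cases "p dvd Suc n")
    case False
    then show ?thesis
      by (simp add: mult_fact_Suc Suc.IH div_Suc mod_eq_0_iff_dvd not_dvd_imp_multiplicity_0 del: fact_Suc)
  next
    case True
    then obtain q where q: "Suc n = p * q" by blast
    then have "q \<noteq> 0" by (intro notI) simp
    then obtain r where r: "q = Suc r" by (cases q) auto
    have p0: "p > 0" using assms by (rule prime_gt_0_nat)
    have "Suc n div p = Suc (n div p)" using True by (simp add: div_Suc mod_eq_0_iff_dvd)
    moreover have "Suc n div p = q" using q p0 by simp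
    ultimately have "n div p = r" using r by simp
    have "multiplicity p (Suc n) = Suc (multiplicity p q)"
      unfolding q using \<open>q \<noteq> 0\<close> p0 p by (intro multiplicity_times_same) auto
    then have "multiplicity p (fact (Suc n)) = Suc (multiplicity p (Suc r)) + (r + multiplicity p (fact r))"
      unfolding mult_fact_Suc[of n] Suc.IH \<open>n div p = r\<close> r by simp
    also have "\<dots> = Suc r + multiplicity p (fact (Suc r))"
      unfolding mult_fact_Suc[of r] by simp
    finally show ?thesis using \<open>Suc n div p = q\<close> r by simp
  qed
qed simp

text \<open>Source of the bound 1 / (p - 1) that defines the disc. The induction closes because (p -
  1) q + q = p q \<le> n for q = n div p.\<close>

lemma multiplicity_fact_bound:
  fixes p :: nat
  assumes "Factorial_Ring.prime p"
  shows "(p - 1) * multiplicity p (fact n) \<le> n"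
proof (induction n rule: less_induct)
  case (less n)
  show ?case
  proof (cases "n = 0")
    case False
    have p: "p > 1" using assms by (rule prime_gt_1_nat)
    have "(p - 1) * multiplicity p (fact (n div p)) \<le> n div p"
      using False p by (intro less) simp
    then have "(p - 1) * multiplicity p (fact n) \<le> (p - 1) * (n div p) + n div p"
      unfolding multiplicity_fact[OF assms, of n] distrib_left by simp
    also have "\<dots> = p * (n div p)" using p by (cases p) auto
    also have "\<dots> \<le> n" by simp
    finally show ?thesis .
  qed simp
qed

context padic_complex_field
begin

lemma v_minus: "v (- x) = v x"
proof -
  have "v (- 1) = 0" using v_of_int[of "- 1"] by simp
  then show ?thesis using v_mult[of "- 1" x] by simp
qed

lemma v_sum:
  assumes "\<And>i. i \<in> A \<Longrightarrow> c \<le> v (f i)"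
  shows "c \<le> v (sum f A)"
  using assms
proof (induction A rule: infinite_finite_induct)
  case (insert i A)
  then have "c \<le> min (v (f i)) (v (sum f A))" by simp
  then show ?case using v_add[of "f i" "sum f A"] insert.hyps by (metis order_trans sum.insert)
qed (use v_eq_infinity_iff[of 0] in auto)

lemma dist_le:
  assumes "ereal c \<le> v (x - y)"
  shows "dist x y \<le> real p powr (- c)"
proof (cases "x = y")
  case False
  then have "v (x - y) \<noteq> \<infinity>" using v_eq_infinity_iff[of "x - y"] by simp
  then have "c \<le> real_of_ereal (v (x - y))"
    using assms v_not_minus_infinity[of "x - y"] by (cases "v (x - y)") auto
  then show ?thesis
    using dist_eq[OF False] prime_gt_1_nat[OF prime_p] by (simp add: powr_mono)
qed simp

text \<open>In the ultrametric, \<open>exp x - 1\<close> is as small as the terms of positive degree.\<close>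

lemma padic_exp_nonzero:
  assumes "x \<in> exp_disc p v"
  shows "padic_exp x \<noteq> 0"
proof -
  have p1: "real p > 1" using prime_gt_1_nat[OF prime_p] by simp
  \<comment> \<open>A real number is placed below \<open>v x\<close>, which is infinite for x = 0.
    Its distance \<open>c\<close> from 1 / (p - 1) is the margin: the j-th term has valuation at
    least j c.\<close>
  obtain r where r: "ereal (1 / (real p - 1)) < ereal r" "ereal r < v x"
    using assms ereal_dense2 unfolding exp_disc_def by blast
  define c where "c = r - 1 / (real p - 1)"
  have c: "c > 0" using r(1) by (simp add: c_def)
  define T where "T j = x ^ j / fact j" for j
  have vpow: "ereal (real j * r) \<le> v (x ^ j)" for j
  proof (induction j)
    case 0
    then show ?case using v_of_int[of 1] by simp
  next
    case (Suc j)
    have "ereal r + ereal (real j * r) \<le> v x + v (x ^ j)"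
      using r(2) Suc by (intro add_mono) auto
    then show ?case by (simp add: v_mult algebra_simps)
  qed
  have vT: "ereal (real j * c) \<le> v (T j)" for j
  proof -
    define m where "m = multiplicity p (fact j)"
    have "multiplicity (int p) (int (fact j)) = m"
      unfolding m_def multiplicity_def of_nat_power[symmetric] int_dvd_int_iff ..
    then have vf: "v (fact j) = ereal (real m)" using v_of_int[of "fact j"] by simp
    have "real (p - 1) * real m \<le> real j"
      unfolding m_def of_nat_mult[symmetric] of_nat_le_iff by (rule multiplicity_fact_bound[OF prime_p])
    then have "real m \<le> real j * (1 / (real p - 1))"
      using p1 by (simp add: field_simps of_nat_diff)
    then have "real j * c \<le> real j * r - real m" by (simp add: c_def right_diff_distrib)
    moreover have "v (x ^ j) = v (T j) + v (fact j)"
      unfolding v_mult[symmetric] by (simp add: T_def)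
    ultimately show ?thesis
      using vpow[of j] vf by (cases "v (T j)") auto
  qed
  define S where "S n = (\<Sum>j<n. T j)" for n
  have S: "dist (S m) (S n) \<le> real p powr (- (real n * c))" if "n \<le> m" for m n
  proof (rule dist_le)
    have "S m - S n = (\<Sum>j\<in>{n..<m}. T j)"
      unfolding S_def using sum_diff_nat_ivl[of 0 n m T] that by (simp add: atLeast0LessThan)
    moreover have "ereal (real n * c) \<le> v (\<Sum>j\<in>{n..<m}. T j)"
    proof (rule v_sum)
      fix j assume "j \<in> {n..<m}"
      then have "ereal (real n * c) \<le> ereal (real j * c)" using c by simp
      then show "ereal (real n * c) \<le> v (T j)" using vT[of j] by (rule order_trans)
    qed
    ultimately show "ereal (real n * c) \<le> v (S m - S n)" by simp
  qed
  define q where "q = real p powr (- c)"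
  have q: "0 < q" "q < 1" using p1 c by (simp_all add: q_def powr_less_one)
  have qn: "real p powr (- (real n * c)) = q ^ n" for n
    using p1 by (simp add: q_def powr_realpow[symmetric] powr_powr mult.commute)
  have "Cauchy S"
  proof (rule metric_CauchyI)
    fix e :: real assume "e > 0"
    then obtain N where N: "q ^ N < e" using real_arch_pow_inv[of e q] q(2) by blast
    have "dist (S m) (S n) < e" if "N \<le> n" "n \<le> m" for m n
    proof -
      have "q ^ n \<le> q ^ N" using that(1) q by (intro power_decreasing) auto
      then show ?thesis using S[OF that(2)] N unfolding qn by linarith
    qed
    then show "\<exists>N. \<forall>m\<ge>N. \<forall>n\<ge>N. dist (S m) (S n) < e"
      by (metis dist_commute nat_le_linear)
  qed
  moreover have "complete (UNIV :: 'a set)"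
    using UNIV_completion by (simp add: is_completion_of_def)
  ultimately obtain L where L: "S \<longlonglongrightarrow> L" unfolding complete_def by blast
  then have "T sums L" by (simp add: sums_def S_def[abs_def])
  then have exp: "padic_exp x = L" by (simp add: padic_exp_def T_def[abs_def] sums_unique[symmetric])
  have "(\<lambda>n. dist (S n) 1) \<longlonglongrightarrow> dist L 1" using L by (intro tendsto_intros)
  \<comment> \<open>\<open>S 1\<close> is the constant term 1, so the comparison starts at n = 1 and
    the bound is q ^ 1.\<close>
  moreover have "\<exists>N. \<forall>n\<ge>N. dist (S n) 1 \<le> q"
  proof (intro exI[of _ 1] allI impI)
    fix n :: nat assume "1 \<le> n"
    from S[OF this] show "dist (S n) 1 \<le> q" unfolding qn by (simp add: S_def T_def)
  qed
  ultimately have "dist L 1 \<le> q" by (rule LIMSEQ_le_const2)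
  moreover have "dist (0::'a) 1 = 1"
    using dist_eq[of 0 1] v_minus[of 1] v_of_int[of 1] p1 by simp
  ultimately show ?thesis using q(2) exp by auto
qed

end

section \<open>Application to the p-adic exponential\<close>

theorem corollary3p14:
  fixes p n :: nat
    and v :: "'a::{field_char_0, metric_space} \<Rightarrow> ereal"
    and Qp Qpbar :: "'a set"
    and l :: 'a
    and x :: "nat \<Rightarrow> 'a"
  assumes "padic_complex_field p v Qp Qpbar"
    and "l \<in> exp_disc p v"
    and "exponentially_transcendental p v l"
    and "\<And>i. i \<in> {1..n} \<Longrightarrow> x i \<in> exp_disc p v"
    and "rat_independent n x"
  shows "tr_deg (rat_adjoin {l})
      (rat_adjoin ({l} \<union> (\<lambda>i. padic_exp (x i)) ` {1..n} \<union> (\<lambda>i. padic_exp (l * x i)) ` {1..n}))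
    \<ge> enat n"
proof -
  interpret padic_complex_field p v Qp Qpbar by fact
  obtain D where D: "field_derivation D" "D l \<noteq> 0"
    and Dexp: "\<And>y. y \<in> exp_disc p v \<Longrightarrow> D (padic_exp y) = padic_exp y * D y"
    using assms(3)
    by (auto simp: exponentially_transcendental_def exp_constants_def exp_derivations_def)
  have fam: "\<forall>i\<in>{1..n}. c i = 0" if "(\<Sum>i\<in>{1..n}. rat_scale (c i) (x i)) = 0" for c
    using assms(5) that by (simp add: rat_independent_def rat_scale_def)
  define V where "V = x ` {1..n}"
  \<comment> \<open>A rationally independent family has no repetitions, hence
    \<open>card V = n\<close>.\<close>
  have V: "finite V" "rat.independent V" "card V = n"
    using rat.independent_familyI[where f = x and I = "{1..n}", OF _ fam]
    by (auto simp: V_def card_image)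
  \<comment> \<open>The disc is stable under multiplication by \<open>l\<close>:
    \<open>v (x i)\<close> is nonnegative, so v(l x i) \<ge> v l.\<close>
  have disc: "w \<in> exp_disc p v" if w: "w \<in> V \<union> (*) l ` V" for w
  proof -
    have "0 \<le> 1 / (real p - 1)" using prime_gt_1_nat[OF prime_p] by simp
    then have 0: "0 \<le> ereal (1 / (real p - 1))" by simp
    from w consider i where "i \<in> {1..n}" "w = x i" | i where "i \<in> {1..n}" "w = l * x i"
      by (auto simp: V_def)
    then show ?thesis
    proof cases
      case 1
      then show ?thesis using assms(4) by simp
    next
      case 2
      have l: "ereal (1 / (real p - 1)) < v l" using assms(2) by (simp add: exp_disc_def)
      have "ereal (1 / (real p - 1)) < v (x i)" using assms(4)[OF 2(1)] by (simp add: exp_disc_def)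
      then have "0 \<le> v (x i)" by (intro order_trans[OF 0 less_imp_le])
      then have "v l \<le> v l + v (x i)" by (metis add.right_neutral add_left_mono)
      then show ?thesis using l by (simp add: exp_disc_def 2(2) v_mult)
    qed
  qed
  obtain S where S: "S \<subseteq> padic_exp ` (V \<union> (*) l ` V)" "finite S" "card V \<le> card S"
    "alg_independent (rat_adjoin {l}) S"
    by (rule independent_exponentials[OF D V(1,2), of padic_exp])
      (auto intro!: padic_exp_nonzero Dexp disc)
  let ?G = "{l} \<union> (\<lambda>i. padic_exp (x i)) ` {1..n} \<union> (\<lambda>i. padic_exp (l * x i)) ` {1..n}"
  have "S \<subseteq> ?G" using S(1) by (auto simp: V_def)
  then have "S \<subseteq> rat_adjoin ?G" by (auto intro: generate_field.incl)
  then have "enat (card S) \<le> tr_deg (rat_adjoin {l}) (rat_adjoin ?G)"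
    unfolding tr_deg_def using S by (intro Sup_upper) auto
  moreover have "enat n \<le> enat (card S)" using S(3) V(3) by simp
  ultimately show ?thesis by (rule order_trans[rotated])
qed

end
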